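(* Let $\gamma$ be a Radon centered Gaussian measure on a real Hausdorff locally convex space $X$. For every function $f\in L^2(\gamma)$ and every integer $N\ge1$, $$ E_N(f)\le\sigma_{\gamma,2}\bigl(f,\sqrt{2\pi}\,N^{-1/2}\bigr). $$
   Context: $X^*$ is the topological dual of $X$. A Radon measure $\gamma$ on $X$ is centered Gaussian if for every $l\in X^*$ the image measure $\gamma\circ l^{-1}$ is either Dirac's measure at $0$ or a centered Gaussian measure on $\mathbb{R}$. The Cameron--Martin space is $H=\{h\in X: |h|_H<\infty\}$, $|h|_H=\sup\{l(h): l\in X^*,\ \int_X l^2d\gamma\le1\}$; it is a separable Hilbert space with inner product $\langle\cdot,\cdot\rangle_H$. $\mathcal{FC}^\infty(X)$ is the set of functions $\varphi(x)=\psi(l_1(x),\dots,l_n(x))$ with $\psi\in C_b^\infty(\mathbb{R}^n)$ (bounded with all derivatives bounded), $l_i\in X^*$. $\mathcal{FC}^\infty(X,H)$ is the set of vector fields $\Phi(x)=\sum_{i=1}^n\Psi_i(g_1(x),\dots,g_n(x))h_i$ with $\Psi_i\in C_b^\infty(\mathbb{R}^n)$, $g_i\in X^*$, $h_i\in H$; $\mathcal{FC}_0^\infty(X,H)$ is the subset of those for which the $\Psi_i$ can be chosen with compact support. For $\varphi=\psi(l_1,\dots,l_n)$, $\nabla\varphi=\sum_j\partial_{x_j}\psi(l_1,\dots,l_n)e_j$, where $l_i\in X^*$ are orthonormal in $L^2(\gamma)$ and $e_i\in H$ are orthonormal in $H$ with $l_i(e_j)=\delta_{ij}$. The Gaussian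 divergence $\mathrm{div}_\gamma\Phi$ is defined by $\int(\mathrm{div}_\gamma\Phi)\varphi\,d\gamma=-\int\langle\Phi,\nabla\varphi\rangle_H\,d\gamma$ for all $\varphi\in\mathcal{FC}^\infty(X)$; for $\Phi=\sum_i\Psi_i(l_1,\dots,l_n)e_i$ with such $l_i,e_i$ one has $\mathrm{div}_\gamma\Phi=\sum_j[\partial_{x_j}\Psi_j(l_1,\dots,l_n)-l_j\Psi_j(l_1,\dots,l_n)]$. $\|\cdot\|_2$ is the $L^2(\gamma)$-norm, and $\|\Phi\|_2$ is the $L^2(\gamma)$-norm of $|\Phi|_H$. For real-valued $f\in L^2(\gamma)$ set $$\sigma_{\gamma,2}(f,\varepsilon):=\sup\Bigl\{\int\mathrm{div}_\gamma\Phi\, f\,d\gamma:\ \Phi\in\mathcal{FC}_0^\infty(X,H),\ \|\mathrm{div}_\gamma\Phi\|_2\le1,\ \|\Phi\|_2\le\varepsilon\Bigr\}.$$ Let $L^2(\gamma)=\bigoplus_{k=0}^\infty\mathcal{H}_k$ be the Wiener chaos decomposition: $\mathcal{H}_0$ is the space of constants and, for $k\ge1$, $\mathcal{H}_k$ is the orthogonal complement of the space of measurable polynomials of degree at most $k-1$ in the space of measurable polynomials of degree at most $k$, where the space of measurable polynomials of degree at most $k$ is the closure in $L^2(\gamma)$ of the set of polynomials of degree at most $k$ in finitely many functionals from $X^*$. Set $$E_N(f):=\inf\Bigl\{\|f-f_N\|_2:\ f_N\in\bigoplus_{k=0}^{N-1}\mathcal{H}_k\Bigr\}.$$ *)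

theory Defs
  imports "HOL-Probability.Probability"
begin

section \<open>Hausdorff locally convex spaces and Gaussian measures\<close>

text \<open>The last condition on \<open>V\<close> is \<^const>\<open>convex\<close> unfolded, as that constant is not available
  for the type of the class being declared.\<close>

class hausdorff_locally_convex = real_vector + topological_ab_group_add + t2_space +
  assumes tendsto_scaleR_nhds: "LIM p (nhds c \<times>\<^sub>F nhds x). fst p *\<^sub>R snd p :> nhds (c *\<^sub>R x)"
    and convex_nhds_0: "open U \<Longrightarrow> 0 \<in> U \<Longrightarrow> \<exists>V. open V \<and> 0 \<in> V \<and> V \<subseteq> U \<and>
      (\<forall>x\<in>V. \<forall>y\<in>V. \<forall>u\<ge>0. \<forall>v\<ge>0. u + v = 1 \<longrightarrow> u *\<^sub>R x + v *\<^sub>R y \<in> V)"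

definition top_dual :: "('a::hausdorff_locally_convex \<Rightarrow> real) set" where
  "top_dual = {l. linear l \<and> continuous_on UNIV l}"

definition radon_measure :: "'a::t2_space measure \<Rightarrow> bool" where
  "radon_measure \<gamma> \<longleftrightarrow> sets \<gamma> = sets borel \<and> finite_measure \<gamma> \<and>
     (\<forall>B\<in>sets \<gamma>. \<forall>\<epsilon>>0. \<exists>K. compact K \<and> K \<subseteq> B \<and> measure \<gamma> (B - K) < \<epsilon>)"

definition centered_gaussian :: "'a::hausdorff_locally_convex measure \<Rightarrow> bool" where
  "centered_gaussian \<gamma> \<longleftrightarrow>
     (\<forall>l\<in>top_dual. distr \<gamma> borel l = return borel 0 \<or>
        (\<exists>s>0. distr \<gamma> borel l = density lborel (normal_density 0 s)))"

text \<open>Elements of \<open>L\<^sup>2(\<gamma>)\<close> are represented by functions, not by classes modulo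
  almost everywhere equality.\<close>

definition L2_space :: "'a measure \<Rightarrow> ('a \<Rightarrow> real) set" where
  "L2_space \<gamma> = {f \<in> borel_measurable \<gamma>. integrable \<gamma> (\<lambda>x. (f x)\<^sup>2)}"

definition L2_norm :: "'a measure \<Rightarrow> ('a \<Rightarrow> real) \<Rightarrow> real" where
  "L2_norm \<gamma> f = sqrt (\<integral>x. (f x)\<^sup>2 \<partial>\<gamma>)"


section \<open>The Cameron--Martin space\<close>

definition cm_enorm :: "'a::hausdorff_locally_convex measure \<Rightarrow> 'a \<Rightarrow> ereal" where
  "cm_enorm \<gamma> h =
     (SUP l\<in>{l\<in>top_dual. l \<in> L2_space \<gamma> \<and> (\<integral>x. (l x)\<^sup>2 \<partial>\<gamma>) \<le> 1}. ereal (l h))"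

definition cm_space :: "'a::hausdorff_locally_convex measure \<Rightarrow> 'a set" where
  "cm_space \<gamma> = {h. cm_enorm \<gamma> h < \<infinity>}"

definition cm_norm :: "'a::hausdorff_locally_convex measure \<Rightarrow> 'a \<Rightarrow> real" where
  "cm_norm \<gamma> h = real_of_ereal (cm_enorm \<gamma> h)"

text \<open>The inner product is recovered from the Hilbert norm by polarization; it is meaningful
  only for arguments in \<^term>\<open>cm_space \<gamma>\<close>.\<close>

definition cm_inner :: "'a::hausdorff_locally_convex measure \<Rightarrow> 'a \<Rightarrow> 'a \<Rightarrow> real" where
  "cm_inner \<gamma> h k = ((cm_norm \<gamma> (h + k))\<^sup>2 - (cm_norm \<gamma> (h - k))\<^sup>2) / 4"


section \<open>Smooth functions of finitely many real variables\<close>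

text \<open>Since the number \<open>n\<close> of variables is quantified inside the definitions below, a function
  on \<open>\<real>\<^sup>n\<close> is encoded as a function of \<open>x :: nat \<Rightarrow> real\<close> that depends on \<open>x 0, \<dots>, x (n - 1)\<close>
  only. For such functions, continuity in the product topology of \<^typ>\<open>nat \<Rightarrow> real\<close> is
  continuity on \<open>\<real>\<^sup>n\<close>.\<close>

definition depends_on_first :: "nat \<Rightarrow> ((nat \<Rightarrow> real) \<Rightarrow> real) \<Rightarrow> bool" where
  "depends_on_first n \<psi> \<longleftrightarrow> (\<forall>x y. (\<forall>i<n. x i = y i) \<longrightarrow> \<psi> x = \<psi> y)"

definition partial :: "nat \<Rightarrow> ((nat \<Rightarrow> real) \<Rightarrow> real) \<Rightarrow> (nat \<Rightarrow> real) \<Rightarrow> real" where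
  "partial i \<psi> x = deriv (\<lambda>t. \<psi> (x(i := t))) (x i)"

primrec partials :: "nat list \<Rightarrow> ((nat \<Rightarrow> real) \<Rightarrow> real) \<Rightarrow> (nat \<Rightarrow> real) \<Rightarrow> real" where
  "partials [] \<psi> = \<psi>"
| "partials (i # is) \<psi> = partial i (partials is \<psi>)"

definition smooth :: "nat \<Rightarrow> ((nat \<Rightarrow> real) \<Rightarrow> real) set" where
  "smooth n = {\<psi>. depends_on_first n \<psi> \<and>
     (\<forall>is. set is \<subseteq> {..<n} \<longrightarrow> continuous_on UNIV (partials is \<psi>) \<and>
        (\<forall>i<n. \<forall>x. (\<lambda>t. partials is \<psi> (x(i := t))) field_differentiable at (x i)))}"

definition Cb_inf :: "nat \<Rightarrow> ((nat \<Rightarrow> real) \<Rightarrow> real) set" where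
  "Cb_inf n = {\<psi> \<in> smooth n. \<forall>is. set is \<subseteq> {..<n} \<longrightarrow> bounded (range (partials is \<psi>))}"

text \<open>Compact support in \<open>\<real>\<^sup>n\<close>, not in the product space \<^typ>\<open>nat \<Rightarrow> real\<close>.\<close>

definition compact_supp :: "nat \<Rightarrow> ((nat \<Rightarrow> real) \<Rightarrow> real) \<Rightarrow> bool" where
  "compact_supp n \<psi> \<longleftrightarrow> (\<exists>R. \<forall>x. (\<exists>i<n. \<bar>x i\<bar> > R) \<longrightarrow> \<psi> x = 0)"


section \<open>Cylindrical functions and vector fields, gradient, divergence\<close>

definition FC_inf :: "('a::hausdorff_locally_convex \<Rightarrow> real) set" where
  "FC_inf = {\<phi>. \<exists>n \<psi> l. \<psi> \<in> Cb_inf n \<and> (\<forall>i<n. l i \<in> top_dual) \<and>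
     \<phi> = (\<lambda>x. \<psi> (\<lambda>i. l i x))}"

definition FC0_inf_vec :: "'a::hausdorff_locally_convex measure \<Rightarrow> ('a \<Rightarrow> 'a) set" where
  "FC0_inf_vec \<gamma> = {\<Phi>. \<exists>n \<Psi> g h.
     (\<forall>i<n. \<Psi> i \<in> Cb_inf n \<and> compact_supp n (\<Psi> i) \<and> g i \<in> top_dual \<and> h i \<in> cm_space \<gamma>) \<and>
     \<Phi> = (\<lambda>x. \<Sum>i<n. \<Psi> i (\<lambda>j. g j x) *\<^sub>R h i)}"

definition dual_orthonormal ::
    "'a::hausdorff_locally_convex measure \<Rightarrow> nat \<Rightarrow> (nat \<Rightarrow> 'a \<Rightarrow> real) \<Rightarrow> (nat \<Rightarrow> 'a) \<Rightarrow> bool" where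
  "dual_orthonormal \<gamma> n l e \<longleftrightarrow>
     (\<forall>i<n. l i \<in> top_dual \<and> e i \<in> cm_space \<gamma>) \<and>
     (\<forall>i<n. \<forall>j<n. (\<integral>x. l i x * l j x \<partial>\<gamma>) = of_bool (i = j) \<and>
        cm_inner \<gamma> (e i) (e j) = of_bool (i = j) \<and> l i (e j) = of_bool (i = j))"

text \<open>\<^term>\<open>FC_inf\<close> allows functionals that are linearly dependent in \<open>L\<^sup>2(\<gamma>)\<close> (for instance
  nonzero ones vanishing almost everywhere), so that a representation through orthonormal
  functionals exists in general only up to almost everywhere equality, and the gradient is
  determined almost everywhere.\<close>

definition has_gradient ::
    "'a::hausdorff_locally_convex measure \<Rightarrow> ('a \<Rightarrow> real) \<Rightarrow> ('a \<Rightarrow> 'a) \<Rightarrow> bool" where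
  "has_gradient \<gamma> \<phi> G \<longleftrightarrow> (\<exists>n \<psi> l e. \<psi> \<in> Cb_inf n \<and> dual_orthonormal \<gamma> n l e \<and>
     (AE x in \<gamma>. \<phi> x = \<psi> (\<lambda>i. l i x)) \<and>
     G = (\<lambda>x. \<Sum>j<n. partial j \<psi> (\<lambda>i. l i x) *\<^sub>R e j))"

text \<open>\<open>v\<close> is a version of the divergence of \<open>\<Phi>\<close>; it is unique up to almost everywhere
  equality because \<^term>\<open>FC_inf\<close> is dense in \<open>L\<^sup>2(\<gamma>)\<close>.\<close>

definition has_gauss_div ::
    "'a::hausdorff_locally_convex measure \<Rightarrow> ('a \<Rightarrow> 'a) \<Rightarrow> ('a \<Rightarrow> real) \<Rightarrow> bool" where
  "has_gauss_div \<gamma> \<Phi> v \<longleftrightarrow> v \<in> L2_space \<gamma> \<and>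
     (\<forall>\<phi>\<in>FC_inf. \<forall>G. has_gradient \<gamma> \<phi> G \<longrightarrow>
        (\<integral>x. v x * \<phi> x \<partial>\<gamma>) = - (\<integral>x. cm_inner \<gamma> (\<Phi> x) (G x) \<partial>\<gamma>))"

definition sigma2 ::
    "'a::hausdorff_locally_convex measure \<Rightarrow> ('a \<Rightarrow> real) \<Rightarrow> real \<Rightarrow> ereal" where
  "sigma2 \<gamma> f \<epsilon> = Sup {ereal (\<integral>x. v x * f x \<partial>\<gamma>) | \<Phi> v.
     \<Phi> \<in> FC0_inf_vec \<gamma> \<and> has_gauss_div \<gamma> \<Phi> v \<and>
     L2_norm \<gamma> v \<le> 1 \<and> L2_norm \<gamma> (\<lambda>x. cm_norm \<gamma> (\<Phi> x)) \<le> \<epsilon>}"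


section \<open>Wiener chaos and best approximation\<close>

definition cyl_polys :: "nat \<Rightarrow> ('a::hausdorff_locally_convex \<Rightarrow> real) set" where
  "cyl_polys k = {p. \<exists>n l A c. (\<forall>i<n. l i \<in> top_dual) \<and>
     finite A \<and> (\<forall>\<alpha>\<in>A. (\<Sum>i<n. \<alpha> i) \<le> k) \<and>
     p = (\<lambda>x. \<Sum>\<alpha>\<in>A. c (\<alpha> :: nat \<Rightarrow> nat) * (\<Prod>i<n. l i x ^ \<alpha> i))}"

definition meas_polys ::
    "'a::hausdorff_locally_convex measure \<Rightarrow> nat \<Rightarrow> ('a \<Rightarrow> real) set" where
  "meas_polys \<gamma> k =
     {f \<in> L2_space \<gamma>. \<forall>\<epsilon>>0. \<exists>p\<in>cyl_polys k. L2_norm \<gamma> (\<lambda>x. f x - p x) < \<epsilon>}"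

fun chaos :: "'a::hausdorff_locally_convex measure \<Rightarrow> nat \<Rightarrow> ('a \<Rightarrow> real) set" where
  "chaos \<gamma> 0 = {f \<in> L2_space \<gamma>. \<exists>c. AE x in \<gamma>. f x = c}"
| "chaos \<gamma> (Suc k) =
     {f \<in> meas_polys \<gamma> (Suc k). \<forall>g\<in>meas_polys \<gamma> k. (\<integral>x. f x * g x \<partial>\<gamma>) = 0}"

definition chaos_sum :: "'a::hausdorff_locally_convex measure \<Rightarrow> nat \<Rightarrow> ('a \<Rightarrow> real) set" where
  "chaos_sum \<gamma> N = {(\<lambda>x. \<Sum>k<N. u k x) | u. \<forall>k<N. u k \<in> chaos \<gamma> k}"

definition best_approx ::
    "'a::hausdorff_locally_convex measure \<Rightarrow> nat \<Rightarrow> ('a \<Rightarrow> real) \<Rightarrow> ereal" where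
  "best_approx \<gamma> N f = (INF u\<in>chaos_sum \<gamma> N. ereal (L2_norm \<gamma> (\<lambda>x. f x - u x)))"

end

theory Submission
  imports Defs "HOL-Complex_Analysis.Conformal_Mappings"
begin

text \<open>
  The chaos of order \<open>k\<close> is the eigenspace of the Ornstein--Uhlenbeck operator
  \<open>L = div \<nabla>\<close> for the eigenvalue \<open>- k\<close>. If \<open>q = f - P f\<close> is the part of \<open>f\<close> in the chaoses of
  order at least \<open>N\<close>, then \<open>\<Phi> = \<nabla> L\<^sup>-\<^sup>1 q\<close> has divergence \<open>q\<close>, and
  \<open>\<parallel>\<Phi>\<parallel>\<^sup>2 = \<Sum>k\<ge>N. \<parallel>q\<^sub>k\<parallel>\<^sup>2 / k \<le> \<parallel>q\<parallel>\<^sup>2 / N\<close>. Testing \<open>f\<close> against the divergence of \<open>\<Phi> / \<parallel>q\<parallel>\<close> gives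
  \<open>\<parallel>q\<parallel> = E\<^sub>N(f)\<close>. Hence the estimate holds with \<open>N\<^sup>-\<^sup>1\<^sup>/\<^sup>2\<close> in the second argument of \<open>\<sigma>\<close>, which is increasing in it,
  and \<open>\<surd>(2\<pi>) \<ge> 1\<close>.

  Everything is made explicit with the functions \<open>H\<^sub>k(l)\<close>, where \<open>l\<close> is a continuous linear
  functional and \<open>H\<^sub>k\<close> the Hermite polynomial for the variance of \<open>l\<close>. Let \<open>h\<^sub>l\<close> be the vector of the
  Cameron--Martin space that represents \<open>l\<close>, so that \<open>m(h\<^sub>l) = \<integral> l m d\<gamma>\<close> for all functionals \<open>m\<close>.
  Gaussian integration by parts says \<open>H\<^sub>k(l) = - div (H\<^sub>k\<^sub>-\<^sub>1(l) h\<^sub>l)\<close>, and it implies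
  \<open>\<integral> H\<^sub>j(l) H\<^sub>k(m) d\<gamma> = \<delta>\<^sub>j\<^sub>k k! (\<integral> l m d\<gamma>)\<^sup>k\<close>
  (\<open>herm_orthogonality\<close>) and the orthogonality of \<open>H\<^sub>k(l)\<close> to all polynomials of degree less than
  \<open>k\<close>. So a finite sum \<open>\<Sum>i. c\<^sub>i H\<^bsub>k(i)\<^esub>(l\<^sub>i)\<close> splits into chaos components by sorting its terms, on
  which \<open>\<nabla> L\<^sup>-\<^sup>1\<close> acts explicitly: the field is \<open>- \<Sum>i. c\<^sub>i H\<^bsub>k(i)-1\<^esub>(l\<^sub>i) h\<^bsub>l(i)\<^esub>\<close>. Since
  \<open>\<langle>h\<^sub>l, h\<^sub>m\<rangle> = \<integral> l m d\<gamma>\<close>, the same orthogonality relation computes its energy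
  (\<open>integral_field_energy_le\<close>). A smooth cutoff makes the field compactly supported at a small
  cost in the divergence (\<open>hsum_approx_by_divergence\<close>).

  Three facts about Radon Gaussian measures are used. The sums above are dense in \<open>L\<^sup>2(\<gamma>)\<close>
  (\<open>herm_span_dense\<close>): powers of \<open>l\<close> converge to \<open>cos l\<close> and \<open>sin l\<close>, and trigonometric functions of
  functionals approximate indicators by the Stone--Weierstrass theorem on compact sets,
  because functionals separate points (the Hahn--Banach theorem). The vector \<open>h\<^sub>l\<close> exists in the
  space itself (\<open>ex_representer\<close>); as the space may be incomplete, this is not a matter of
  integrating \<open>x l(x)\<close>, and compactness of the sets that carry \<open>\<gamma>\<close> is used instead. Finally, the
  translate of \<open>\<gamma>\<close> by \<open>h\<^sub>l\<close> has density \<open>exp (l - \<integral> l\<^sup>2 d\<gamma> / 2)\<close> (\<open>cameron_martin\<close>), which yields integration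
  by parts by differentiation.
\<close>

section \<open>Separation of points by continuous functionals\<close>

text \<open>Positive homogeneity is only required as an inequality; applying it to a factor and to its
  inverse gives the equality.\<close>

definition sublinear :: "('a::real_vector \<Rightarrow> real) \<Rightarrow> bool" where
  "sublinear q \<longleftrightarrow> (\<forall>x y. q (x + y) \<le> q x + q y) \<and> (\<forall>t\<ge>0. \<forall>x. q (t *\<^sub>R x) \<le> t * q x)"

lemma sublinearD:
  assumes "sublinear q"
  shows "q (x + y) \<le> q x + q y" and "t \<ge> 0 \<Longrightarrow> q (t *\<^sub>R x) \<le> t * q x"
    and "q 0 = 0" and "- q (- x) \<le> q x"
proof -
  show add: "q (x + y) \<le> q x + q y" for x y using assms by (auto simp: sublinear_def)
  show sc: "t \<ge> 0 \<Longrightarrow> q (t *\<^sub>R x) \<le> t * q x" for t x using assms by (auto simp: sublinear_def)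
  show z: "q 0 = 0" using sc[of 0 0] add[of 0 0] by simp
  show "- q (- x) \<le> q x" using add[of x "- x"] z by simp
qed

text \<open>The function \<open>r x = (INF t\<ge>0. q (x + t y) - t q(y))\<close> is sublinear and lies below \<open>q\<close>. It is as
  linear as possible in the direction \<open>y\<close>. This single construction serves twice: it shows that
  minimal sublinear functions are linear, and it fixes the value of the functional at a point.\<close>

lemma sublinear_directional_improvement:
  assumes q: "sublinear q"
  obtains r where "sublinear r" "\<And>x. r x \<le> q x" "\<And>x. r (x - y) \<le> q x - q y"
proof -
  define S where "S x = (\<lambda>t. q (x + t *\<^sub>R y) - t * q y) ` {0..}" for x
  define r where "r x = Inf (S x)" for x
  have low: "- q (- x) \<le> q (x + t *\<^sub>R y) - t * q y" if "t \<ge> 0" for x t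
  proof -
    have "t * q y \<le> q (t *\<^sub>R y)"
    proof (cases "t = 0")
      case False
      have "t * q ((1/t) *\<^sub>R (t *\<^sub>R y)) \<le> t * ((1/t) * q (t *\<^sub>R y))"
        using sublinearD(2)[OF q, of "1/t" "t *\<^sub>R y"] that False by (intro mult_left_mono) auto
      then show ?thesis using False by simp
    qed (simp add: sublinearD(3)[OF q])
    also have "\<dots> = q ((x + t *\<^sub>R y) + (- x))" by simp
    also have "\<dots> \<le> q (x + t *\<^sub>R y) + q (- x)" by (rule sublinearD[OF q])
    finally show ?thesis by simp
  qed
  have bdd: "bdd_below (S x)" for x
    unfolding S_def by (rule bdd_belowI[of _ "- q (- x)"]) (auto intro: low)
  have le: "r x \<le> q (x + t *\<^sub>R y) - t * q y" if "t \<ge> 0" for x t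
    unfolding r_def using that by (intro cInf_lower bdd) (auto simp: S_def)
  have ge: "c \<le> r x" if "\<And>t. t \<ge> 0 \<Longrightarrow> c \<le> q (x + t *\<^sub>R y) - t * q y" for c x
    unfolding r_def using that by (intro cInf_greatest) (auto simp: S_def)
  have "sublinear r"
    unfolding sublinear_def
  proof (intro conjI allI impI)
    fix x z
    have *: "r (x + z) - (q (z + s *\<^sub>R y) - s * q y) \<le> r x" if "s \<ge> 0" for s
    proof (rule ge)
      fix t :: real assume "t \<ge> 0"
      have "r (x + z) \<le> q ((x + z) + (t + s) *\<^sub>R y) - (t + s) * q y"
        using \<open>t \<ge> 0\<close> that by (intro le) auto
      also have "\<dots> = q ((x + t *\<^sub>R y) + (z + s *\<^sub>R y)) - (t + s) * q y"
        by (simp add: algebra_simps)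
      also have "\<dots> \<le> q (x + t *\<^sub>R y) + q (z + s *\<^sub>R y) - (t + s) * q y"
        using sublinearD(1)[OF q, of "x + t *\<^sub>R y" "z + s *\<^sub>R y"] by linarith
      finally show "r (x + z) - (q (z + s *\<^sub>R y) - s * q y) \<le> q (x + t *\<^sub>R y) - t * q y"
        by (simp add: algebra_simps)
    qed
    have "r (x + z) - r x \<le> r z"
      by (rule ge) (use * in \<open>simp add: algebra_simps\<close>)
    then show "r (x + z) \<le> r x + r z" by simp
  next
    fix t :: real and x assume t: "t \<ge> 0"
    show "r (t *\<^sub>R x) \<le> t * r x"
    proof (cases "t = 0")
      case True
      then show ?thesis using le[of 0 0] sublinearD(3)[OF q] by simp
    next
      case False
      have "r (t *\<^sub>R x) / t \<le> r x"
      proof (rule ge)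
        fix s :: real assume "s \<ge> 0"
        have "r (t *\<^sub>R x) \<le> q (t *\<^sub>R x + (t * s) *\<^sub>R y) - (t * s) * q y"
          using t \<open>s \<ge> 0\<close> by (intro le) auto
        also have "\<dots> = q (t *\<^sub>R (x + s *\<^sub>R y)) - t * (s * q y)" by (simp add: algebra_simps)
        also have "\<dots> \<le> t * q (x + s *\<^sub>R y) - t * (s * q y)"
          using sublinearD(2)[OF q t] by simp
        finally show "r (t *\<^sub>R x) / t \<le> q (x + s *\<^sub>R y) - s * q y"
          using False t by (simp add: field_simps)
      qed
      then show ?thesis using False t by (simp add: field_simps)
    qed
  qed
  moreover have "r x \<le> q x" for x using le[of 0 x] by simp
  moreover have "r (x - y) \<le> q x - q y" for x using le[of 1 "x - y"] by simp
  ultimately show ?thesis by (rule that)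
qed

lemma minimal_sublinear_imp_linear:
  assumes q: "sublinear q"
    and min: "\<And>r. sublinear r \<Longrightarrow> (\<And>x. r x \<le> q x) \<Longrightarrow> r = q"
  shows "linear q"
proof -
  have add': "q (x - y) \<le> q x - q y" for x y
  proof -
    obtain r where "sublinear r" "\<And>x. r x \<le> q x" "\<And>x. r (x - y) \<le> q x - q y"
      using sublinear_directional_improvement[OF q, where y = y] by metis
    then show ?thesis using min by metis
  qed
  have add: "q (x + y) = q x + q y" for x y
    using add'[of "x + y" y] sublinearD(1)[OF q, of x y] by simp
  have neg: "q (- x) = - q x" for x
    using add[of x "- x"] sublinearD(3)[OF q] by simp
  have pos: "q (t *\<^sub>R x) = t * q x" if "t \<ge> 0" for t x
    using sublinearD(2)[OF q that, of x] sublinearD(2)[OF q that, of "- x"]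
    by (simp add: neg)
  have "q (t *\<^sub>R x) = t * q x" for t x
    using pos[of t x] pos[of "- t" x] by (cases "t \<ge> 0") (auto simp: neg)
  then show ?thesis by (intro linearI) (auto simp: add)
qed

text \<open>Zorn's lemma for the pointwise order: the infimum of a chain of sublinear functions below \<open>p\<close>
  is finite, because each of them is bounded below by \<open>- p (- x)\<close>.\<close>

lemma sublinear_dominates_linear:
  assumes p: "sublinear p"
  obtains l where "linear l" "\<And>x. l x \<le> p x"
proof -
  define A where "A = {q. sublinear q \<and> (\<forall>x. q x \<le> p x)}"
  define P :: "('a \<Rightarrow> real) \<Rightarrow> ('a \<Rightarrow> real) \<Rightarrow> bool" where "P a u \<longleftrightarrow> (\<forall>x. u x \<le> a x)" for a u
  have "\<exists>m\<in>A. \<forall>a\<in>A. P m a \<longrightarrow> a = m"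
  proof (rule predicate_Zorn)
    show "partial_order_on A (relation_of P A)"
    proof (rule partial_order_on_relation_ofI)
      fix a b c assume "P a b" "P b c"
      then show "P a c" unfolding P_def using order_trans by blast
    next
      fix a b assume "P a b" "P b a"
      then show "a = b" unfolding P_def by (intro ext order_antisym) auto
    qed (simp add: P_def)
  next
    fix C assume "C \<in> Chains (relation_of P A)"
    then have CA: "C \<subseteq> A" and ch: "\<forall>a\<in>C. \<forall>b\<in>C. P a b \<or> P b a"
      unfolding Chains_def relation_of_def by blast+
    show "\<exists>u\<in>A. \<forall>a\<in>C. P a u"
    proof (cases "C = {}")
      case True
      then show ?thesis using p by (auto simp: A_def)
    next
      case False
      define u where "u x = (INF q\<in>C. q x)" for x
      have bdd: "bdd_below ((\<lambda>q. q x) ` C)" for x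
      proof (rule bdd_belowI2[of _ "- p (- x)"])
        fix q assume "q \<in> C"
        then have "sublinear q" "q (- x) \<le> p (- x)" using CA by (auto simp: A_def)
        then show "- p (- x) \<le> q x" using sublinearD(4)[of q x] by linarith
      qed
      have le: "u x \<le> q x" if "q \<in> C" for q x
        unfolding u_def by (rule cINF_lower[OF bdd that])
      have ge: "c \<le> u x" if "\<And>q. q \<in> C \<Longrightarrow> c \<le> q x" for c x
        unfolding u_def using False that by (intro cINF_greatest) auto
      have "sublinear u"
        unfolding sublinear_def
      proof (intro conjI allI impI)
        fix x y
        have *: "u (x + y) - q2 y \<le> u x" if q2: "q2 \<in> C" for q2
        proof (rule ge)
          fix q1 assume "q1 \<in> C"
          then obtain q where q: "q \<in> C" "\<forall>x. q x \<le> q1 x" "\<forall>x. q x \<le> q2 x"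
            using ch \<open>q1 \<in> C\<close> q2 unfolding P_def by blast
          have "u (x + y) \<le> q (x + y)" by (rule le[OF q(1)])
          also have "\<dots> \<le> q x + q y"
            using q(1) CA by (intro sublinearD(1)) (auto simp: A_def)
          finally show "u (x + y) - q2 y \<le> q1 x" using q(2)[rule_format, of x] q(3)[rule_format, of y] by linarith
        qed
        have "u (x + y) - u x \<le> u y"
        proof (rule ge)
          fix q assume "q \<in> C"
          from *[OF this] show "u (x + y) - u x \<le> q y" by simp
        qed
        then show "u (x + y) \<le> u x + u y" by simp
      next
        fix t :: real and x assume t: "t \<ge> 0"
        have *: "u (t *\<^sub>R x) \<le> t * q x" if "q \<in> C" for q
        proof -
          have "sublinear q" using that CA by (auto simp: A_def)
          then show ?thesis using le[OF that, of "t *\<^sub>R x"] sublinearD(2)[of q t x] t by linarith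
        qed
        show "u (t *\<^sub>R x) \<le> t * u x"
        proof (cases "t = 0")
          case True
          then show ?thesis using * False by auto
        next
          case False
          have "u (t *\<^sub>R x) / t \<le> u x"
            by (rule ge) (use * t False in \<open>simp add: field_simps\<close>)
          then show ?thesis using False t by (simp add: field_simps)
        qed
      qed
      moreover have "u x \<le> p x" for x
      proof -
        obtain q where "q \<in> C" using False by blast
        moreover from this CA have "q x \<le> p x" by (auto simp: A_def)
        ultimately show ?thesis using le[of q x] by linarith
      qed
      ultimately show ?thesis using le by (auto simp: A_def P_def)
    qed
  qed
  then obtain m where m: "m \<in> A" "\<And>a. a \<in> A \<Longrightarrow> P m a \<Longrightarrow> a = m" by blast
  have "linear m"
  proof (rule minimal_sublinear_imp_linear)
    show "sublinear m" using m by (auto simp: A_def)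
    fix r assume "sublinear r" "\<And>x. r x \<le> m x"
    moreover have "r x \<le> p x" for x
      using \<open>\<And>x. r x \<le> m x\<close>[of x] m(1) by (force simp: A_def intro: order_trans)
    ultimately show "r = m" by (intro m(2)) (auto simp: A_def P_def)
  qed
  then show ?thesis using that[of m] m by (auto simp: A_def)
qed

text \<open>Every linear functional below the improvement of \<open>p\<close> in the direction \<open>y\<close> satisfies
  \<open>l (- y) \<le> - p y\<close>.\<close>

lemma hahn_banach_at_point:
  assumes p: "sublinear p"
  obtains l where "linear l" "\<And>x. l x \<le> p x" "l y = p y"
proof -
  obtain r where r: "sublinear r" "\<And>x. r x \<le> p x" "\<And>x. r (x - y) \<le> p x - p y"
    using sublinear_directional_improvement[OF p, where y = y] by metis
  obtain l where l: "linear l" "\<And>x. l x \<le> r x"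
    using sublinear_dominates_linear[OF r(1)] by metis
  have "l (0 - y) \<le> p 0 - p y" using l(2) r(3) order_trans by blast
  then have "p y \<le> l y"
    using sublinearD(3)[OF p] linear_neg[OF l(1)] by simp
  moreover have "l x \<le> p x" for x using l(2) r(2) order_trans by blast
  ultimately show ?thesis using l(1) that[of l] antisym by metis
qed

lemma continuous_on_scaleR_right:
  "continuous_on UNIV (\<lambda>x::'a::hausdorff_locally_convex. c *\<^sub>R x)"
proof (clarsimp simp: continuous_on_def)
  fix x :: 'a
  have "filterlim (\<lambda>y. (c, y)) (nhds c \<times>\<^sub>F nhds x) (at x)"
    by (intro filterlim_Pair tendsto_const tendsto_ident_at)
  from filterlim_compose[OF tendsto_scaleR_nhds this]
  show "((\<lambda>y. c *\<^sub>R y) \<longlongrightarrow> c *\<^sub>R x) (at x)" by simp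
qed

lemma tendsto_scaleR_left_0:
  "((\<lambda>t::real. t *\<^sub>R (x::'a::hausdorff_locally_convex)) \<longlongrightarrow> 0) (nhds 0)"
proof -
  have "filterlim (\<lambda>t::real. (t, x)) (nhds 0 \<times>\<^sub>F nhds x) (nhds 0)"
    by (intro filterlim_Pair tendsto_const filterlim_ident)
  from filterlim_compose[OF tendsto_scaleR_nhds this] show ?thesis by simp
qed

lemma linear_bounded_near_0_imp_continuous:
  fixes l :: "'a::hausdorff_locally_convex \<Rightarrow> real"
  assumes l: "linear l" and W: "open W" "0 \<in> W" "\<And>x. x \<in> W \<Longrightarrow> \<bar>l x\<bar> \<le> 1"
  shows "continuous_on UNIV l"
proof (clarsimp simp: continuous_on_def)
  fix x :: 'a
  have "\<forall>\<^sub>F y in at x. dist (l y) (l x) < e" if e: "e > 0" for e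
  proof -
    define U where "U = (\<lambda>y. (2 / e) *\<^sub>R (y - x)) -` W"
    have "continuous_on UNIV (\<lambda>y. (2 / e) *\<^sub>R (y - x))"
      by (rule continuous_on_compose2[OF continuous_on_scaleR_right]) (auto intro!: continuous_intros)
    then have "open U" unfolding U_def using W(1) by (simp add: open_vimage)
    moreover have "x \<in> U" using W(2) by (simp add: U_def)
    moreover have "dist (l y) (l x) < e" if "y \<in> U" for y
    proof -
      have "\<bar>l ((2 / e) *\<^sub>R (y - x))\<bar> \<le> 1" using that W(3) by (auto simp: U_def)
      also have "l ((2 / e) *\<^sub>R (y - x)) = (2 / e) * (l y - l x)"
        by (simp only: linear_scale[OF l] linear_diff[OF l] real_scaleR_def)
      finally show ?thesis using e by (simp add: abs_mult dist_real_def field_simps)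
    qed
    ultimately show ?thesis by (auto simp: eventually_at_topological)
  qed
  then show "(l \<longlongrightarrow> l x) (at x)" by (simp add: tendsto_iff)
qed

text \<open>Apply the Hahn--Banach theorem to the Minkowski gauge of a convex neighbourhood of \<open>0\<close> that does
  not contain \<open>x\<close>; the gauge is at least \<open>1\<close> at \<open>x\<close>, and a functional below the gauge is bounded near \<open>0\<close>.\<close>

theorem top_dual_separates_0:
  fixes x :: "'a::hausdorff_locally_convex"
  assumes "x \<noteq> 0"
  obtains l where "l \<in> top_dual" "l x \<noteq> 0"
proof -
  \<comment> \<open>\<open>p\<close> below is the Minkowski gauge of \<open>V\<close>\<close>
  obtain U where "open U" "0 \<in> U" "x \<notin> U"
    using separation_t1[of 0 x] assms by metis
  then obtain V where V: "open V" "0 \<in> V" "V \<subseteq> U"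
    "\<And>y z u v. y \<in> V \<Longrightarrow> z \<in> V \<Longrightarrow> u \<ge> 0 \<Longrightarrow> v \<ge> 0 \<Longrightarrow> u + v = 1 \<Longrightarrow> u *\<^sub>R y + v *\<^sub>R z \<in> V"
    using convex_nhds_0[of U] by metis
  have xV: "x \<notin> V" using V(3) \<open>x \<notin> U\<close> by blast
  define S where "S y = {t. t > 0 \<and> (1 / t) *\<^sub>R y \<in> V}" for y
  define p where "p y = Inf (S y)" for y
  have bdd: "bdd_below (S y)" for y by (rule bdd_belowI[of _ 0]) (auto simp: S_def)
  have ne: "S y \<noteq> {}" for y
  proof -
    have "\<forall>\<^sub>F t in nhds (0::real). t *\<^sub>R y \<in> V"
      using tendsto_scaleR_left_0[of y] V(1,2) by (auto simp: tendsto_def)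
    then obtain d where d: "d > 0" "\<And>t. dist t 0 < d \<Longrightarrow> t *\<^sub>R y \<in> V"
      unfolding eventually_nhds_metric by blast
    have "2 / d \<in> S y" using d(2)[of "d / 2"] d(1) by (simp add: S_def)
    then show ?thesis by blast
  qed
  have le: "p y \<le> t" if "t \<in> S y" for y t unfolding p_def by (rule cInf_lower[OF that bdd])
  have ge: "c \<le> p y" if "\<And>t. t \<in> S y \<Longrightarrow> c \<le> t" for c y
    unfolding p_def using that by (intro cInf_greatest ne)
  have "sublinear p"
    unfolding sublinear_def
  proof (intro conjI allI impI)
    fix y z
    have *: "p (y + z) - s \<le> p y" if s: "s \<in> S z" for s
    proof (rule ge)
      fix t assume t: "t \<in> S y"
      have st: "s > 0" "t > 0" using s t by (auto simp: S_def)
      have "(t / (t + s)) *\<^sub>R ((1 / t) *\<^sub>R y) + (s / (t + s)) *\<^sub>R ((1 / s) *\<^sub>R z) \<in> V"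
        using s t st by (intro V(4)) (auto simp: S_def add_divide_distrib[symmetric])
      moreover have "(t / (t + s)) *\<^sub>R ((1 / t) *\<^sub>R y) + (s / (t + s)) *\<^sub>R ((1 / s) *\<^sub>R z)
        = (1 / (t + s)) *\<^sub>R (y + z)"
        using st by (simp add: scaleR_add_right)
      ultimately have "t + s \<in> S (y + z)" using st by (simp add: S_def)
      from le[OF this] show "p (y + z) - s \<le> t" by simp
    qed
    have "p (y + z) - p y \<le> p z"
      by (rule ge) (use * in \<open>simp add: algebra_simps\<close>)
    then show "p (y + z) \<le> p y + p z" by simp
  next
    fix t :: real and y assume t: "t \<ge> 0"
    show "p (t *\<^sub>R y) \<le> t * p y"
    proof (cases "t = 0")
      case True
      have "p 0 \<le> e" if "e > 0" for e using le[of e 0] that V(2) by (simp add: S_def)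
      then have "p 0 \<le> 0" using field_le_epsilon[of "p 0" 0] by simp
      then show ?thesis using True by simp
    next
      case False
      have "p (t *\<^sub>R y) / t \<le> p y"
      proof (rule ge)
        fix s assume "s \<in> S y"
        then have "t * s \<in> S (t *\<^sub>R y)" using t False by (simp add: S_def)
        from le[OF this] show "p (t *\<^sub>R y) / t \<le> s" using t False by (simp add: field_simps)
      qed
      then show ?thesis using t False by (simp add: field_simps)
    qed
  qed
  then obtain l where l: "linear l" "\<And>y. l y \<le> p y" "l x = p x"
    using hahn_banach_at_point[where y = x] by metis
  have "1 \<le> p x"
  proof (rule ge, rule ccontr)
    fix t assume t: "t \<in> S x" "\<not> 1 \<le> t"
    then have "t *\<^sub>R ((1 / t) *\<^sub>R x) + (1 - t) *\<^sub>R 0 \<in> V"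
      using V(2) by (intro V(4)) (auto simp: S_def)
    then show False using t xV by (simp add: S_def)
  qed
  have p1: "l y \<le> 1" if "y \<in> V" for y
    using le[of 1 y] l(2)[of y] that by (simp add: S_def)
  have "continuous_on UNIV l"
  proof (rule linear_bounded_near_0_imp_continuous[OF l(1)])
    show "open (V \<inter> uminus -` V)"
      by (intro open_Int V(1) open_vimage) (auto intro!: continuous_intros)
    show "0 \<in> V \<inter> uminus -` V" using V(2) by simp
    show "\<bar>l y\<bar> \<le> 1" if "y \<in> V \<inter> uminus -` V" for y
      using p1[of y] p1[of "- y"] that linear_neg[OF l(1), of y] by simp
  qed
  then show ?thesis using that[of l] l \<open>1 \<le> p x\<close> by (simp add: top_dual_def)
qed

section \<open>Trigonometric functions and Radon measures\<close>

text \<open>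
  The trigonometric functions of a vector space \<open>G\<close> of real functions are the linear combinations
  of \<open>cos m\<close> and \<open>sin m\<close> with \<open>m \<in> G\<close>. Two choices of \<open>G\<close> occur: the continuous linear functionals on
  the space \<open>X\<close>, and a space of functionals on \<open>X \<times> \<real>\<close> that serves to find the vectors which
  represent functionals.
\<close>

locale phase_space =
  fixes G :: "('b::t2_space \<Rightarrow> real) set"
  assumes continuous_phase: "m \<in> G \<Longrightarrow> continuous_on UNIV m"
    and zero_phase: "(\<lambda>_. 0) \<in> G"
    and add_phase: "m \<in> G \<Longrightarrow> m' \<in> G \<Longrightarrow> (\<lambda>x. m x + m' x) \<in> G"
    and scale_phase: "m \<in> G \<Longrightarrow> (\<lambda>x. c * m x) \<in> G"
    and separating_phase: "x \<noteq> y \<Longrightarrow> \<exists>m\<in>G. m x \<noteq> m y"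

inductive_set trig_span :: "('b \<Rightarrow> real) set \<Rightarrow> ('b \<Rightarrow> real) set" for G where
  cos: "m \<in> G \<Longrightarrow> (\<lambda>x. cos (m x)) \<in> trig_span G"
| sin: "m \<in> G \<Longrightarrow> (\<lambda>x. sin (m x)) \<in> trig_span G"
| add: "t \<in> trig_span G \<Longrightarrow> u \<in> trig_span G \<Longrightarrow> (\<lambda>x. t x + u x) \<in> trig_span G"
| scale: "t \<in> trig_span G \<Longrightarrow> (\<lambda>x. c * t x) \<in> trig_span G"

context phase_space
begin

lemma continuous_trig: "t \<in> trig_span G \<Longrightarrow> continuous_on UNIV t"
  by (induction rule: trig_span.induct)
    (simp_all add: continuous_phase continuous_on_add continuous_on_mult_left continuous_on_cos continuous_on_sin)

lemma bounded_trig: "t \<in> trig_span G \<Longrightarrow> \<exists>C. \<forall>x. \<bar>t x\<bar> \<le> C"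
proof (induction rule: trig_span.induct)
  case (add t u)
  then obtain C D where "\<And>x. \<bar>t x\<bar> \<le> C" "\<And>x. \<bar>u x\<bar> \<le> D" by blast
  then have "\<bar>t x + u x\<bar> \<le> C + D" for x
    by (meson abs_triangle_ineq add_mono order_trans)
  then show ?case by blast
next
  case (scale t c)
  then obtain C where "\<And>x. \<bar>t x\<bar> \<le> C" by blast
  then have "\<bar>c * t x\<bar> \<le> \<bar>c\<bar> * C" for x by (simp add: abs_mult mult_left_mono)
  then show ?case by blast
qed (auto intro!: exI[of _ 1])

lemma const_trig: "(\<lambda>_. c) \<in> trig_span G"
  using trig_span.scale[OF trig_span.cos[OF zero_phase], of c] by simp

lemma mult_trig:
  assumes t: "t \<in> trig_span G" and u: "u \<in> trig_span G"
  shows "(\<lambda>x. t x * u x) \<in> trig_span G"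
proof -
  have diff: "(\<lambda>x. m x - m' x) \<in> G" if "m \<in> G" "m' \<in> G" for m m'
    using add_phase[OF that(1) scale_phase[OF that(2), of "-1"]] by simp
  have sub: "(\<lambda>x. c * t x + d * u x) \<in> trig_span G"
    if "t \<in> trig_span G" "u \<in> trig_span G" for t u c d
    by (intro trig_span.add trig_span.scale that)
  \<comment> \<open>product-to-sum formulas\<close>
  have base: "(\<lambda>x. cos (m x) * cos (m' x)) \<in> trig_span G"
    "(\<lambda>x. cos (m x) * sin (m' x)) \<in> trig_span G"
    "(\<lambda>x. sin (m x) * cos (m' x)) \<in> trig_span G"
    "(\<lambda>x. sin (m x) * sin (m' x)) \<in> trig_span G" if "m \<in> G" "m' \<in> G" for m m'
    using sub[OF trig_span.cos[OF diff[OF that]] trig_span.cos[OF add_phase[OF that]], of "1/2" "1/2"]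
      sub[OF trig_span.sin[OF add_phase[OF that]] trig_span.sin[OF diff[OF that]], of "1/2" "-1/2"]
      sub[OF trig_span.sin[OF add_phase[OF that]] trig_span.sin[OF diff[OF that]], of "1/2" "1/2"]
      sub[OF trig_span.cos[OF diff[OF that]] trig_span.cos[OF add_phase[OF that]], of "1/2" "-1/2"]
    by (auto simp: cos_add cos_diff sin_add sin_diff field_simps)
  have aux: "(\<lambda>x. cos (m x) * u x) \<in> trig_span G \<and> (\<lambda>x. sin (m x) * u x) \<in> trig_span G"
    if m: "m \<in> G" for m
    using u
  proof induction
    case (add t u)
    then show ?case
      using trig_span.add[of "\<lambda>x. cos (m x) * t x" G "\<lambda>x. cos (m x) * u x"]
        trig_span.add[of "\<lambda>x. sin (m x) * t x" G "\<lambda>x. sin (m x) * u x"]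
      by (simp add: algebra_simps)
  next
    case (scale t c)
    then show ?case
      using trig_span.scale[of "\<lambda>x. cos (m x) * t x" G c]
        trig_span.scale[of "\<lambda>x. sin (m x) * t x" G c]
      by (simp add: algebra_simps)
  qed (auto intro: base m)
  from t show ?thesis
  proof induction
    case (add t t')
    then show ?case
      using trig_span.add[of "\<lambda>x. t x * u x" G "\<lambda>x. t' x * u x"] by (simp add: algebra_simps)
  next
    case (scale t c)
    then show ?case
      using trig_span.scale[of "\<lambda>x. t x * u x" G c] by (simp add: algebra_simps)
  qed (use aux in auto)
qed

lemma separating_trig:
  assumes "x \<noteq> y"
  obtains t where "t \<in> trig_span G" "t x \<noteq> t y"
proof -
  obtain m where m: "m \<in> G" "m x \<noteq> m y" using separating_phase[OF assms] by blast
  \<comment> \<open>rescale so that the two phases differ by exactly half a period\<close>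
  define c where "c = pi / (m x - m y)"
  have cm: "(\<lambda>z. c * m z) \<in> G" by (rule scale_phase[OF m(1)])
  have "c * m x = c * m y + pi" using m(2) by (simp add: c_def field_simps)
  then have *: "cos (c * m x) = - cos (c * m y)" "sin (c * m x) = - sin (c * m y)"
    by simp_all
  show ?thesis
  proof (cases "cos (c * m y) = 0")
    case True
    then have "sin (c * m y) \<noteq> 0" using sin_cos_squared_add[of "c * m y"] by auto
    then show ?thesis using that[OF trig_span.sin[OF cm]] * by simp
  next
    case False
    then show ?thesis using that[OF trig_span.cos[OF cm]] * by simp
  qed
qed

lemma polynomial_trig:
  assumes "real_polynomial_function p" and t: "t \<in> trig_span G"
  shows "(\<lambda>x. p (t x)) \<in> trig_span G"
  using assms(1)
proof induction
  case (linear f)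
  then obtain c where "f = (\<lambda>x. x * c)" using real_bounded_linear by blast
  then show ?case using trig_span.scale[OF t, of c] by (simp add: mult.commute)
qed (auto intro: const_trig mult_trig trig_span.add)

text \<open>The Stone--Weierstrass theorem gives a function with the right behaviour on the compact sets
  only. To integrate it, bounds on the whole space are needed. They come from composition with a
  polynomial, which does not leave the algebra of trigonometric functions.\<close>

lemma trig_separates_compacts:
  assumes K: "compact K" and L: "compact L" and KL: "K \<inter> L = {}" and e: "0 < e"
  obtains t where "t \<in> trig_span G" "\<And>x. - e \<le> t x" "\<And>x. t x \<le> 1 + e"
    "\<And>x. x \<in> K \<Longrightarrow> 1 - e \<le> t x" "\<And>x. x \<in> L \<Longrightarrow> t x \<le> e"
proof -
  define d where "d = min (e / 2) (1 / 2)"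
  have d: "0 < d" "d < 1" "d \<le> e / 2" using e by (auto simp: d_def)
  interpret function_ring_on "trig_span G" "K \<union> L"
  proof
    show "continuous_on (K \<union> L) f" if "f \<in> trig_span G" for f
      using continuous_trig[OF that] continuous_on_subset by blast
    show "\<exists>f\<in>trig_span G. f x \<noteq> f y" if "x \<noteq> y" for x y
      using separating_trig[OF that] by metis
  qed (use K L in \<open>auto intro: trig_span.add mult_trig const_trig\<close>)
  obtain f where f: "f \<in> trig_span G" "\<forall>x\<in>L. f x < d" "\<forall>x\<in>K. f x > 1 - d"
    using two[of L K d] K L KL d by (auto simp: compact_imp_closed Int_commute)
  obtain C where C: "\<And>x. \<bar>f x\<bar> \<le> C" using bounded_trig[OF f(1)] by blast
  \<comment> \<open>\<open>f\<close> is only controlled on the compacts; compose it with a polynomial that is uniformly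
    close on the range of \<open>f\<close> to the truncation of the real line to the unit interval\<close>
  define clamp where "clamp = (\<lambda>y::real. max 0 (min 1 y))"
  have "continuous_on {-C..C} clamp" unfolding clamp_def by (intro continuous_intros)
  then obtain p where p: "real_polynomial_function p" "\<And>y. y \<in> {-C..C} \<Longrightarrow> \<bar>clamp y - p y\<bar> < d"
    using Stone_Weierstrass_real_polynomial_function[of "{-C..C}" clamp d] d by auto
  have close: "\<bar>clamp (f x) - p (f x)\<bar> < d" for x
    using C[of x] by (intro p(2)) auto
  show ?thesis
  proof
    show "(\<lambda>x. p (f x)) \<in> trig_span G" by (rule polynomial_trig[OF p(1) f(1)])
    show "- e \<le> p (f x)" "p (f x) \<le> 1 + e" for x
      using close[of x] d e by (auto simp: clamp_def max_def min_def abs_if split: if_splits)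
    show "1 - e \<le> p (f x)" if "x \<in> K" for x
      using close[of x] d f(3)[rule_format, OF that]
      by (auto simp: clamp_def max_def min_def abs_if split: if_splits)
    show "p (f x) \<le> e" if "x \<in> L" for x
      using close[of x] d f(2)[rule_format, OF that]
      by (auto simp: clamp_def max_def min_def abs_if split: if_splits)
  qed
qed

lemma trig_measurable: "t \<in> trig_span G \<Longrightarrow> t \<in> borel_measurable borel"
  by (intro borel_measurable_continuous_onI continuous_trig)

text \<open>Exhaust both \<open>B\<close> and its complement by compact sets and separate these. Two measures are
  treated at once, since the comparison of measures needs the same function for both.\<close>

lemma trig_approximates_indicator:
  assumes \<mu>: "radon_measure \<mu>" and \<nu>: "radon_measure \<nu>" and B: "B \<in> sets borel" and e: "e > 0"
  obtains t where "t \<in> trig_span G" "\<And>x. \<bar>t x\<bar> \<le> 2"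
    "(\<integral>x. \<bar>t x - indicator B x\<bar> \<partial>\<mu>) < e" "(\<integral>x. \<bar>t x - indicator B x\<bar> \<partial>\<nu>) < e"
proof -
  \<comment> \<open>the four exceptional sets have mass at most \<open>d\<close>, and \<open>t\<close> misses the indicator by at most \<open>d\<close>
    off these sets and by at most \<open>1 + d \<le> 2\<close> on them\<close>
  define M where "M = 1 + measure \<mu> UNIV + measure \<nu> UNIV"
  have M: "M \<ge> 1" by (simp add: M_def)
  define d where "d = min 1 (e / (M + 16))"
  have d: "0 < d" "d \<le> 1" using e M by (auto simp: d_def)
  have dM: "d * (M + 16) \<le> e" using pos_le_divide_eq[of "M + 16" d e] M by (simp add: d_def)
  have inner: "\<exists>K. compact K \<and> K \<subseteq> A \<and> measure \<rho> (A - K) < d"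
    if "radon_measure \<rho>" "A \<in> sets borel" for \<rho> :: "'b measure" and A
    using that d(1) by (auto simp: radon_measure_def)
  have B': "- B \<in> sets borel" using B by auto
  obtain K1 where K1: "compact K1" "K1 \<subseteq> B" "measure \<mu> (B - K1) < d" using inner[OF \<mu> B] by blast
  obtain K2 where K2: "compact K2" "K2 \<subseteq> B" "measure \<nu> (B - K2) < d" using inner[OF \<nu> B] by blast
  obtain L1 where L1: "compact L1" "L1 \<subseteq> - B" "measure \<mu> (- B - L1) < d" using inner[OF \<mu> B'] by blast
  obtain L2 where L2: "compact L2" "L2 \<subseteq> - B" "measure \<nu> (- B - L2) < d" using inner[OF \<nu> B'] by blast
  obtain t where t: "t \<in> trig_span G" "\<And>x. - d \<le> t x" "\<And>x. t x \<le> 1 + d"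
    "\<And>x. x \<in> K1 \<union> K2 \<Longrightarrow> 1 - d \<le> t x" "\<And>x. x \<in> L1 \<union> L2 \<Longrightarrow> t x \<le> d"
    by (rule trig_separates_compacts[of "K1 \<union> K2" "L1 \<union> L2" d])
      (use K1 K2 L1 L2 d in auto)
  have est: "(\<integral>x. \<bar>t x - indicator B x\<bar> \<partial>\<rho>) < e"
    if \<rho>: "radon_measure \<rho>" and KL: "compact K" "K \<subseteq> K1 \<union> K2" "compact L" "L \<subseteq> L1 \<union> L2"
      and m: "measure \<rho> (B - K) < d" "measure \<rho> (- B - L) < d" and M': "measure \<rho> UNIV \<le> M - 1"
    for \<rho> :: "'b measure" and K L
  proof -
    have sets: "sets \<rho> = sets borel" and "finite_measure \<rho>" using \<rho> by (auto simp: radon_measure_def)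
    interpret finite_measure \<rho> by fact
    have [measurable_cong]: "sets \<rho> = sets borel" by fact
    have [measurable]: "t \<in> borel_measurable borel" by (rule trig_measurable[OF t(1)])
    have [measurable]: "B \<in> sets borel" "K \<in> sets borel" "L \<in> sets borel"
      using B KL by (auto simp: borel_compact)
    have meas: "B - K \<in> sets \<rho>" "- B - L \<in> sets \<rho>"
      unfolding sets using B KL by (auto simp: borel_compact)
    have spc: "space \<rho> = UNIV" using sets_eq_imp_space_eq[OF sets] by simp
    have ind: "integrable \<rho> (indicat_real (B - K))" "integrable \<rho> (indicat_real (- B - L))"
      using meas by (auto intro!: integrable_real_indicator simp: less_top[symmetric])
    have pw: "\<bar>t x - indicator B x\<bar> \<le> d + 2 * indicator (B - K) x + 2 * indicator (- B - L) x" for x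
    proof (cases "x \<in> B")
      case True
      then show ?thesis using t(2)[of x] t(3)[of x] t(4)[of x] KL(2) d
        by (auto simp: indicator_def)
    next
      case False
      then show ?thesis using t(2)[of x] t(3)[of x] t(5)[of x] KL(4) d
        by (auto simp: indicator_def)
    qed
    have "(\<integral>x. \<bar>t x - indicator B x\<bar> \<partial>\<rho>) \<le>
        (\<integral>x. d + 2 * indicator (B - K) x + 2 * indicator (- B - L) x \<partial>\<rho>)"
    proof (rule integral_mono)
      show "integrable \<rho> (\<lambda>x. \<bar>t x - indicator B x\<bar>)"
      proof (rule integrable_const_bound[of _ 3])
        show "AE x in \<rho>. norm \<bar>t x - indicator B x\<bar> \<le> 3"
        proof (rule AE_I2)
          fix x
          show "norm \<bar>t x - indicator B x\<bar> \<le> 3"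
            using t(2)[of x] t(3)[of x] d by (auto simp: indicator_def)
        qed
      qed measurable
      show "integrable \<rho> (\<lambda>x. d + 2 * indicator (B - K) x + 2 * indicator (- B - L) x)"
        using ind by simp
    qed (rule pw)
    also have "\<dots> = d * measure \<rho> UNIV + 2 * measure \<rho> (B - K) + 2 * measure \<rho> (- B - L)"
      using ind meas by (simp add: spc)
    also have "\<dots> < d * (M - 1) + 2 * d + 2 * d"
      using m mult_left_mono[OF M', of d] d by linarith
    also have "\<dots> \<le> d * (M + 16)" using d by (simp add: algebra_simps)
    also have "\<dots> \<le> e" by (rule dM)
    finally show ?thesis .
  qed
  show ?thesis
  proof (rule that[OF t(1)])
    show "\<bar>t x\<bar> \<le> 2" for x using t(2)[of x] t(3)[of x] d by auto
    show "(\<integral>x. \<bar>t x - indicator B x\<bar> \<partial>\<mu>) < e"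
      by (rule est[OF \<mu>, of K1 L1]) (use K1 L1 in \<open>auto simp: M_def\<close>)
    show "(\<integral>x. \<bar>t x - indicator B x\<bar> \<partial>\<nu>) < e"
      by (rule est[OF \<nu>, of K2 L2]) (use K2 L2 in \<open>auto simp: M_def\<close>)
  qed
qed

lemma integrable_trig:
  assumes "radon_measure \<mu>" "t \<in> trig_span G"
  shows "integrable \<mu> t"
proof -
  have sets: "sets \<mu> = sets borel" and "finite_measure \<mu>" using assms by (auto simp: radon_measure_def)
  interpret finite_measure \<mu> by fact
  obtain C where "\<And>x. \<bar>t x\<bar> \<le> C" using bounded_trig[OF assms(2)] by blast
  moreover have "t \<in> borel_measurable \<mu>"
    using trig_measurable[OF assms(2)] measurable_cong_sets[OF sets refl] by blast
  ultimately show ?thesis by (intro integrable_const_bound[of _ C]) auto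
qed

theorem radon_measure_eqI_trig:
  assumes \<mu>: "radon_measure \<mu>" and \<nu>: "radon_measure \<nu>"
    and cos_eq: "\<And>m. m \<in> G \<Longrightarrow> (\<integral>x. cos (m x) \<partial>\<mu>) = (\<integral>x. cos (m x) \<partial>\<nu>)"
    and sin_eq: "\<And>m. m \<in> G \<Longrightarrow> (\<integral>x. sin (m x) \<partial>\<mu>) = (\<integral>x. sin (m x) \<partial>\<nu>)"
  shows "\<mu> = \<nu>"
proof (rule measure_eqI)
  have s: "sets \<mu> = sets borel" "sets \<nu> = sets borel" and f: "finite_measure \<mu>" "finite_measure \<nu>"
    using \<mu> \<nu> by (auto simp: radon_measure_def)
  show "sets \<mu> = sets \<nu>" using s by simp
  have trig: "(\<integral>x. t x \<partial>\<mu>) = (\<integral>x. t x \<partial>\<nu>)" if "t \<in> trig_span G" for t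
    using that by induction (auto simp: cos_eq sin_eq integrable_trig[OF \<mu>] integrable_trig[OF \<nu>])
  have close: "\<bar>(\<integral>x. t x \<partial>\<rho>) - measure \<rho> B\<bar> \<le> (\<integral>x. \<bar>t x - indicator B x\<bar> \<partial>\<rho>)"
    if \<rho>: "radon_measure \<rho>" and t: "t \<in> trig_span G" and B: "B \<in> sets borel" for \<rho> t B
  proof -
    have sr: "sets \<rho> = sets borel" and "finite_measure \<rho>" using \<rho> by (auto simp: radon_measure_def)
    interpret finite_measure \<rho> by fact
    have spc: "space \<rho> = UNIV" using sets_eq_imp_space_eq[OF sr] by simp
    have i: "integrable \<rho> t" by (rule integrable_trig[OF \<rho> t])
    have i': "integrable \<rho> (indicator B :: _ \<Rightarrow> real)"
      using B sr by (intro integrable_real_indicator) (auto simp: less_top[symmetric])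
    have "(\<integral>x. t x \<partial>\<rho>) - measure \<rho> B = (\<integral>x. t x - indicator B x \<partial>\<rho>)"
      using i i' by (simp add: spc)
    also have "\<bar>\<dots>\<bar> \<le> (\<integral>x. \<bar>t x - indicator B x\<bar> \<partial>\<rho>)" by (rule integral_abs_bound)
    finally show ?thesis .
  qed
  fix A assume "A \<in> sets \<mu>"
  then have A: "A \<in> sets borel" using s by simp
  have "\<bar>measure \<mu> A - measure \<nu> A\<bar> \<le> e" if e: "e > 0" for e
  proof -
    obtain t where t: "t \<in> trig_span G"
      "(\<integral>x. \<bar>t x - indicator A x\<bar> \<partial>\<mu>) < e / 2" "(\<integral>x. \<bar>t x - indicator A x\<bar> \<partial>\<nu>) < e / 2"
      using trig_approximates_indicator[OF \<mu> \<nu> A, of "e / 2"] e by auto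
    show ?thesis using close[OF \<mu> t(1) A] close[OF \<nu> t(1) A] trig[OF t(1)] t(2,3) by linarith
  qed
  then have "measure \<mu> A = measure \<nu> A"
    by (metis abs_le_zero_iff dense_ge eq_iff_diff_eq_0)
  then show "emeasure \<mu> A = emeasure \<nu> A"
    using f by (simp add: finite_measure.emeasure_eq_measure)
qed

end

lemma top_dual_add: "l \<in> top_dual \<Longrightarrow> m \<in> top_dual \<Longrightarrow> (\<lambda>x. l x + m x) \<in> top_dual"
  by (auto simp: top_dual_def intro!: linear_compose_add continuous_intros)

lemma top_dual_scale: "l \<in> top_dual \<Longrightarrow> (\<lambda>x. c * l x) \<in> top_dual"
  using linear_compose_scale_right[of l c] by (auto simp: top_dual_def intro!: continuous_intros)

lemma top_dual_zero: "(\<lambda>_. 0) \<in> top_dual"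
  by (auto simp: top_dual_def module_hom_zero)

lemma top_dual_linear:
  assumes "l \<in> top_dual"
  shows "l (x + y) = l x + l y" "l (x - y) = l x - l y" "l (c *\<^sub>R x) = c * l x" "l 0 = 0" "l (- x) = - l x"
  using assms by (auto simp: top_dual_def linear_add linear_diff linear_scale linear_0 linear_neg)

lemma top_dual_eqI:
  assumes "\<And>l. l \<in> top_dual \<Longrightarrow> l x = l y"
  shows "x = (y :: 'a::hausdorff_locally_convex)"
proof (rule ccontr)
  assume "x \<noteq> y"
  then obtain l :: "'a \<Rightarrow> real" where "l \<in> top_dual" "l (x - y) \<noteq> 0"
    using top_dual_separates_0[of "x - y"] by auto
  then show False using assms[of l] by (simp add: top_dual_linear)
qed

interpretation top_dual: phase_space "top_dual :: ('a::hausdorff_locally_convex \<Rightarrow> real) set"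
proof
  show "\<exists>m\<in>top_dual. m x \<noteq> m y" if "x \<noteq> y" for x y :: 'a
    using top_dual_eqI that by blast
  show "continuous_on UNIV m" if "m \<in> top_dual" for m :: "'a \<Rightarrow> real"
    using that by (simp add: top_dual_def)
qed (rule top_dual_add top_dual_scale top_dual_zero; assumption?)+

section \<open>Functions of moderate growth\<close>

text \<open>A class of functions that contains all polynomials in functionals and all bounded measurable
  functions, is closed under products and essentially invariant under translations, and consists
  of functions that are integrable for every Gaussian measure. Most integrability questions
  reduce to closure properties of this class.\<close>

definition moderate :: "('a::hausdorff_locally_convex \<Rightarrow> real) set" where
  "moderate = {F \<in> borel_measurable borel. \<exists>ls C. set ls \<subseteq> top_dual \<and>
     (\<forall>x. \<bar>F x\<bar> \<le> C * exp (\<Sum>l\<leftarrow>ls. \<bar>l x\<bar>))}"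

lemma moderateI:
  assumes "F \<in> borel_measurable borel" "set ls \<subseteq> top_dual" "\<And>x. \<bar>F x\<bar> \<le> C * exp (\<Sum>l\<leftarrow>ls. \<bar>l x\<bar>)"
  shows "F \<in> moderate"
  using assms by (auto simp: moderate_def)

lemma moderateE:
  assumes "F \<in> moderate"
  obtains ls C where "set ls \<subseteq> top_dual" "C \<ge> 0" "\<And>x. \<bar>F x\<bar> \<le> C * exp (\<Sum>l\<leftarrow>ls. \<bar>l x\<bar>)"
proof -
  obtain ls C where *: "set ls \<subseteq> top_dual" "\<And>x. \<bar>F x\<bar> \<le> C * exp (\<Sum>l\<leftarrow>ls. \<bar>l x\<bar>)"
    using assms by (auto simp: moderate_def)
  have "0 \<le> C * exp (\<Sum>l\<leftarrow>ls. \<bar>l 0\<bar>)" using *(2)[of 0] by (meson abs_ge_zero order_trans)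
  then have "C \<ge> 0" by (simp add: zero_le_mult_iff)
  with * that show ?thesis by blast
qed

lemma moderate_measurable [dest]: "F \<in> moderate \<Longrightarrow> F \<in> borel_measurable borel"
  by (simp add: moderate_def)

lemma top_dual_measurable [dest]: "l \<in> top_dual \<Longrightarrow> l \<in> borel_measurable borel"
  by (simp add: top_dual_def borel_measurable_continuous_onI)

lemma sum_list_abs_nonneg: "0 \<le> (\<Sum>l\<leftarrow>ls. \<bar>l x :: real\<bar>)"
  by (rule sum_list_nonneg) auto

lemma moderate_bounded:
  assumes "F \<in> borel_measurable borel" "\<And>x. \<bar>F x\<bar> \<le> C"
  shows "F \<in> moderate"
  using assms by (intro moderateI[of F "[]" C]) auto

lemma moderate_const: "(\<lambda>_. c) \<in> moderate"
  by (rule moderate_bounded) auto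

lemma moderate_dual:
  assumes "l \<in> top_dual" shows "l \<in> moderate"
proof (rule moderateI)
  show "\<bar>l x\<bar> \<le> 1 * exp (\<Sum>l\<leftarrow>[l]. \<bar>l x\<bar>)" for x
    using exp_ge_add_one_self[of "\<bar>l x\<bar>"] by (simp del: exp_ge_add_one_self)
qed (use assms in auto)

lemma moderate_exp_sum:
  assumes "set ls \<subseteq> top_dual" shows "(\<lambda>x. exp (\<Sum>l\<leftarrow>ls. \<bar>l x\<bar>)) \<in> moderate"
proof (rule moderateI)
  have "(\<lambda>x. \<Sum>l\<leftarrow>ls. \<bar>l x\<bar>) \<in> borel_measurable borel"
    using assms by (induction ls) (auto intro!: borel_measurable_add borel_measurable_abs)
  then show "(\<lambda>x. exp (\<Sum>l\<leftarrow>ls. \<bar>l x\<bar>)) \<in> borel_measurable borel" by measurable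
  show "\<bar>exp (\<Sum>l\<leftarrow>ls. \<bar>l x\<bar>)\<bar> \<le> 1 * exp (\<Sum>l\<leftarrow>ls. \<bar>l x\<bar>)" for x by simp
qed fact

lemma moderate_mult:
  assumes F: "F \<in> moderate" and G: "G \<in> moderate" shows "(\<lambda>x. F x * G x) \<in> moderate"
proof -
  obtain ls C where 1: "set ls \<subseteq> top_dual" "C \<ge> 0" "\<And>x. \<bar>F x\<bar> \<le> C * exp (\<Sum>l\<leftarrow>ls. \<bar>l x\<bar>)"
    using moderateE[OF F] by metis
  obtain ms D where 2: "set ms \<subseteq> top_dual" "D \<ge> 0" "\<And>x. \<bar>G x\<bar> \<le> D * exp (\<Sum>l\<leftarrow>ms. \<bar>l x\<bar>)"
    using moderateE[OF G] by metis
  show ?thesis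
  proof (rule moderateI)
    show "(\<lambda>x. F x * G x) \<in> borel_measurable borel"
      by (intro borel_measurable_times moderate_measurable F G)
    show "\<bar>F x * G x\<bar> \<le> (C * D) * exp (\<Sum>l\<leftarrow>ls @ ms. \<bar>l x\<bar>)" for x
      using mult_mono[OF 1(3)[of x] 2(3)[of x]] 1(2) by (simp add: abs_mult exp_add ac_simps)
  qed (use 1 2 in auto)
qed

lemma moderate_cmult: "F \<in> moderate \<Longrightarrow> (\<lambda>x. c * F x) \<in> moderate"
  by (rule moderate_mult[OF moderate_const])

lemma moderate_add:
  assumes F: "F \<in> moderate" and G: "G \<in> moderate" shows "(\<lambda>x. F x + G x) \<in> moderate"
proof -
  obtain ls C where 1: "set ls \<subseteq> top_dual" "C \<ge> 0" "\<And>x. \<bar>F x\<bar> \<le> C * exp (\<Sum>l\<leftarrow>ls. \<bar>l x\<bar>)"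
    using moderateE[OF F] by metis
  obtain ms D where 2: "set ms \<subseteq> top_dual" "D \<ge> 0" "\<And>x. \<bar>G x\<bar> \<le> D * exp (\<Sum>l\<leftarrow>ms. \<bar>l x\<bar>)"
    using moderateE[OF G] by metis
  show ?thesis
  proof (rule moderateI)
    show "(\<lambda>x. F x + G x) \<in> borel_measurable borel"
      by (intro borel_measurable_add moderate_measurable F G)
    show "\<bar>F x + G x\<bar> \<le> (C + D) * exp (\<Sum>l\<leftarrow>ls @ ms. \<bar>l x\<bar>)" for x
    proof -
      have "C * exp (\<Sum>l\<leftarrow>ls. \<bar>l x\<bar>) \<le> C * exp (\<Sum>l\<leftarrow>ls @ ms. \<bar>l x\<bar>)"
        using 1(2) sum_list_abs_nonneg[of x ms] by (intro mult_left_mono) auto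
      moreover have "D * exp (\<Sum>l\<leftarrow>ms. \<bar>l x\<bar>) \<le> D * exp (\<Sum>l\<leftarrow>ls @ ms. \<bar>l x\<bar>)"
        using 2(2) sum_list_abs_nonneg[of x ls] by (intro mult_left_mono) auto
      ultimately show ?thesis using 1(3)[of x] 2(3)[of x] unfolding distrib_right by linarith
    qed
  qed (use 1 2 in auto)
qed

lemma moderate_minus: "F \<in> moderate \<Longrightarrow> (\<lambda>x. - F x) \<in> moderate"
  using moderate_cmult[of F "-1"] by simp

lemma moderate_diff: "F \<in> moderate \<Longrightarrow> G \<in> moderate \<Longrightarrow> (\<lambda>x. F x - G x) \<in> moderate"
  using moderate_add[OF _ moderate_minus, of F G] by simp

lemma moderate_power: "F \<in> moderate \<Longrightarrow> (\<lambda>x. F x ^ n) \<in> moderate"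
  by (induction n) (auto intro: moderate_const moderate_mult)

lemma moderate_sum: "(\<And>i. i \<in> I \<Longrightarrow> F i \<in> moderate) \<Longrightarrow> (\<lambda>x. \<Sum>i\<in>I. F i x) \<in> moderate"
  by (induction I rule: infinite_finite_induct) (auto intro: moderate_const moderate_add)

lemma moderate_prod: "(\<And>i. i \<in> I \<Longrightarrow> F i \<in> moderate) \<Longrightarrow> (\<lambda>x. \<Prod>i\<in>I. F i x) \<in> moderate"
  by (induction I rule: infinite_finite_induct) (auto intro: moderate_const moderate_mult)

lemma moderate_shift:
  assumes F: "F \<in> moderate"
  obtains D where "D \<in> moderate" "\<And>x t. \<bar>t\<bar> \<le> 1 \<Longrightarrow> \<bar>F (x + t *\<^sub>R h)\<bar> \<le> D x"
proof -
  obtain ls C where 1: "set ls \<subseteq> top_dual" "C \<ge> 0" "\<And>x. \<bar>F x\<bar> \<le> C * exp (\<Sum>l\<leftarrow>ls. \<bar>l x\<bar>)"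
    using moderateE[OF F] by metis
  define D where "D x = C * exp (\<Sum>l\<leftarrow>ls. \<bar>l h\<bar>) * exp (\<Sum>l\<leftarrow>ls. \<bar>l x\<bar>)" for x
  have "D \<in> moderate" unfolding D_def by (intro moderate_cmult moderate_exp_sum 1)
  moreover have "\<bar>F (x + t *\<^sub>R h)\<bar> \<le> D x" if t: "\<bar>t\<bar> \<le> 1" for x t
  proof -
    have "(\<Sum>l\<leftarrow>ls. \<bar>l (x + t *\<^sub>R h)\<bar>) \<le> (\<Sum>l\<leftarrow>ls. \<bar>l h\<bar> + \<bar>l x\<bar>)"
    proof (rule sum_list_mono)
      fix l assume "l \<in> set ls"
      then have "l (x + t *\<^sub>R h) = l x + t * l h" using 1 by (simp add: top_dual_linear subset_iff)
      moreover have "\<bar>t * l h\<bar> \<le> \<bar>l h\<bar>"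
        using t by (simp add: abs_mult mult_left_le_one_le)
      ultimately show "\<bar>l (x + t *\<^sub>R h)\<bar> \<le> \<bar>l h\<bar> + \<bar>l x\<bar>" by linarith
    qed
    then have "C * exp (\<Sum>l\<leftarrow>ls. \<bar>l (x + t *\<^sub>R h)\<bar>) \<le> C * exp ((\<Sum>l\<leftarrow>ls. \<bar>l h\<bar>) + (\<Sum>l\<leftarrow>ls. \<bar>l x\<bar>))"
      using 1(2) by (intro mult_left_mono) (auto simp: sum_list_addf)
    then show ?thesis using 1(3)[of "x + t *\<^sub>R h"] by (simp add: D_def exp_add ac_simps)
  qed
  ultimately show ?thesis by (rule that)
qed

section \<open>Exponential moments of Gaussian measures\<close>

lemma normal_exp_moment:
  assumes s: "s > 0"
  shows "integrable (density lborel (normal_density 0 s)) exp"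
    and "(\<integral>y. exp y \<partial>density lborel (normal_density 0 s)) = exp (s\<^sup>2 / 2)"
proof -
  \<comment> \<open>completing the square\<close>
  have *: "normal_density 0 s y * exp y = exp (s\<^sup>2 / 2) * normal_density (s\<^sup>2) s y" for y
  proof -
    have "- y\<^sup>2 / (2 * s\<^sup>2) + y = s\<^sup>2 / 2 + - (y - s\<^sup>2)\<^sup>2 / (2 * s\<^sup>2)"
      using s by (simp add: field_simps power2_eq_square)
    then have "exp (- y\<^sup>2 / (2 * s\<^sup>2)) * exp y = exp (s\<^sup>2 / 2) * exp (- (y - s\<^sup>2)\<^sup>2 / (2 * s\<^sup>2))"
      by (simp only: exp_add[symmetric])
    then show ?thesis by (simp add: normal_density_def)
  qed
  show "integrable (density lborel (normal_density 0 s)) exp"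
    using s by (subst integrable_density) (auto simp: *)
  show "(\<integral>y. exp y \<partial>density lborel (normal_density 0 s)) = exp (s\<^sup>2 / 2)"
    using s by (subst integral_density) (auto simp: *)
qed

locale radon_gaussian =
  fixes \<gamma> :: "'a::hausdorff_locally_convex measure"
  assumes radon: "radon_measure \<gamma>" and gaussian: "centered_gaussian \<gamma>"
begin

definition cov :: "('a \<Rightarrow> real) \<Rightarrow> ('a \<Rightarrow> real) \<Rightarrow> real" where
  "cov l m = (\<integral>x. l x * m x \<partial>\<gamma>)"

lemma sets_eq [measurable_cong]: "sets \<gamma> = sets borel"
  using radon by (simp add: radon_measure_def)

lemma space_eq: "space \<gamma> = UNIV"
  using sets_eq_imp_space_eq[OF sets_eq] by simp

lemma measurable_eq: "measurable \<gamma> N = measurable borel N"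
  by (rule measurable_cong_sets[OF sets_eq refl])

lemma gaussian_cases:
  assumes "l \<in> top_dual"
  obtains "distr \<gamma> borel l = return borel 0"
  | s where "s > 0" "distr \<gamma> borel l = density lborel (normal_density 0 s)"
  using gaussian assms by (auto simp: centered_gaussian_def)

lemma gaussian_prob_space: "prob_space \<gamma>"
proof (rule prob_space_distrD)
  show "(\<lambda>_. 0) \<in> measurable \<gamma> (borel :: real measure)" by simp
  show "prob_space (distr \<gamma> borel (\<lambda>_. 0 :: real))"
    using gaussian_cases[OF top_dual_zero]
    by (metis prob_space_normal_density prob_space_return space_borel UNIV_I)
qed

sublocale prob_space \<gamma> by (rule gaussian_prob_space)

lemma gaussian_exp:
  assumes l: "l \<in> top_dual"
  shows "integrable \<gamma> (\<lambda>x. exp (l x))" and "(\<integral>x. exp (l x) \<partial>\<gamma>) = exp (cov l l / 2)"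
proof -
  have m [measurable]: "l \<in> borel_measurable \<gamma>" using l by (auto simp: measurable_eq)
  have cov: "cov l l = (\<integral>y. y\<^sup>2 \<partial>distr \<gamma> borel l)"
    by (simp add: cov_def integral_distr power2_eq_square)
  have "integrable (distr \<gamma> borel l) exp \<and>
    (\<integral>y. exp y \<partial>distr \<gamma> borel l) = exp ((\<integral>y. y\<^sup>2 \<partial>distr \<gamma> borel l) / 2)"
    using l
  proof (cases rule: gaussian_cases)
    case 1
    have "integrable (return borel 0) (exp :: real \<Rightarrow> real)"
      by (simp add: integrable_iff_bounded nn_integral_return)
    then show ?thesis by (simp add: 1 integral_return)
  next
    case (2 s)
    have "(\<integral>y. y\<^sup>2 \<partial>density lborel (normal_density 0 s)) = s\<^sup>2"
      using integral_normal_moment_even[OF 2(1), of 0 1] 2(1) by (subst integral_density) auto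
    then show ?thesis using normal_exp_moment[OF 2(1)] by (simp add: 2(2))
  qed
  then show "integrable \<gamma> (\<lambda>x. exp (l x))" "(\<integral>x. exp (l x) \<partial>\<gamma>) = exp (cov l l / 2)"
    by (simp_all add: integrable_distr_eq integral_distr cov)
qed

text \<open>The constant \<open>c\<close> is arbitrary because the induction step doubles it, through
  \<open>a b \<le> a\<^sup>2 + b\<^sup>2\<close>.\<close>

lemma integrable_exp_sum_abs:
  assumes "set ls \<subseteq> top_dual"
  shows "integrable \<gamma> (\<lambda>x. exp (c * (\<Sum>l\<leftarrow>ls. \<bar>l x\<bar>)))"
  using assms
proof (induction ls arbitrary: c)
  case (Cons l ls)
  have l: "l \<in> top_dual" "set ls \<subseteq> top_dual" using Cons.prems by auto
  have [measurable]: "l \<in> borel_measurable borel" using l by auto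
  have [measurable]: "(\<lambda>x. \<Sum>l\<leftarrow>ls. \<bar>l x\<bar>) \<in> borel_measurable borel"
    using l(2) by (induction ls) (auto intro!: borel_measurable_add borel_measurable_abs)
  have int: "integrable \<gamma> (\<lambda>x. exp (2 * c * l x) + exp (- (2 * c) * l x) + exp (2 * c * (\<Sum>l\<leftarrow>ls. \<bar>l x\<bar>)))"
    using gaussian_exp(1)[OF top_dual_scale[OF l(1)], of "2 * c"]
      gaussian_exp(1)[OF top_dual_scale[OF l(1)], of "- (2 * c)"] Cons.IH[OF l(2), of "2 * c"]
    by simp
  show ?case
  proof (rule Bochner_Integration.integrable_bound[OF int])
    show "AE x in \<gamma>. norm (exp (c * (\<Sum>l\<leftarrow>l # ls. \<bar>l x\<bar>))) \<le>
       norm (exp (2 * c * l x) + exp (- (2 * c) * l x) + exp (2 * c * (\<Sum>l\<leftarrow>ls. \<bar>l x\<bar>)))"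
    proof (rule AE_I2)
      fix x
      define a where "a = exp (c * \<bar>l x\<bar>)"
      define b where "b = exp (c * (\<Sum>l\<leftarrow>ls. \<bar>l x\<bar>))"
      have "0 \<le> (a - b)\<^sup>2" by simp
      then have "2 * (a * b) \<le> a\<^sup>2 + b\<^sup>2" by (simp add: power2_diff)
      moreover have "0 < a * b" by (simp add: a_def b_def)
      moreover have "a\<^sup>2 \<le> exp (2 * c * l x) + exp (- (2 * c) * l x)"
        by (cases "l x \<ge> 0") (auto simp: a_def exp_double[symmetric] add_increasing add_increasing2 mult.assoc)
      moreover have "b\<^sup>2 = exp (2 * c * (\<Sum>l\<leftarrow>ls. \<bar>l x\<bar>))"
        by (simp add: b_def exp_double[symmetric] mult.assoc)
      moreover have "exp (c * (\<Sum>l\<leftarrow>l # ls. \<bar>l x\<bar>)) = a * b"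
        by (simp add: a_def b_def exp_add distrib_left)
      ultimately show "norm (exp (c * (\<Sum>l\<leftarrow>l # ls. \<bar>l x\<bar>))) \<le>
       norm (exp (2 * c * l x) + exp (- (2 * c) * l x) + exp (2 * c * (\<Sum>l\<leftarrow>ls. \<bar>l x\<bar>)))"
        by simp
    qed
  qed simp
qed simp

lemma integrable_moderate:
  assumes "F \<in> moderate" shows "integrable \<gamma> F"
proof -
  obtain ls C where 1: "set ls \<subseteq> top_dual" "C \<ge> 0" "\<And>x. \<bar>F x\<bar> \<le> C * exp (\<Sum>l\<leftarrow>ls. \<bar>l x\<bar>)"
    using moderateE[OF assms] by metis
  have "integrable \<gamma> (\<lambda>x. C * exp (1 * (\<Sum>l\<leftarrow>ls. \<bar>l x\<bar>)))"
    by (intro integrable_mult_right integrable_exp_sum_abs 1)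
  then show ?thesis
    by (rule Bochner_Integration.integrable_bound) (use assms 1 in \<open>auto simp: measurable_eq\<close>)
qed

lemma moderate_L2: "F \<in> moderate \<Longrightarrow> F \<in> L2_space \<gamma>"
  by (auto simp: L2_space_def measurable_eq intro: integrable_moderate moderate_power)

lemma cov_sym: "cov l m = cov m l"
  by (simp add: cov_def mult.commute)

lemma cov_add: "l \<in> top_dual \<Longrightarrow> l' \<in> top_dual \<Longrightarrow> m \<in> top_dual \<Longrightarrow>
    cov (\<lambda>x. l x + l' x) m = cov l m + cov l' m"
  by (simp add: cov_def distrib_right integrable_moderate moderate_mult moderate_dual)

lemma cov_scale: "cov (\<lambda>x. c * l x) m = c * cov l m"
  by (simp add: cov_def mult.assoc)

lemma cov_add2: "l \<in> top_dual \<Longrightarrow> l' \<in> top_dual \<Longrightarrow> m \<in> top_dual \<Longrightarrow>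
    cov m (\<lambda>x. l x + l' x) = cov m l + cov m l'"
  using cov_add[of l l' m] by (simp add: cov_sym)

lemma cov_scale2: "cov m (\<lambda>x. c * l x) = c * cov m l"
  using cov_scale[of c l m] by (simp add: cov_sym)

lemma cov_nonneg: "0 \<le> cov l l"
  by (simp add: cov_def)

text \<open>For real \<open>w\<close> this is the moment generating function of the functional \<open>l + w m\<close>. Both sides are
  entire functions of \<open>w\<close>, the left one by expansion in a power series, so that the identity
  theorem extends the formula to complex \<open>w\<close>.\<close>

lemma gaussian_exp_complex:
  fixes w :: complex
  assumes l: "l \<in> top_dual" and m: "m \<in> top_dual"
  shows "(\<integral>x. complex_of_real (exp (l x)) * exp (w * complex_of_real (m x)) \<partial>\<gamma>) =
    exp ((cov l l + 2 * w * cov l m + w\<^sup>2 * cov m m) / 2)"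
proof -
  define f where "f w = (\<integral>x. complex_of_real (exp (l x)) * exp (w * complex_of_real (m x)) \<partial>\<gamma>)" for w :: complex
  define g where "g w = exp ((cov l l + 2 * w * cov l m + w\<^sup>2 * cov m m) / 2)" for w :: complex
  have [measurable]: "l \<in> borel_measurable borel" "m \<in> borel_measurable borel" using l m by auto
  define a where "a n = (\<integral>x. complex_of_real (exp (l x)) * (complex_of_real (m x)) ^ n /\<^sub>R fact n \<partial>\<gamma>)" for n
  have sums: "(\<lambda>n. a n * w ^ n) sums f w" for w :: complex
  proof -
    define F where "F n x = complex_of_real (exp (l x)) * ((w * complex_of_real (m x)) ^ n /\<^sub>R fact n)" for n x
    have Fsums: "(\<lambda>n. F n x) sums (complex_of_real (exp (l x)) * exp (w * complex_of_real (m x)))" for x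
      unfolding F_def by (intro sums_mult exp_converges)
    have normF: "norm (F n x) = exp (l x) * ((norm w * \<bar>m x\<bar>) ^ n /\<^sub>R fact n)" for n x
      by (simp add: F_def norm_mult norm_power power_mult_distrib)
    have nsums: "(\<lambda>n. norm (F n x)) sums (exp (l x) * exp (norm w * \<bar>m x\<bar>))" for x
      unfolding normF by (intro sums_mult exp_converges)
    have Eint: "integrable \<gamma> (\<lambda>x. exp (l x) * exp (norm w * \<bar>m x\<bar>))"
    proof (rule Bochner_Integration.integrable_bound)
      show "integrable \<gamma> (\<lambda>x. exp (1 * (\<Sum>l\<leftarrow>[l, \<lambda>x. norm w * m x]. \<bar>l x\<bar>)))"
        using l m by (intro integrable_exp_sum_abs) (auto intro: top_dual_scale)
      show "AE x in \<gamma>. norm (exp (l x) * exp (norm w * \<bar>m x\<bar>)) \<le>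
          norm (exp (1 * (\<Sum>l\<leftarrow>[l, \<lambda>x. norm w * m x]. \<bar>l x\<bar>)))"
        by (auto simp: exp_add[symmetric] abs_mult)
    qed simp
    have Fle: "norm (F n x) \<le> exp (l x) * exp (norm w * \<bar>m x\<bar>)" for n x
      using sum_le_suminf[OF sums_summable[OF nsums], of "{n}" x] sums_unique[OF nsums, of x] by simp
    have Fint: "integrable \<gamma> (F n)" for n
      by (rule Bochner_Integration.integrable_bound[OF Eint]) (use Fle in \<open>auto simp: F_def[abs_def]\<close>)
    have "(\<lambda>n. integral\<^sup>L \<gamma> (F n)) sums (\<integral>x. (\<Sum>n. F n x) \<partial>\<gamma>)"
    proof (rule sums_integral[OF Fint])
      show "AE x in \<gamma>. summable (\<lambda>n. norm (F n x))" using sums_summable[OF nsums] by simp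
      show "summable (\<lambda>n. \<integral>x. norm (F n x) \<partial>\<gamma>)"
      proof (rule summableI_nonneg_bounded)
        fix n
        have "(\<Sum>i<n. \<integral>x. norm (F i x) \<partial>\<gamma>) = (\<integral>x. (\<Sum>i<n. norm (F i x)) \<partial>\<gamma>)"
          using Fint by (intro Bochner_Integration.integral_sum[symmetric]) auto
        also have "\<dots> \<le> (\<integral>x. exp (l x) * exp (norm w * \<bar>m x\<bar>) \<partial>\<gamma>)"
        proof (rule integral_mono)
          fix x
          show "(\<Sum>i<n. norm (F i x)) \<le> exp (l x) * exp (norm w * \<bar>m x\<bar>)"
            using sum_le_suminf[OF sums_summable[OF nsums], of "{..<n}" x] sums_unique[OF nsums, of x]
            by simp
        qed (use Fint Eint in auto)
        finally show "(\<Sum>i<n. \<integral>x. norm (F i x) \<partial>\<gamma>) \<le> (\<integral>x. exp (l x) * exp (norm w * \<bar>m x\<bar>) \<partial>\<gamma>)" .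
      qed simp
    qed
    moreover have "(\<integral>x. (\<Sum>n. F n x) \<partial>\<gamma>) = f w"
      unfolding f_def using sums_unique[OF Fsums] by simp
    moreover have "integral\<^sup>L \<gamma> (F n) = a n * w ^ n" for n
    proof -
      have "F n = (\<lambda>x. (complex_of_real (exp (l x)) * (complex_of_real (m x)) ^ n /\<^sub>R fact n) * w ^ n)"
        by (simp add: F_def fun_eq_iff power_mult_distrib ac_simps)
      then show ?thesis unfolding a_def by (simp only: integral_mult_left_zero)
    qed
    ultimately show ?thesis by simp
  qed
  \<comment> \<open>both sides are entire and agree on the real axis\<close>
  have hf: "f holomorphic_on UNIV"
  proof -
    have "f holomorphic_on ball 0 r" for r
      by (rule power_series_holomorphic[of 0 r a]) (use sums in simp)
    then show ?thesis
      by (metis UNIV_I analytic_on_holomorphic analytic_on_open centre_in_ball holomorphic_on_def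
          holomorphic_on_imp_differentiable_at open_ball zero_less_one mem_ball_0 gt_ex at_within_open open_UNIV)
  qed
  have hg: "g holomorphic_on UNIV" unfolding g_def by (intro holomorphic_intros) auto
  have real: "f (complex_of_real t) = g (complex_of_real t)" for t
  proof -
    have lm: "(\<lambda>x. l x + t * m x) \<in> top_dual" by (intro top_dual_add top_dual_scale l m)
    have c: "cov (\<lambda>x. l x + t * m x) (\<lambda>x. l x + t * m x) = cov l l + 2 * t * cov l m + t\<^sup>2 * cov m m"
      using l m lm by (simp add: cov_add cov_add2 cov_scale cov_scale2 top_dual_scale cov_sym
          power2_eq_square algebra_simps)
    have "f (complex_of_real t) = (\<integral>x. complex_of_real (exp (l x + t * m x)) \<partial>\<gamma>)"
      by (simp add: f_def exp_add exp_of_real[symmetric])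
    also have "\<dots> = complex_of_real (\<integral>x. exp (l x + t * m x) \<partial>\<gamma>)" by (rule integral_complex_of_real)
    also have "\<dots> = g (complex_of_real t)"
      by (simp add: gaussian_exp(2)[OF lm] c g_def exp_of_real[symmetric])
    finally show ?thesis .
  qed
  have "f w - g w = 0"
  proof (rule analytic_continuation[where f = "\<lambda>z. f z - g z" and S = UNIV and U = "range complex_of_real" and \<xi> = 0])
    show "(\<lambda>z. f z - g z) holomorphic_on UNIV" by (intro holomorphic_intros hf hg)
    show "(0::complex) islimpt range complex_of_real"
      unfolding islimpt_approachable
    proof (intro allI impI)
      fix e :: real assume "e > 0"
      then show "\<exists>x'\<in>range complex_of_real. x' \<noteq> 0 \<and> dist x' 0 < e"
        by (intro bexI[of _ "complex_of_real (e / 2)"]) (auto simp: norm_divide image_iff intro!: exI[of _ "e / 2"])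
    qed
  qed (use real in auto)
  then show ?thesis by (simp add: f_def g_def)
qed

text \<open>The case \<open>w = \<i>\<close>. With \<open>l = 0\<close> these formulas give the characteristic function of the measure.\<close>

lemma gaussian_exp_trig:
  assumes l: "l \<in> top_dual" and m: "m \<in> top_dual"
  shows "(\<integral>x. exp (l x) * cos (m x) \<partial>\<gamma>) = exp ((cov l l - cov m m) / 2) * cos (cov l m)"
    and "(\<integral>x. exp (l x) * sin (m x) \<partial>\<gamma>) = exp ((cov l l - cov m m) / 2) * sin (cov l m)"
proof -
  have [measurable]: "l \<in> borel_measurable borel" "m \<in> borel_measurable borel" using l m by auto
  let ?F = "\<lambda>x. complex_of_real (exp (l x)) * exp (\<i> * complex_of_real (m x))"
  have int: "integrable \<gamma> ?F"
    by (rule Bochner_Integration.integrable_bound[OF gaussian_exp(1)[OF l]]) (auto simp: norm_mult)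
  have "(\<integral>x. ?F x \<partial>\<gamma>) = exp ((cov l l + 2 * \<i> * cov l m + \<i>\<^sup>2 * cov m m) / 2)"
    using gaussian_exp_complex[OF l m, of \<i>] by simp
  also have "\<dots> = complex_of_real (exp ((cov l l - cov m m) / 2)) * exp (\<i> * complex_of_real (cov l m))"
    by (simp add: exp_of_real[symmetric] exp_add[symmetric] diff_divide_distrib add_divide_distrib algebra_simps)
  finally have *: "(\<integral>x. ?F x \<partial>\<gamma>) =
    complex_of_real (exp ((cov l l - cov m m) / 2)) * exp (\<i> * complex_of_real (cov l m))" .
  show "(\<integral>x. exp (l x) * cos (m x) \<partial>\<gamma>) = exp ((cov l l - cov m m) / 2) * cos (cov l m)"
    using arg_cong[OF *, of Re] integral_Re[OF int] by (simp add: exp_Euler cos_of_real sin_of_real)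
  show "(\<integral>x. exp (l x) * sin (m x) \<partial>\<gamma>) = exp ((cov l l - cov m m) / 2) * sin (cov l m)"
    using arg_cong[OF *, of Im] integral_Im[OF int] by (simp add: exp_Euler cos_of_real sin_of_real)
qed

end

section \<open>Square-integrable functions\<close>

lemma L2_measurable: "f \<in> L2_space M \<Longrightarrow> f \<in> borel_measurable M"
  by (simp add: L2_space_def)

lemma L2_integrable_mult:
  assumes f: "f \<in> L2_space M" and g: "g \<in> L2_space M"
  shows "integrable M (\<lambda>x. f x * g x)"
proof (rule Bochner_Integration.integrable_bound)
  show "integrable M (\<lambda>x. (f x)\<^sup>2 + (g x)\<^sup>2)" using f g by (simp add: L2_space_def)
  show "(\<lambda>x. f x * g x) \<in> borel_measurable M"
    by (intro borel_measurable_times L2_measurable f g)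
  show "AE x in M. norm (f x * g x) \<le> norm ((f x)\<^sup>2 + (g x)\<^sup>2)"
  proof (rule AE_I2)
    fix x
    have "2 * (\<bar>f x\<bar> * \<bar>g x\<bar>) \<le> (f x)\<^sup>2 + (g x)\<^sup>2"
      using sum_squares_bound[of "\<bar>f x\<bar>" "\<bar>g x\<bar>"] by (simp add: mult.assoc)
    moreover have "0 \<le> \<bar>f x\<bar> * \<bar>g x\<bar>" by simp
    ultimately have "\<bar>f x\<bar> * \<bar>g x\<bar> \<le> (f x)\<^sup>2 + (g x)\<^sup>2" by linarith
    then show "norm (f x * g x) \<le> norm ((f x)\<^sup>2 + (g x)\<^sup>2)" by (simp add: abs_mult)
  qed
qed

lemma L2_add: "f \<in> L2_space M \<Longrightarrow> g \<in> L2_space M \<Longrightarrow> (\<lambda>x. f x + g x) \<in> L2_space M"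
  using L2_integrable_mult[of f M g] by (auto simp: L2_space_def power2_sum mult.assoc)

lemma L2_cmult: "f \<in> L2_space M \<Longrightarrow> (\<lambda>x. c * f x) \<in> L2_space M"
  by (auto simp: L2_space_def power_mult_distrib)

lemma L2_diff: "f \<in> L2_space M \<Longrightarrow> g \<in> L2_space M \<Longrightarrow> (\<lambda>x. f x - g x) \<in> L2_space M"
  using L2_add[OF _ L2_cmult, of f M g "-1"] by simp

lemma L2_norm_nonneg: "0 \<le> L2_norm M f"
  by (simp add: L2_norm_def)

lemma L2_norm_square: "(L2_norm M f)\<^sup>2 = (\<integral>x. (f x)\<^sup>2 \<partial>M)"
  by (simp add: L2_norm_def)

lemma L2_Cauchy_Schwarz:
  assumes f: "f \<in> L2_space M" and g: "g \<in> L2_space M"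
  shows "\<bar>\<integral>x. f x * g x \<partial>M\<bar> \<le> L2_norm M f * L2_norm M g"
proof -
  define a b c where "a = (\<integral>x. (f x)\<^sup>2 \<partial>M)" and "b = (\<integral>x. f x * g x \<partial>M)"
    and "c = (\<integral>x. (g x)\<^sup>2 \<partial>M)"
  have quad: "0 \<le> a + t * (2 * b) + t\<^sup>2 * c" for t
  proof -
    have "0 \<le> (\<integral>x. (f x + t * g x)\<^sup>2 \<partial>M)" by simp
    also have "\<dots> = (\<integral>x. (f x)\<^sup>2 + t * (2 * (f x * g x)) + t\<^sup>2 * (g x)\<^sup>2 \<partial>M)"
      by (rule Bochner_Integration.integral_cong) (auto simp: power2_eq_square algebra_simps)
    also have "\<dots> = a + t * (2 * b) + t\<^sup>2 * c"
      using f g L2_integrable_mult[OF f g] by (simp add: a_def b_def c_def L2_space_def)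
    finally show ?thesis .
  qed
  have "b\<^sup>2 \<le> a * c"
  proof (cases "c = 0")
    case True
    have "b = 0"
    proof (rule ccontr)
      assume "b \<noteq> 0"
      then show False using quad[of "- (a + 1) / (2 * b)"] True by simp
    qed
    then show ?thesis by (simp add: True)
  next
    case False
    moreover have "c \<ge> 0" by (simp add: c_def)
    ultimately have "c > 0" by simp
    then show ?thesis using quad[of "- b / c"]
      by (simp add: field_simps power2_eq_square)
  qed
  then have "\<bar>b\<bar> \<le> sqrt (a * c)" by (metis real_sqrt_abs real_sqrt_le_iff)
  then show ?thesis by (simp add: L2_norm_def a_def b_def c_def real_sqrt_mult)
qed

lemma L2_norm_triangle:
  assumes f: "f \<in> L2_space M" and g: "g \<in> L2_space M"
  shows "L2_norm M (\<lambda>x. f x + g x) \<le> L2_norm M f + L2_norm M g"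
proof (rule power2_le_imp_le)
  have "(L2_norm M (\<lambda>x. f x + g x))\<^sup>2 = (\<integral>x. (f x)\<^sup>2 + 2 * (f x * g x) + (g x)\<^sup>2 \<partial>M)"
    by (simp add: L2_norm_square power2_sum ac_simps)
  also have "\<dots> = (L2_norm M f)\<^sup>2 + 2 * (\<integral>x. f x * g x \<partial>M) + (L2_norm M g)\<^sup>2"
    using f g L2_integrable_mult[OF f g] by (simp add: L2_norm_square L2_space_def)
  also have "\<dots> \<le> (L2_norm M f)\<^sup>2 + 2 * (L2_norm M f * L2_norm M g) + (L2_norm M g)\<^sup>2"
    using L2_Cauchy_Schwarz[OF f g] by linarith
  also have "\<dots> = (L2_norm M f + L2_norm M g)\<^sup>2" by (simp add: power2_sum)
  finally show "(L2_norm M (\<lambda>x. f x + g x))\<^sup>2 \<le> (L2_norm M f + L2_norm M g)\<^sup>2" .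
qed (simp add: L2_norm_nonneg)

lemma L2_norm_cmult: "L2_norm M (\<lambda>x. c * f x) = \<bar>c\<bar> * L2_norm M f"
  by (simp add: L2_norm_def power_mult_distrib real_sqrt_mult)

lemma L2_norm_tendsto_0:
  assumes [measurable]: "\<And>n. r n \<in> borel_measurable M" and W: "W \<in> L2_space M"
    and le: "\<And>n x. x \<in> space M \<Longrightarrow> \<bar>r n x\<bar> \<le> W x"
    and lim: "\<And>x. x \<in> space M \<Longrightarrow> (\<lambda>n. r n x) \<longlonglongrightarrow> 0"
  shows "(\<lambda>n. L2_norm M (r n)) \<longlonglongrightarrow> 0"
proof -
  have "(\<lambda>n. \<integral>x. (r n x)\<^sup>2 \<partial>M) \<longlonglongrightarrow> (\<integral>x. 0 \<partial>M)"
  proof (rule integral_dominated_convergence)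
    show "integrable M (\<lambda>x. (W x)\<^sup>2)" using W by (simp add: L2_space_def)
    show "AE x in M. (\<lambda>n. (r n x)\<^sup>2) \<longlonglongrightarrow> 0"
      using tendsto_power[OF lim, of _ 2] by (intro AE_I2) simp
    show "AE x in M. norm ((r n x)\<^sup>2) \<le> (W x)\<^sup>2" for n
      using power_mono[OF le, of _ n 2] by (intro AE_I2) simp
  qed simp_all
  then have "(\<lambda>n. L2_norm M (r n)) \<longlonglongrightarrow> sqrt 0"
    unfolding L2_norm_def by (intro tendsto_real_sqrt) simp
  then show ?thesis by simp
qed

context radon_gaussian
begin

section \<open>The Cameron--Martin theorem\<close>

definition cm_density :: "('a \<Rightarrow> real) \<Rightarrow> 'a \<Rightarrow> real" where
  "cm_density l x = exp (l x - cov l l / 2)"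

lemma cm_density_alt: "cm_density l x = exp (- (cov l l / 2)) * exp (l x)"
  by (simp add: cm_density_def exp_add[symmetric])

lemma cm_density_moderate:
  assumes "l \<in> top_dual" shows "cm_density l \<in> moderate"
proof (rule moderateI)
  show "cm_density l \<in> borel_measurable borel"
    unfolding cm_density_def[abs_def] using top_dual_measurable[OF assms] by simp
  show "\<bar>cm_density l x\<bar> \<le> exp (- (cov l l / 2)) * exp (\<Sum>l\<leftarrow>[l]. \<bar>l x\<bar>)" for x
    by (simp add: cm_density_alt)
qed (use assms in simp)

lemma integral_cm_density:
  assumes l: "l \<in> top_dual" and F: "F \<in> borel_measurable borel"
  shows "(\<integral>x. F x \<partial>density \<gamma> (\<lambda>x. ennreal (cm_density l x))) = (\<integral>x. cm_density l x * F x \<partial>\<gamma>)"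
  using F cm_density_moderate[OF l]
  by (subst integral_density) (auto simp: measurable_eq cm_density_def)

lemma moderate_cos: "m \<in> top_dual \<Longrightarrow> (\<lambda>x. cos (m x)) \<in> moderate"
  by (rule moderate_bounded[of _ 1]) (auto dest: top_dual_measurable)

lemma moderate_sin: "m \<in> top_dual \<Longrightarrow> (\<lambda>x. sin (m x)) \<in> moderate"
  by (rule moderate_bounded[of _ 1]) (auto dest: top_dual_measurable)

lemma gaussian_trig:
  assumes m: "m \<in> top_dual"
  shows "(\<integral>x. cos (m x) \<partial>\<gamma>) = exp (- (cov m m / 2))" and "(\<integral>x. sin (m x) \<partial>\<gamma>) = 0"
  using gaussian_exp_trig[OF top_dual_zero m] by (simp_all add: cov_def)

lemma cm_density_trig:
  assumes l: "l \<in> top_dual" and m: "m \<in> top_dual"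
  shows "(\<integral>x. cm_density l x * cos (m x) \<partial>\<gamma>) = exp (- (cov m m / 2)) * cos (cov l m)"
    and "(\<integral>x. cm_density l x * sin (m x) \<partial>\<gamma>) = exp (- (cov m m / 2)) * sin (cov l m)"
proof -
  have e: "exp (- (cov l l / 2)) * exp ((cov l l - cov m m) / 2) = exp (- (cov m m / 2))"
    by (simp add: exp_add[symmetric] diff_divide_distrib)
  show "(\<integral>x. cm_density l x * cos (m x) \<partial>\<gamma>) = exp (- (cov m m / 2)) * cos (cov l m)"
    "(\<integral>x. cm_density l x * sin (m x) \<partial>\<gamma>) = exp (- (cov m m / 2)) * sin (cov l m)"
    unfolding cm_density_alt mult.assoc integral_mult_right_zero gaussian_exp_trig[OF l m] e[symmetric]
    by (simp_all only: mult.assoc)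
qed

text \<open>By the Cauchy--Schwarz inequality, the mass of a set under the measure with this density is at
  most a constant times the square root of its original mass; so inner regularity is inherited.\<close>

lemma radon_measure_cm_density:
  assumes l: "l \<in> top_dual"
  shows "radon_measure (density \<gamma> (\<lambda>x. ennreal (cm_density l x)))" (is "radon_measure ?\<mu>")
proof -
  have w: "cm_density l \<in> moderate" by (rule cm_density_moderate[OF l])
  have [measurable]: "cm_density l \<in> borel_measurable borel" using w by auto
  have fin: "finite_measure ?\<mu>"
  proof
    have "emeasure ?\<mu> (space ?\<mu>) = (\<integral>\<^sup>+x. ennreal (cm_density l x) \<partial>\<gamma>)"
      by (auto simp: emeasure_density space_eq intro!: nn_integral_cong)
    also have "\<dots> = ennreal (\<integral>x. cm_density l x \<partial>\<gamma>)"
      by (rule nn_integral_eq_integral[OF integrable_moderate[OF w]]) (simp add: cm_density_def)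
    finally show "emeasure ?\<mu> (space ?\<mu>) \<noteq> \<infinity>" by simp
  qed
  interpret \<mu>: finite_measure ?\<mu> by (rule fin)
  have meas: "measure ?\<mu> A \<le> L2_norm \<gamma> (cm_density l) * sqrt (measure \<gamma> A)" if A: "A \<in> sets borel" for A
  proof -
    have I: "indicat_real A \<in> moderate" by (rule moderate_bounded[of _ 1]) (use A in \<open>auto simp: indicator_def\<close>)
    have "measure ?\<mu> A = (\<integral>x. indicat_real A x \<partial>?\<mu>)"
      using A by (simp add: space_eq)
    also have "\<dots> = (\<integral>x. cm_density l x * indicat_real A x \<partial>\<gamma>)"
      by (rule integral_cm_density[OF l]) (use A in simp)
    also have "\<dots> \<le> L2_norm \<gamma> (cm_density l) * L2_norm \<gamma> (indicat_real A)"
      using L2_Cauchy_Schwarz[OF moderate_L2[OF w] moderate_L2[OF I]] by linarith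
    also have "L2_norm \<gamma> (indicat_real A) = sqrt (measure \<gamma> A)"
    proof -
      have "(indicat_real A x)\<^sup>2 = indicat_real A x" for x by (simp add: indicator_def)
      then show ?thesis using A by (simp add: L2_norm_def space_eq)
    qed
    finally show ?thesis .
  qed
  have "\<exists>K. compact K \<and> K \<subseteq> B \<and> measure ?\<mu> (B - K) < e" if B: "B \<in> sets ?\<mu>" and e: "e > 0" for B e
  proof -
    define C where "C = L2_norm \<gamma> (cm_density l) + 1"
    have C: "C > 0" using L2_norm_nonneg[of \<gamma> "cm_density l"] by (simp add: C_def)
    have "B \<in> sets \<gamma>" "(e / C)\<^sup>2 > 0" using B e C by auto
    then obtain K where K: "compact K" "K \<subseteq> B" "measure \<gamma> (B - K) < (e / C)\<^sup>2"
      using radon unfolding radon_measure_def by metis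
    have "B - K \<in> sets borel" using B K(1) by (auto simp: borel_compact sets_eq)
    from meas[OF this] have "measure ?\<mu> (B - K) \<le> C * sqrt (measure \<gamma> (B - K))"
      by (simp add: C_def distrib_right add_increasing2)
    also have "\<dots> < C * (e / C)"
      using K(3) e C by (intro mult_strict_left_mono real_less_lsqrt) auto
    also have "\<dots> = e" using C by simp
    finally show ?thesis using K by blast
  qed
  then show ?thesis using fin by (simp add: radon_measure_def sets_eq)
qed

text \<open>The idea is to find the vector \<open>h\<close> as a difference of two points of one compact set. The measure \<open>\<mu>\<close>
  with density \<open>exp (l - \<integral> l\<^sup>2 d\<gamma> / 2)\<close> has the trigonometric integrals that the translate of \<open>\<gamma>\<close> by \<open>h\<close>
  would have. If no such \<open>h\<close> exists, then the functions \<open>(x, s) \<mapsto> m x - s (\<integral> l m d\<gamma>)\<close> on \<open>X \<times> \<real>\<close> separate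
  points. Take a compact set \<open>K\<close> that carries at least three quarters of the mass of both measures. A
  trigonometric function that is almost \<open>1\<close> on \<open>K \<times> {0}\<close> and almost \<open>0\<close> on \<open>K \<times> {1}\<close> has equal
  integrals for \<open>\<gamma>\<close> on the slice \<open>s = 0\<close> and for \<open>\<mu>\<close> on the slice \<open>s = 1\<close>, although the first is
  large and the second is small.\<close>

lemma ex_representer:
  assumes l: "l \<in> top_dual"
  obtains h where "\<And>m. m \<in> top_dual \<Longrightarrow> m h = cov l m"
proof (rule ccontr)
  assume "\<not> thesis"
  then have none: "\<exists>m\<in>top_dual. m h \<noteq> cov l m" for h using that by blast
  define G where "G = (\<lambda>m (x, s). m x - s * cov l m) ` top_dual"
  interpret G: phase_space G
  proof
    fix u v :: "'a \<times> real" assume uv: "u \<noteq> v"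
    obtain x s y t where xy: "u = (x, s)" "v = (y, t)" by fastforce
    show "\<exists>m\<in>G. m u \<noteq> m v"
    proof (rule ccontr)
      assume "\<not> (\<exists>m\<in>G. m u \<noteq> m v)"
      then have eq: "m x - s * cov l m = m y - t * cov l m" if "m \<in> top_dual" for m
        using that by (auto simp: G_def xy)
      show False
      proof (cases "s = t")
        case True
        then have "x = y" using eq by (intro top_dual_eqI) simp
        then show False using True uv xy by simp
      next
        case False
        then have "m ((1 / (s - t)) *\<^sub>R (x - y)) = cov l m" if "m \<in> top_dual" for m
        proof -
          have "m x - m y = (s - t) * cov l m" using eq[OF that] by (simp add: algebra_simps)
          then show ?thesis using that False by (simp add: top_dual_linear)
        qed
        then show False using none by blast
      qed
    qed
  next
    fix m :: "'a \<times> real \<Rightarrow> real" assume "m \<in> G"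
    then obtain n where n: "n \<in> top_dual" "m = (\<lambda>(x, s). n x - s * cov l n)" by (auto simp: G_def)
    have "continuous_on UNIV (\<lambda>p :: 'a \<times> real. n (fst p))"
      by (rule continuous_on_compose2[of UNIV n UNIV fst])
        (use n(1) in \<open>auto simp: top_dual_def intro!: continuous_intros\<close>)
    then have "continuous_on UNIV (\<lambda>p. n (fst p) - snd p * cov l n)"
      by (rule continuous_on_diff) (intro continuous_intros)
    then show "continuous_on UNIV m" by (simp add: n(2) case_prod_beta')
    show "(\<lambda>x. c * m x) \<in> G" for c
    proof -
      have "(\<lambda>x. c * m x) = (\<lambda>(x, s). (c * n x) - s * cov l (\<lambda>x. c * n x))"
        unfolding n(2) cov_scale2 by (simp add: fun_eq_iff right_diff_distrib)
      then show ?thesis unfolding G_def by (rule image_eqI[where x = "\<lambda>x. c * n x"]) (rule top_dual_scale[OF n(1)])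
    qed
  next
    fix m m' :: "'a \<times> real \<Rightarrow> real" assume "m \<in> G" "m' \<in> G"
    then obtain n n' where n: "n \<in> top_dual" "m = (\<lambda>(x, s). n x - s * cov l n)"
      "n' \<in> top_dual" "m' = (\<lambda>(x, s). n' x - s * cov l n')" by (auto simp: G_def)
    have "(\<lambda>x. m x + m' x) = (\<lambda>(x, s). (n x + n' x) - s * cov l (\<lambda>x. n x + n' x))"
      unfolding n(2,4) cov_add2[OF n(1,3) l] by (simp add: fun_eq_iff algebra_simps)
    then show "(\<lambda>x. m x + m' x) \<in> G"
      unfolding G_def by (rule image_eqI[where x = "\<lambda>x. n x + n' x"]) (rule top_dual_add[OF n(1,3)])
  next
    show "(\<lambda>_. 0) \<in> G" unfolding G_def
      by (rule image_eqI[of _ _ "\<lambda>_. 0"]) (auto simp: fun_eq_iff cov_def top_dual_zero)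
  qed
  let ?\<mu> = "density \<gamma> (\<lambda>x. ennreal (cm_density l x))"
  have rad: "radon_measure ?\<mu>" by (rule radon_measure_cm_density[OF l])
  interpret \<mu>: finite_measure ?\<mu> using rad by (simp add: radon_measure_def)
  have [measurable_cong]: "sets ?\<mu> = sets borel" using rad by (simp add: radon_measure_def)
  have \<mu>meas: "measurable ?\<mu> N = measurable borel N" for N :: "'x measure"
    by (rule measurable_cong_sets) (simp_all add: sets_eq)
  \<comment> \<open>the tilted measure and the measure itself have the same trigonometric moments, up to the shift\<close>
  have sec: "(\<lambda>x. t (x, s)) \<in> moderate" if t: "t \<in> trig_span G" for t s
  proof -
    obtain C where "\<And>x. \<bar>t x\<bar> \<le> C" using G.bounded_trig[OF t] by blast
    moreover have "continuous_on UNIV (\<lambda>x. t (x, s))"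
      by (rule continuous_on_compose2[OF G.continuous_trig[OF t]]) (auto intro!: continuous_intros)
    ultimately show ?thesis by (intro moderate_bounded[of _ C] borel_measurable_continuous_onI) auto
  qed
  have sec_int: "integrable ?\<mu> (\<lambda>x. t (x, s))" if t: "t \<in> trig_span G" for t s
  proof -
    obtain C where "\<And>x. \<bar>t x\<bar> \<le> C" using G.bounded_trig[OF t] by blast
    then show ?thesis
      by (intro \<mu>.integrable_const_bound[of _ C]) (use sec[OF t] in \<open>auto simp: \<mu>meas\<close>)
  qed
  have eq: "(\<integral>x. t (x, 0) \<partial>\<gamma>) = (\<integral>x. t (x, 1) \<partial>?\<mu>)" if "t \<in> trig_span G" for t
    using that
  proof induction
    case (cos m)
    then obtain n where n: "n \<in> top_dual" "m = (\<lambda>(x, s). n x - s * cov l n)" by (auto simp: G_def)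
    have [simp]: "integrable \<gamma> (\<lambda>x. cm_density l x * cos (n x))" "integrable \<gamma> (\<lambda>x. cm_density l x * sin (n x))"
      using l n(1) by (auto intro!: integrable_moderate moderate_mult cm_density_moderate moderate_cos moderate_sin)
    have "(\<integral>x. cos (m (x, 1)) \<partial>?\<mu>) = (\<integral>x. cm_density l x * cos (m (x, 1)) \<partial>\<gamma>)"
      using top_dual_measurable[OF n(1)] by (intro integral_cm_density[OF l]) (simp add: n(2))
    also have "\<dots> = (\<integral>x. cos (cov l n) * (cm_density l x * cos (n x)) + sin (cov l n) * (cm_density l x * sin (n x)) \<partial>\<gamma>)"
      by (simp add: n(2) cos_diff algebra_simps)
    also have "\<dots> = cos (cov l n) * (exp (- (cov n n / 2)) * cos (cov l n)) +
        sin (cov l n) * (exp (- (cov n n / 2)) * sin (cov l n))"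
      by (simp add: cm_density_trig[OF l n(1)])
    also have "\<dots> = exp (- (cov n n / 2)) * ((cos (cov l n))\<^sup>2 + (sin (cov l n))\<^sup>2)"
      by (simp only: power2_eq_square distrib_left mult.left_commute)
    finally show ?case by (simp add: n(2) gaussian_trig[OF n(1)])
  next
    case (sin m)
    then obtain n where n: "n \<in> top_dual" "m = (\<lambda>(x, s). n x - s * cov l n)" by (auto simp: G_def)
    have [simp]: "integrable \<gamma> (\<lambda>x. cm_density l x * cos (n x))" "integrable \<gamma> (\<lambda>x. cm_density l x * sin (n x))"
      using l n(1) by (auto intro!: integrable_moderate moderate_mult cm_density_moderate moderate_cos moderate_sin)
    have "(\<integral>x. sin (m (x, 1)) \<partial>?\<mu>) = (\<integral>x. cm_density l x * sin (m (x, 1)) \<partial>\<gamma>)"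
      using top_dual_measurable[OF n(1)] by (intro integral_cm_density[OF l]) (simp add: n(2))
    also have "\<dots> = (\<integral>x. cos (cov l n) * (cm_density l x * sin (n x)) - sin (cov l n) * (cm_density l x * cos (n x)) \<partial>\<gamma>)"
      by (simp add: n(2) sin_diff algebra_simps)
    also have "\<dots> = 0"
      by (simp add: cm_density_trig[OF l n(1)])
    finally show ?case by (simp add: n(2) gaussian_trig[OF n(1)])
  next
    case (add t u)
    then show ?case using sec integrable_moderate sec_int by simp
  qed simp
  \<comment> \<open>a compact set carrying more than half of both measures cannot be separated from its shift\<close>
  have \<mu>1: "measure ?\<mu> UNIV = 1"
  proof -
    have "measure ?\<mu> UNIV = (\<integral>x. 1 \<partial>?\<mu>)" by (simp add: space_eq)
    also have "\<dots> = (\<integral>x. cm_density l x * 1 \<partial>\<gamma>)" by (rule integral_cm_density[OF l]) simp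
    also have "\<dots> = 1" using cm_density_trig(1)[OF l top_dual_zero] by (simp add: cov_def)
    finally show ?thesis .
  qed
  have \<gamma>1: "measure \<gamma> UNIV = 1" using prob_space by (simp add: space_eq)
  obtain K1 where K1: "compact K1" "measure \<gamma> (UNIV - K1) < 1 / 4"
    using radon unfolding radon_measure_def by (metis zero_less_divide_1_iff zero_less_numeral sets.top space_eq)
  obtain K2 where K2: "compact K2" "measure ?\<mu> (UNIV - K2) < 1 / 4"
    using rad unfolding radon_measure_def
    by (metis zero_less_divide_1_iff zero_less_numeral sets.top space_density space_eq)
  define K where "K = K1 \<union> K2"
  have K: "compact K" using K1 K2 by (auto simp: K_def)
  have Kb: "K \<in> sets borel" "K1 \<in> sets borel" "K2 \<in> sets borel"
    using K K1 K2 by (auto simp: borel_compact)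
  have IK: "indicat_real K \<in> moderate"
    by (rule moderate_bounded[of _ 1]) (use Kb in \<open>auto simp: indicator_def\<close>)
  have \<gamma>K: "measure \<gamma> K \<ge> 3 / 4"
    using K1(2) finite_measure_mono[of K1 K] finite_measure_compl[of K1] Kb \<gamma>1
    by (simp add: space_eq sets_eq K_def)
  have \<mu>K: "measure ?\<mu> K \<ge> 3 / 4"
    using K2(2) \<mu>.finite_measure_mono[of K2 K] \<mu>.finite_measure_compl[of K2] Kb \<mu>1
    by (simp add: space_eq sets_eq K_def)
  obtain t where t: "t \<in> trig_span G" "\<And>x. - (1 / 8) \<le> t x" "\<And>x. t x \<le> 1 + 1 / 8"
    "\<And>x. x \<in> K \<times> {0} \<Longrightarrow> 1 - 1 / 8 \<le> t x" "\<And>x. x \<in> K \<times> {1} \<Longrightarrow> t x \<le> 1 / 8"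
    by (rule G.trig_separates_compacts[of "K \<times> {0}" "K \<times> {1}" "1 / 8"])
      (use K in \<open>auto intro: compact_Times\<close>)
  have "5 / 8 \<le> measure \<gamma> K - 1 / 8" using \<gamma>K by simp
  also have "\<dots> = (\<integral>x. indicator K x - 1 / 8 \<partial>\<gamma>)"
    using integrable_moderate[OF IK] Kb by (simp add: space_eq prob_space[unfolded space_eq])
  also have "\<dots> \<le> (\<integral>x. t (x, 0) \<partial>\<gamma>)"
  proof (rule integral_mono)
    show "indicator K x - 1 / 8 \<le> t (x, 0)" for x
      using t(2)[of "(x, 0)"] t(4)[of "(x, 0)"] by (auto simp: indicator_def)
  qed (intro integrable_moderate moderate_diff moderate_const IK sec[OF t(1)])+
  also have "\<dots> = (\<integral>x. t (x, 1) \<partial>?\<mu>)" by (rule eq[OF t(1)])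
  also have "\<dots> \<le> (\<integral>x. 9 / 8 - indicator K x \<partial>?\<mu>)"
  proof (rule integral_mono)
    show "integrable ?\<mu> (\<lambda>x. 9 / 8 - indicat_real K x)"
      by (rule \<mu>.integrable_const_bound[of _ 2]) (use Kb in \<open>auto simp: \<mu>meas indicator_def\<close>)
    show "t (x, 1) \<le> 9 / 8 - indicator K x" for x
      using t(3)[of "(x, 1)"] t(5)[of "(x, 1)"] by (auto simp: indicator_def)
  qed (rule sec_int[OF t(1)])
  also have "\<dots> = 9 / 8 - measure ?\<mu> K"
  proof -
    have "integrable ?\<mu> (indicat_real K)"
      by (rule \<mu>.integrable_const_bound[of _ 1]) (use Kb in \<open>auto simp: \<mu>meas indicator_def\<close>)
    then show ?thesis using Kb \<mu>1 by (simp add: space_eq)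
  qed
  also have "\<dots> \<le> 3 / 8" using \<mu>K by simp
  finally show False by simp
qed

text \<open>The Riesz representer of the functional \<open>l\<close> in the Cameron--Martin space.\<close>

definition cm_vector :: "('a \<Rightarrow> real) \<Rightarrow> 'a" where
  "cm_vector l = (SOME h. \<forall>m\<in>top_dual. m h = cov l m)"

lemma dual_cm_vector:
  assumes "l \<in> top_dual" "m \<in> top_dual"
  shows "m (cm_vector l) = cov l m"
proof -
  have "\<exists>h. \<forall>m\<in>top_dual. m h = cov l m" using ex_representer[OF assms(1)] by metis
  from someI_ex[OF this] show ?thesis using assms(2) by (simp add: cm_vector_def)
qed

lemma cm_vector_eqI:
  assumes "l \<in> top_dual" "\<And>m. m \<in> top_dual \<Longrightarrow> m h = cov l m"
  shows "cm_vector l = h"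
  by (rule top_dual_eqI) (simp add: assms dual_cm_vector)

lemma cm_vector_add: "l \<in> top_dual \<Longrightarrow> m \<in> top_dual \<Longrightarrow>
    cm_vector (\<lambda>x. l x + m x) = cm_vector l + cm_vector m"
  by (rule cm_vector_eqI) (auto simp: top_dual_linear dual_cm_vector cov_add top_dual_add)

lemma cm_vector_scale: "l \<in> top_dual \<Longrightarrow> cm_vector (\<lambda>x. c * l x) = c *\<^sub>R cm_vector l"
  by (rule cm_vector_eqI) (auto simp: top_dual_linear dual_cm_vector cov_scale top_dual_scale)

lemma cm_vector_sum:
  assumes "\<And>i. i \<in> I \<Longrightarrow> l i \<in> top_dual"
  shows "(\<lambda>x. \<Sum>i\<in>I. c i * l i x) \<in> top_dual"
    and "cm_vector (\<lambda>x. \<Sum>i\<in>I. c i * l i x) = (\<Sum>i\<in>I. c i *\<^sub>R cm_vector (l i))"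
proof -
  have "(\<lambda>x. \<Sum>i\<in>I. c i * l i x) \<in> top_dual \<and>
    cm_vector (\<lambda>x. \<Sum>i\<in>I. c i * l i x) = (\<Sum>i\<in>I. c i *\<^sub>R cm_vector (l i))"
    using assms
  proof (induction I rule: infinite_finite_induct)
    case (insert i I)
    then have "(\<lambda>x. c i * l i x) \<in> top_dual" "l i \<in> top_dual" by (auto intro: top_dual_scale)
    then show ?case using insert by (simp add: top_dual_add cm_vector_add cm_vector_scale)
  qed (auto intro!: top_dual_zero cm_vector_eqI simp: cov_def top_dual_linear)
  then show "(\<lambda>x. \<Sum>i\<in>I. c i * l i x) \<in> top_dual"
    "cm_vector (\<lambda>x. \<Sum>i\<in>I. c i * l i x) = (\<Sum>i\<in>I. c i *\<^sub>R cm_vector (l i))" by auto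
qed

text \<open>Both measures are Radon and have the same trigonometric integrals.\<close>

theorem cameron_martin:
  assumes l: "l \<in> top_dual"
  shows "distr \<gamma> borel (\<lambda>x. x + cm_vector l) = density \<gamma> (\<lambda>x. ennreal (cm_density l x))"
proof (rule top_dual.radon_measure_eqI_trig)
  define h where "h = cm_vector l"
  have cont: "continuous_on UNIV (\<lambda>x::'a. x + k)" for k by (intro continuous_intros)
  have meas [measurable]: "(\<lambda>x. x + k) \<in> measurable borel (borel :: 'a measure)" for k
    by (rule borel_measurable_continuous_onI[OF cont])
  have meas': "(\<lambda>x. x + k) \<in> measurable \<gamma> (borel :: 'a measure)" for k
    using meas by (simp add: measurable_eq)
  show "radon_measure (distr \<gamma> borel (\<lambda>x. x + cm_vector l))"
    unfolding radon_measure_def h_def[symmetric]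
  proof (intro conjI ballI allI impI)
    show "finite_measure (distr \<gamma> borel (\<lambda>x. x + h))" by (rule finite_measure_distr[OF meas'])
    fix B :: "'a set" and e :: real assume "B \<in> sets (distr \<gamma> borel (\<lambda>x. x + h))" and e: "e > 0"
    then have B: "B \<in> sets borel" by simp
    define B' where "B' = (\<lambda>x. x + h) -` B"
    have "B' \<in> sets \<gamma>" unfolding B'_def using measurable_sets[OF meas' B] by (simp add: space_eq)
    then obtain K where K: "compact K" "K \<subseteq> B'" "measure \<gamma> (B' - K) < e"
      using radon e unfolding radon_measure_def by metis
    have K': "compact ((\<lambda>x. x + h) ` K)"
      by (rule compact_continuous_image[OF continuous_on_subset[OF cont] K(1)]) simp
    moreover have "measure (distr \<gamma> borel (\<lambda>x. x + h)) (B - (\<lambda>x. x + h) ` K) = measure \<gamma> (B' - K)"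
    proof (subst measure_distr[OF meas'])
      show "B - (\<lambda>x. x + h) ` K \<in> sets borel" using B K' by (auto simp: borel_compact)
      have "(\<lambda>x. x + h) -` (B - (\<lambda>x. x + h) ` K) \<inter> space \<gamma> = B' - K"
        by (auto simp: B'_def space_eq)
      then show "measure \<gamma> ((\<lambda>x. x + h) -` (B - (\<lambda>x. x + h) ` K) \<inter> space \<gamma>) = measure \<gamma> (B' - K)"
        by simp
    qed
    moreover have "(\<lambda>x. x + h) ` K \<subseteq> B" using K(2) by (auto simp: B'_def)
    ultimately show "\<exists>K. compact K \<and> K \<subseteq> B \<and> measure (distr \<gamma> borel (\<lambda>x. x + h)) (B - K) < e"
      using K(3) by metis
  qed simp
  show "radon_measure (density \<gamma> (\<lambda>x. ennreal (cm_density l x)))"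
    by (rule radon_measure_cm_density[OF l])
  fix m :: "'a \<Rightarrow> real" assume m: "m \<in> top_dual"
  have [measurable]: "m \<in> borel_measurable borel" using m by auto
  have [simp]: "integrable \<gamma> (\<lambda>x. cos (m x))" "integrable \<gamma> (\<lambda>x. sin (m x))"
    using m by (auto intro!: integrable_moderate moderate_cos moderate_sin)
  show "(\<integral>x. cos (m x) \<partial>distr \<gamma> borel (\<lambda>x. x + cm_vector l)) =
      (\<integral>x. cos (m x) \<partial>density \<gamma> (\<lambda>x. ennreal (cm_density l x)))"
    by (subst integral_distr[OF meas'], simp, subst integral_cm_density[OF l], simp)
      (simp add: top_dual_linear[OF m] dual_cm_vector l m cos_add gaussian_trig cm_density_trig)
  show "(\<integral>x. sin (m x) \<partial>distr \<gamma> borel (\<lambda>x. x + cm_vector l)) =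
      (\<integral>x. sin (m x) \<partial>density \<gamma> (\<lambda>x. ennreal (cm_density l x)))"
    by (subst integral_distr[OF meas'], simp, subst integral_cm_density[OF l], simp)
      (simp add: top_dual_linear[OF m] dual_cm_vector l m sin_add gaussian_trig cm_density_trig)
qed

corollary integral_shift:
  assumes l: "l \<in> top_dual" and F: "F \<in> borel_measurable borel"
  shows "(\<integral>x. F (x + cm_vector l) \<partial>\<gamma>) = (\<integral>x. cm_density l x * F x \<partial>\<gamma>)"
proof -
  have "continuous_on UNIV (\<lambda>x::'a. x + cm_vector l)" by (intro continuous_intros)
  then have "(\<lambda>x. x + cm_vector l) \<in> measurable \<gamma> borel"
    using borel_measurable_continuous_onI measurable_eq by blast
  then have "(\<integral>x. F (x + cm_vector l) \<partial>\<gamma>) = (\<integral>x. F x \<partial>distr \<gamma> borel (\<lambda>x. x + cm_vector l))"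
    by (rule integral_distr[OF _ F, symmetric])
  also have "\<dots> = (\<integral>x. cm_density l x * F x \<partial>\<gamma>)"
    unfolding cameron_martin[OF l] by (rule integral_cm_density[OF l F])
  finally show ?thesis .
qed

section \<open>Integration by parts\<close>

text \<open>Differentiate the identity \<open>\<integral> F(x + t h) d\<gamma> = \<integral> F exp (t l - t\<^sup>2 q / 2) d\<gamma>\<close> at \<open>t = 0\<close>, where \<open>h\<close> represents \<open>l\<close>
  and \<open>q = \<integral> l\<^sup>2 d\<gamma>\<close>. Both difference quotients are dominated by functions of moderate growth.\<close>

theorem gaussian_integration_by_parts:
  assumes l: "l \<in> top_dual" and F: "F \<in> moderate" and F': "F' \<in> moderate"
    and deriv: "\<And>x. ((\<lambda>t. F (x + t *\<^sub>R cm_vector l)) has_real_derivative F' x) (at 0)"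
  shows "(\<integral>x. F' x \<partial>\<gamma>) = (\<integral>x. l x * F x \<partial>\<gamma>)"
proof -
  define h where "h = cm_vector l"
  define q where "q = cov l l"
  have q: "q \<ge> 0" by (simp add: q_def cov_nonneg)
  define s where "s n = 1 / real (Suc n)" for n
  have s: "s n > 0" "s n \<le> 1" for n by (auto simp: s_def)
  have s0: "s \<longlonglongrightarrow> 0" unfolding s_def by (rule LIMSEQ_Suc[OF lim_1_over_n])
  have sat: "filterlim s (at 0) sequentially"
    using s(1) s0 by (auto simp: filterlim_at less_imp_neq[symmetric])
  have cont: "continuous_on UNIV (\<lambda>x::'a. x + k)" for k by (intro continuous_intros)
  have meas [measurable]: "(\<lambda>x. x + k) \<in> measurable borel (borel :: 'a measure)" for k
    by (rule borel_measurable_continuous_onI[OF cont])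
  have [measurable]: "F \<in> borel_measurable borel" "F' \<in> borel_measurable borel" "l \<in> borel_measurable borel"
    using F F' l by auto
  have shift: "(\<integral>x. (F (x + s n *\<^sub>R h) - F x) / s n \<partial>\<gamma>) =
      (\<integral>x. F x * ((exp (s n * l x - (s n)\<^sup>2 * q / 2) - 1) / s n) \<partial>\<gamma>)" for n
  proof -
    obtain D where D: "D \<in> moderate" "\<And>x t. \<bar>t\<bar> \<le> 1 \<Longrightarrow> \<bar>F (x + t *\<^sub>R h)\<bar> \<le> D x"
      using moderate_shift[OF F] by metis
    have Fs: "integrable \<gamma> (\<lambda>x. F (x + s n *\<^sub>R h))"
    proof (rule Bochner_Integration.integrable_bound[OF integrable_moderate[OF D(1)]])
      show "AE x in \<gamma>. norm (F (x + s n *\<^sub>R h)) \<le> norm (D x)"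
      proof (rule AE_I2)
        fix x
        have "\<bar>F (x + s n *\<^sub>R h)\<bar> \<le> D x" using s[of n] by (intro D(2)) auto
        then show "norm (F (x + s n *\<^sub>R h)) \<le> norm (D x)" by simp
      qed
    qed measurable
    have sl: "(\<lambda>x. s n * l x) \<in> top_dual" by (rule top_dual_scale[OF l])
    have cd: "cm_density (\<lambda>x. s n * l x) x = exp (s n * l x - (s n)\<^sup>2 * q / 2)" for x
      by (simp add: cm_density_def cov_scale cov_scale2 q_def power2_eq_square mult.assoc)
    have wF: "integrable \<gamma> (\<lambda>x. cm_density (\<lambda>x. s n * l x) x * F x)"
      by (intro integrable_moderate moderate_mult cm_density_moderate sl F)
    have "(\<integral>x. (F (x + s n *\<^sub>R h) - F x) / s n \<partial>\<gamma>) =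
        ((\<integral>x. F (x + s n *\<^sub>R h) \<partial>\<gamma>) - (\<integral>x. F x \<partial>\<gamma>)) / s n"
      using Fs integrable_moderate[OF F] by simp
    also have "(\<integral>x. F (x + s n *\<^sub>R h) \<partial>\<gamma>) = (\<integral>x. cm_density (\<lambda>x. s n * l x) x * F x \<partial>\<gamma>)"
      using integral_shift[OF sl, of F] cm_vector_scale[OF l, of "s n"] by (simp add: h_def)
    also have "((\<integral>x. cm_density (\<lambda>x. s n * l x) x * F x \<partial>\<gamma>) - (\<integral>x. F x \<partial>\<gamma>)) / s n =
        (\<integral>x. (cm_density (\<lambda>x. s n * l x) x * F x - F x) / s n \<partial>\<gamma>)"
      using wF integrable_moderate[OF F] by simp
    also have "\<dots> = (\<integral>x. F x * ((exp (s n * l x - (s n)\<^sup>2 * q / 2) - 1) / s n) \<partial>\<gamma>)"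
      unfolding cd by (rule Bochner_Integration.integral_cong) (auto simp: algebra_simps diff_divide_distrib)
    finally show ?thesis .
  qed
  have lim1: "(\<lambda>n. \<integral>x. (F (x + s n *\<^sub>R h) - F x) / s n \<partial>\<gamma>) \<longlonglongrightarrow> (\<integral>x. F' x \<partial>\<gamma>)"
  proof -
    obtain D where D: "D \<in> moderate" "\<And>x t. \<bar>t\<bar> \<le> 1 \<Longrightarrow> \<bar>F' (x + t *\<^sub>R h)\<bar> \<le> D x"
      using moderate_shift[OF F'] by metis
    show ?thesis
    proof (rule integral_dominated_convergence[OF _ _ integrable_moderate[OF D(1)]])
      show "AE x in \<gamma>. (\<lambda>n. (F (x + s n *\<^sub>R h) - F x) / s n) \<longlonglongrightarrow> F' x"
      proof (rule AE_I2)
        fix x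
        have "((\<lambda>t. (F (x + t *\<^sub>R h) - F x) / t) \<longlongrightarrow> F' x) (at 0)"
          using deriv[of x] by (simp add: h_def has_field_derivative_iff)
        from filterlim_compose[OF this sat]
        show "(\<lambda>n. (F (x + s n *\<^sub>R h) - F x) / s n) \<longlonglongrightarrow> F' x" .
      qed
      show "AE x in \<gamma>. norm ((F (x + s n *\<^sub>R h) - F x) / s n) \<le> D x" for n
      proof (rule AE_I2)
        fix x
        have der: "((\<lambda>t. F (x + t *\<^sub>R h)) has_real_derivative F' (x + t *\<^sub>R h)) (at t)" for t
        proof -
          have "((\<lambda>u. F ((x + t *\<^sub>R h) + u *\<^sub>R h)) has_real_derivative F' (x + t *\<^sub>R h)) (at (t + (- t)))"
            using deriv[of "x + t *\<^sub>R h"] by (simp add: h_def)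
          from DERIV_shift[THEN iffD1, OF this] show ?thesis
            by (simp add: algebra_simps)
        qed
        obtain z where z: "0 < z" "z < s n" "F (x + s n *\<^sub>R h) - F (x + 0 *\<^sub>R h) = (s n - 0) * F' (x + z *\<^sub>R h)"
          using MVT2[of 0 "s n" "\<lambda>t. F (x + t *\<^sub>R h)" "\<lambda>t. F' (x + t *\<^sub>R h)"] der s(1)[of n] by blast
        then have "(F (x + s n *\<^sub>R h) - F x) / s n = F' (x + z *\<^sub>R h)" using s(1)[of n] by simp
        then show "norm ((F (x + s n *\<^sub>R h) - F x) / s n) \<le> D x"
          using D(2)[of z x] z s(2)[of n] by simp
      qed
    qed (simp_all add: measurable_eq)
  qed
  have lim2: "(\<lambda>n. \<integral>x. F x * ((exp (s n * l x - (s n)\<^sup>2 * q / 2) - 1) / s n) \<partial>\<gamma>) \<longlonglongrightarrow> (\<integral>x. F x * l x \<partial>\<gamma>)"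
  proof -
    define W where "W x = \<bar>F x\<bar> * (exp q * exp (\<Sum>l\<leftarrow>[l, l]. \<bar>l x\<bar>))" for x
    have absF: "(\<lambda>x. \<bar>F x\<bar>) \<in> moderate" using F by (auto simp: moderate_def)
    have W: "W \<in> moderate" unfolding W_def
      by (intro moderate_mult absF moderate_cmult moderate_exp_sum) (use l in simp)
    show ?thesis
    proof (rule integral_dominated_convergence[OF _ _ integrable_moderate[OF W]])
      show "AE x in \<gamma>. (\<lambda>n. F x * ((exp (s n * l x - (s n)\<^sup>2 * q / 2) - 1) / s n)) \<longlonglongrightarrow> F x * l x"
      proof (rule AE_I2)
        fix x
        have "((\<lambda>t. exp (t * l x - t\<^sup>2 * q / 2)) has_real_derivative l x) (at 0)"
          by (auto intro!: derivative_eq_intros)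
        then have "((\<lambda>t. (exp (t * l x - t\<^sup>2 * q / 2) - 1) / t) \<longlongrightarrow> l x) (at 0)"
          by (simp add: has_field_derivative_iff)
        from tendsto_mult_left[OF filterlim_compose[OF this sat]]
        show "(\<lambda>n. F x * ((exp (s n * l x - (s n)\<^sup>2 * q / 2) - 1) / s n)) \<longlonglongrightarrow> F x * l x" .
      qed
      show "AE x in \<gamma>. norm (F x * ((exp (s n * l x - (s n)\<^sup>2 * q / 2) - 1) / s n)) \<le> W x" for n
      proof (rule AE_I2)
        fix x
        define u where "u = s n * l x - (s n)\<^sup>2 * q / 2"
        define v where "v = \<bar>l x\<bar> + q / 2"
        have v: "v \<ge> 0" using q by (simp add: v_def)
        have "\<bar>u\<bar> \<le> s n * \<bar>l x\<bar> + (s n)\<^sup>2 * q / 2"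
          unfolding u_def using s(1)[of n] q by (intro order_trans[OF abs_triangle_ineq4]) (simp add: abs_mult)
        also have "\<dots> \<le> s n * v"
          using s[of n] q mult_right_mono[of "s n" 1 "s n * q"]
          by (simp add: v_def distrib_left power2_eq_square mult.assoc mult_left_le_one_le)
        finally have u: "\<bar>u\<bar> \<le> s n * v" .
        have uv: "\<bar>u\<bar> \<le> v" using u s[of n] v mult_right_mono[of "s n" 1 v] by linarith
        have "\<bar>exp u - 1\<bar> \<le> \<bar>u\<bar> * exp \<bar>u\<bar>"
        proof -
          have "exp u - 1 \<le> u * exp u"
            using mult_left_mono[OF exp_ge_add_one_self[of "- u"], of "exp u"] by (simp add: exp_minus algebra_simps)
          then have "exp u - 1 \<le> \<bar>u\<bar> * exp \<bar>u\<bar>"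
            using mult_mono[of u "\<bar>u\<bar>" "exp u" "exp \<bar>u\<bar>"] by (simp add: abs_ge_self)
          moreover have "1 - exp u \<le> - u" using exp_ge_add_one_self[of u] by linarith
          moreover have "- u \<le> \<bar>u\<bar> * exp \<bar>u\<bar>"
            using mult_left_mono[of 1 "exp \<bar>u\<bar>" "\<bar>u\<bar>"] by simp
          ultimately show ?thesis by linarith
        qed
        also have "\<dots> \<le> (s n * v) * exp v"
          using u uv s(1)[of n] v by (intro mult_mono) auto
        also have "\<dots> \<le> s n * (exp v * exp v)"
          using s(1)[of n] exp_ge_add_one_self[of v] by (simp add: mult.assoc mult_left_mono mult_right_mono del: exp_ge_add_one_self)
        finally have "\<bar>(exp u - 1) / s n\<bar> \<le> exp v * exp v"
          using s(1)[of n] by (simp add: field_simps)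
        moreover have "exp v * exp v = exp q * exp (\<Sum>l\<leftarrow>[l, l]. \<bar>l x\<bar>)"
          by (simp add: v_def exp_add[symmetric])
        ultimately show "norm (F x * ((exp (s n * l x - (s n)\<^sup>2 * q / 2) - 1) / s n)) \<le> W x"
          unfolding u_def W_def real_norm_def abs_mult by (intro mult_left_mono) auto
      qed
    qed (simp_all add: measurable_eq)
  qed
  have "(\<integral>x. F' x \<partial>\<gamma>) = (\<integral>x. F x * l x \<partial>\<gamma>)"
    by (rule LIMSEQ_unique[OF lim1 lim2[folded shift]])
  then show ?thesis by (simp add: mult.commute)
qed

end

context radon_gaussian
begin

section \<open>The norm of the Cameron--Martin space\<close>

lemma cm_enorm_nonneg: "0 \<le> cm_enorm \<gamma> h"
  unfolding cm_enorm_def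
  by (rule SUP_upper2[of "\<lambda>_. 0"]) (auto simp: top_dual_zero moderate_L2 moderate_const)

lemma cm_spaceI:
  assumes "0 \<le> c" "\<And>m. m \<in> top_dual \<Longrightarrow> m h \<le> c * sqrt (cov m m)"
  shows "h \<in> cm_space \<gamma>" and "cm_norm \<gamma> h \<le> c"
proof -
  have le: "cm_enorm \<gamma> h \<le> ereal c"
    unfolding cm_enorm_def
  proof (rule SUP_least)
    fix m assume "m \<in> {l \<in> top_dual. l \<in> L2_space \<gamma> \<and> (\<integral>x. (l x)\<^sup>2 \<partial>\<gamma>) \<le> 1}"
    then have m: "m \<in> top_dual" "cov m m \<le> 1" by (auto simp: cov_def power2_eq_square)
    have "m h \<le> c * sqrt (cov m m)" by (rule assms(2)[OF m(1)])
    also have "\<dots> \<le> c" using m(2) assms(1) by (simp add: mult_left_le)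
    finally show "ereal (m h) \<le> ereal c" by simp
  qed
  then show "h \<in> cm_space \<gamma>" unfolding cm_space_def by (auto simp: order_le_less_trans)
  show "cm_norm \<gamma> h \<le> c" using le cm_enorm_nonneg[of h]
    unfolding cm_norm_def by (cases "cm_enorm \<gamma> h") auto
qed

lemma cm_norm_nonneg: "0 \<le> cm_norm \<gamma> h"
  unfolding cm_norm_def by (rule real_of_ereal_pos[OF cm_enorm_nonneg])

lemma dual_le_cm_norm:
  assumes h: "h \<in> cm_space \<gamma>" and m: "m \<in> top_dual"
  shows "m h \<le> cm_norm \<gamma> h * sqrt (cov m m)"
proof -
  have fin: "cm_enorm \<gamma> h = ereal (cm_norm \<gamma> h)"
    using h cm_enorm_nonneg[of h] unfolding cm_norm_def cm_space_def by (cases "cm_enorm \<gamma> h") auto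
  have adm: "r * m h \<le> cm_norm \<gamma> h" if "r\<^sup>2 * cov m m \<le> 1" for r
  proof -
    have rm: "(\<lambda>x. r * m x) \<in> top_dual" by (rule top_dual_scale[OF m])
    have "(\<integral>x. (r * m x)\<^sup>2 \<partial>\<gamma>) \<le> 1"
      using that by (simp add: power_mult_distrib cov_def power2_eq_square[of "m _"])
    then have "ereal (r * m h) \<le> cm_enorm \<gamma> h"
      unfolding cm_enorm_def using rm by (intro SUP_upper2[of "\<lambda>x. r * m x"]) (auto intro: moderate_L2 moderate_dual)
    then show ?thesis by (simp add: fin)
  qed
  show ?thesis
  proof (cases "cov m m = 0")
    case True
    have "m h \<le> 0"
    proof (rule ccontr)
      assume "\<not> m h \<le> 0"
      then show False using adm[of "(cm_norm \<gamma> h + 1) / m h"] True by simp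
    qed
    then show ?thesis by (simp add: True)
  next
    case False
    then have pos: "cov m m > 0" using cov_nonneg[of m] by simp
    have "(1 / sqrt (cov m m)) * m h \<le> cm_norm \<gamma> h"
      using pos by (intro adm) (simp add: power_divide)
    then show ?thesis using pos by (simp add: field_simps)
  qed
qed

lemma dual_square_le_cm_norm:
  assumes h: "h \<in> cm_space \<gamma>" and m: "m \<in> top_dual"
  shows "(m h)\<^sup>2 \<le> (cm_norm \<gamma> h)\<^sup>2 * cov m m"
proof -
  have "- m h \<le> cm_norm \<gamma> h * sqrt (cov m m)"
    using dual_le_cm_norm[OF h top_dual_scale[OF m, of "-1"]] by (simp add: cov_def)
  then have "\<bar>m h\<bar> \<le> cm_norm \<gamma> h * sqrt (cov m m)" using dual_le_cm_norm[OF h m] by linarith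
  then have "\<bar>m h\<bar>\<^sup>2 \<le> (cm_norm \<gamma> h * sqrt (cov m m))\<^sup>2" by (rule power_mono) simp
  then show ?thesis using cov_nonneg[of m] by (simp add: power_mult_distrib)
qed

lemma cm_space_scale:
  assumes "h \<in> cm_space \<gamma>"
  shows "c *\<^sub>R h \<in> cm_space \<gamma>" and "cm_norm \<gamma> (c *\<^sub>R h) \<le> \<bar>c\<bar> * cm_norm \<gamma> h"
proof -
  have "m (c *\<^sub>R h) \<le> \<bar>c\<bar> * cm_norm \<gamma> h * sqrt (cov m m)" if m: "m \<in> top_dual" for m
  proof -
    have "sqrt (cov (\<lambda>x. c * m x) (\<lambda>x. c * m x)) = sqrt (c * c * cov m m)"
      by (simp add: cov_scale cov_scale2 mult.assoc)
    also have "\<dots> = \<bar>c\<bar> * sqrt (cov m m)" by (simp only: real_sqrt_mult real_sqrt_abs2[unfolded real_sqrt_mult])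
    finally show ?thesis
      using dual_le_cm_norm[OF assms top_dual_scale[OF m, of c]] m by (simp add: top_dual_linear ac_simps)
  qed
  then show "c *\<^sub>R h \<in> cm_space \<gamma>" "cm_norm \<gamma> (c *\<^sub>R h) \<le> \<bar>c\<bar> * cm_norm \<gamma> h"
    using cm_spaceI[of "\<bar>c\<bar> * cm_norm \<gamma> h" "c *\<^sub>R h"] by (simp_all add: cm_norm_nonneg)
qed

lemma cm_norm_uminus: "h \<in> cm_space \<gamma> \<Longrightarrow> cm_norm \<gamma> (- h) = cm_norm \<gamma> h"
  using cm_space_scale[of h "-1"] cm_space_scale[of "- h" "-1"] by simp

lemma cm_space_add:
  assumes "h \<in> cm_space \<gamma>" "k \<in> cm_space \<gamma>" shows "h + k \<in> cm_space \<gamma>"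
proof (rule cm_spaceI)
  show "m (h + k) \<le> (cm_norm \<gamma> h + cm_norm \<gamma> k) * sqrt (cov m m)" if "m \<in> top_dual" for m
    using dual_le_cm_norm[OF assms(1) that] dual_le_cm_norm[OF assms(2) that] that
    by (simp add: top_dual_linear distrib_right)
qed (simp add: cm_norm_nonneg)

lemma cm_space_zero: "0 \<in> cm_space \<gamma>" and cm_norm_zero: "cm_norm \<gamma> 0 = 0"
  using cm_spaceI[of 0 0] cm_norm_nonneg[of 0] by (auto simp: top_dual_linear)

lemma cm_space_sum:
  "(\<And>i. i \<in> I \<Longrightarrow> h i \<in> cm_space \<gamma>) \<Longrightarrow> (\<Sum>i\<in>I. c i *\<^sub>R h i) \<in> cm_space \<gamma>"
  by (induction I rule: infinite_finite_induct) (auto intro: cm_space_zero cm_space_add cm_space_scale)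

lemma cov_Cauchy_Schwarz:
  assumes "l \<in> top_dual" "m \<in> top_dual"
  shows "\<bar>cov l m\<bar> \<le> sqrt (cov l l) * sqrt (cov m m)"
  using L2_Cauchy_Schwarz[OF moderate_L2[OF moderate_dual[OF assms(1)]] moderate_L2[OF moderate_dual[OF assms(2)]]]
  by (simp add: cov_def L2_norm_def power2_eq_square)

lemma cm_vector_in_cm_space:
  assumes l: "l \<in> top_dual" shows "cm_vector l \<in> cm_space \<gamma>"
proof (rule cm_spaceI)
  show "m (cm_vector l) \<le> sqrt (cov l l) * sqrt (cov m m)" if "m \<in> top_dual" for m
    using cov_Cauchy_Schwarz[OF l that] by (simp add: dual_cm_vector l that)
qed (simp add: cov_nonneg)

text \<open>The Cauchy--Schwarz inequality between \<open>k + h\<close> and \<open>m\<close> in terms of the Gram matrix of three vectors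
  \<open>k, h, m\<close>: the square norms are \<open>K, q, M\<close>, and \<open>\<kappa> = \<langle>k, h\<rangle>\<close>, \<open>\<mu> = \<langle>k, m\<rangle>\<close>, \<open>B = \<langle>h, m\<rangle>\<close>. It
  follows from the Cauchy--Schwarz inequality for \<open>k\<close> against all combinations of \<open>h\<close> and \<open>m\<close>. This form
  applies to a norm that is defined as a supremum over functionals and not yet known to come
  from an inner product.\<close>

lemma gram_inequality:
  fixes K \<kappa> \<mu> B M q :: real
  assumes "M \<ge> 0" and psd: "\<And>a b. (a * \<mu> + b * \<kappa>)\<^sup>2 \<le> K * (a\<^sup>2 * M + 2 * a * b * B + b\<^sup>2 * q)"
    and CS: "B\<^sup>2 \<le> M * q"
  shows "(\<mu> + B)\<^sup>2 \<le> M * (K + 2 * \<kappa> + q)"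
proof (cases "M = 0")
  case True
  then have "B = 0" using CS by simp
  moreover have "\<mu> = 0" using psd[of 1 0] True by simp
  ultimately show ?thesis by (simp add: True)
next
  case False
  then have M: "M > 0" using assms(1) by simp
  define \<alpha> \<beta> \<delta> where "\<alpha> = M * K - \<mu>\<^sup>2" and "\<beta> = M * \<kappa> - \<mu> * B" and "\<delta> = M * q - B\<^sup>2"
  have \<delta>: "\<delta> \<ge> 0" using CS by (simp add: \<delta>_def)
  have \<alpha>: "\<alpha> \<ge> 0" using psd[of 1 0] by (simp add: \<alpha>_def mult.commute)
  \<comment> \<open>replace \<open>h\<close> by its component orthogonal to \<open>m\<close>\<close>
  have key: "(s * \<mu> + b * \<beta>)\<^sup>2 \<le> K * (s\<^sup>2 * M + b\<^sup>2 * (M * \<delta>))" for s b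
  proof -
    have "(s - b * B) * \<mu> + (b * M) * \<kappa> = s * \<mu> + b * \<beta>" by (simp add: \<beta>_def algebra_simps)
    moreover have "(s - b * B)\<^sup>2 * M + 2 * (s - b * B) * (b * M) * B + (b * M)\<^sup>2 * q = s\<^sup>2 * M + b\<^sup>2 * (M * \<delta>)"
      by (simp add: \<delta>_def power2_eq_square algebra_simps)
    ultimately show ?thesis using psd[of "s - b * B" "b * M"] by simp
  qed
  \<comment> \<open>the claim, multiplied out\<close>
  have "\<alpha> + 2 * \<beta> + \<delta> \<ge> 0"
  proof (cases "\<delta> = 0")
    case True
    then have "\<beta> = 0" using key[of 0 1] by simp
    then show ?thesis using True \<alpha> by simp
  next
    case False
    then have \<delta>: "\<delta> > 0" using \<delta> by simp
    have "\<beta>\<^sup>2 \<le> \<alpha> * \<delta>"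
    proof -
      define X where "X = \<mu>\<^sup>2 * \<delta> + \<beta>\<^sup>2"
      have "(\<mu> * \<delta> * \<mu> + \<beta> * \<beta>)\<^sup>2 \<le> K * ((\<mu> * \<delta>)\<^sup>2 * M + \<beta>\<^sup>2 * (M * \<delta>))" by (rule key)
      then have *: "X * X \<le> (K * M * \<delta>) * X" by (simp add: X_def power2_eq_square algebra_simps)
      have "X \<ge> 0" using \<delta> by (simp add: X_def)
      show ?thesis
      proof (cases "X = 0")
        case True
        then have "\<beta>\<^sup>2 = 0" using \<delta> by (simp add: X_def add_nonneg_eq_0_iff)
        then show ?thesis using \<alpha> \<delta> by simp
      next
        case False
        then have "X \<le> K * M * \<delta>" using * \<open>X \<ge> 0\<close> by (simp add: mult_le_cancel_right)
        then show ?thesis by (simp add: X_def \<alpha>_def algebra_simps)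
      qed
    qed
    then have "0 \<le> \<delta> * (\<alpha> + 2 * \<beta> + \<delta>)"
      using zero_le_power2[of "\<beta> + \<delta>"] by (simp add: power2_eq_square algebra_simps)
    then show ?thesis using \<delta> by (simp add: zero_le_mult_iff)
  qed
  then show ?thesis by (simp add: \<alpha>_def \<beta>_def \<delta>_def power2_eq_square algebra_simps)
qed

lemma cm_norm_add_cm_vector_le:
  assumes l: "l \<in> top_dual" and k: "k \<in> cm_space \<gamma>"
  shows "(cm_norm \<gamma> (k + cm_vector l))\<^sup>2 \<le> (cm_norm \<gamma> k)\<^sup>2 + 2 * l k + cov l l"
proof -
  define Q where "Q = (cm_norm \<gamma> k)\<^sup>2 + 2 * l k + cov l l"
  have *: "(m k + cov l m)\<^sup>2 \<le> cov m m * Q" if m: "m \<in> top_dual" for m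
    unfolding Q_def
  proof (rule gram_inequality[OF cov_nonneg])
    fix a b :: real
    have am: "(\<lambda>x. a * m x) \<in> top_dual" "(\<lambda>x. b * l x) \<in> top_dual" using l m by (auto intro: top_dual_scale)
    have "cov (\<lambda>x. a * m x + b * l x) (\<lambda>x. a * m x + b * l x) = a\<^sup>2 * cov m m + 2 * a * b * cov l m + b\<^sup>2 * cov l l"
      using am top_dual_add[OF am] l m
      by (simp add: cov_add cov_add2 cov_scale cov_scale2 cov_sym[of m l] power2_eq_square algebra_simps)
    then show "(a * m k + b * l k)\<^sup>2 \<le> (cm_norm \<gamma> k)\<^sup>2 * (a\<^sup>2 * cov m m + 2 * a * b * cov l m + b\<^sup>2 * cov l l)"
      using dual_square_le_cm_norm[OF k top_dual_add[OF am]] by simp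
    have "\<bar>cov l m\<bar>\<^sup>2 \<le> (sqrt (cov l l) * sqrt (cov m m))\<^sup>2"
      by (rule power_mono[OF cov_Cauchy_Schwarz[OF l m]]) simp
    then show "(cov l m)\<^sup>2 \<le> cov m m * cov l l"
      by (simp add: power_mult_distrib cov_nonneg mult.commute)
  qed
  have Q: "Q \<ge> 0"
  proof -
    have "- (l k) \<le> cm_norm \<gamma> k * sqrt (cov l l)"
      using dual_le_cm_norm[OF k top_dual_scale[OF l, of "-1"]] by (simp add: cov_def)
    moreover have "2 * (cm_norm \<gamma> k * sqrt (cov l l)) \<le> (cm_norm \<gamma> k)\<^sup>2 + (sqrt (cov l l))\<^sup>2"
      using sum_squares_bound[of "cm_norm \<gamma> k" "sqrt (cov l l)"] by (simp add: mult.assoc)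
    ultimately show ?thesis using cov_nonneg[of l] by (simp add: Q_def)
  qed
  have "cm_norm \<gamma> (k + cm_vector l) \<le> sqrt Q"
  proof (rule cm_spaceI(2))
    fix m assume m: "m \<in> (top_dual :: ('a \<Rightarrow> real) set)"
    have "m k + cov l m \<le> sqrt (cov m m * Q)" by (rule real_le_rsqrt[OF *[OF m]])
    then show "m (k + cm_vector l) \<le> sqrt Q * sqrt (cov m m)"
      by (simp add: top_dual_linear m dual_cm_vector l real_sqrt_mult mult.commute)
  qed (simp add: Q)
  from power_mono[OF this cm_norm_nonneg, of 2] show ?thesis using Q by (simp add: Q_def)
qed

text \<open>The inequality \<open>\<ge>\<close> is the inequality \<open>\<le>\<close> for the vector \<open>k + h\<close> and the functional \<open>- l\<close>, where \<open>h\<close>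
  represents \<open>l\<close>.\<close>

lemma cm_norm_add_cm_vector:
  assumes l: "l \<in> top_dual" and k: "k \<in> cm_space \<gamma>"
  shows "(cm_norm \<gamma> (k + cm_vector l))\<^sup>2 = (cm_norm \<gamma> k)\<^sup>2 + 2 * l k + cov l l"
proof (rule antisym[OF cm_norm_add_cm_vector_le[OF l k]])
  have "(cm_norm \<gamma> ((k + cm_vector l) + cm_vector (\<lambda>x. (-1) * l x)))\<^sup>2
      \<le> (cm_norm \<gamma> (k + cm_vector l))\<^sup>2 + 2 * ((-1) * l (k + cm_vector l)) + cov (\<lambda>x. (-1) * l x) (\<lambda>x. (-1) * l x)"
    by (intro cm_norm_add_cm_vector_le top_dual_scale l cm_space_add k cm_vector_in_cm_space)
  then show "(cm_norm \<gamma> k)\<^sup>2 + 2 * l k + cov l l \<le> (cm_norm \<gamma> (k + cm_vector l))\<^sup>2"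
    unfolding cm_vector_scale[OF l] cov_scale cov_scale2
    by (simp add: top_dual_linear l dual_cm_vector)
qed

lemma cm_norm_cm_vector:
  assumes "l \<in> top_dual" shows "(cm_norm \<gamma> (cm_vector l))\<^sup>2 = cov l l"
  using cm_norm_add_cm_vector[OF assms cm_space_zero] assms by (simp add: cm_norm_zero top_dual_linear)

text \<open>The reproducing property. It computes all inner products that occur below, since the
  vector fields take values in the span of representers.\<close>

lemma cm_inner_cm_vector:
  assumes l: "l \<in> top_dual" and k: "k \<in> cm_space \<gamma>"
  shows "cm_inner \<gamma> (cm_vector l) k = l k"
proof -
  have k': "- k \<in> cm_space \<gamma>" using cm_space_scale(1)[OF k, of "-1"] by simp
  have "(cm_norm \<gamma> (cm_vector l + k))\<^sup>2 = (cm_norm \<gamma> k)\<^sup>2 + 2 * l k + cov l l"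
    using cm_norm_add_cm_vector[OF l k] by (simp add: add.commute)
  moreover have "(cm_norm \<gamma> (cm_vector l - k))\<^sup>2 = (cm_norm \<gamma> k)\<^sup>2 - 2 * l k + cov l l"
    using cm_norm_add_cm_vector[OF l k'] l by (simp add: cm_norm_uminus[OF k] top_dual_linear)
  ultimately show ?thesis by (simp add: cm_inner_def)
qed

text \<open>The equality case of the Cauchy--Schwarz inequality: \<open>e\<close> and \<open>l\<close> have norm \<open>1\<close> and \<open>l e = 1\<close>, so the
  difference of \<open>e\<close> and the representer of \<open>l\<close> has norm \<open>0\<close>.\<close>

lemma dual_orthonormal_cm_vector:
  assumes "dual_orthonormal \<gamma> n l e" and j: "j < n"
  shows "e j = cm_vector (l j)"
proof (rule cm_vector_eqI[symmetric])
  have l: "l j \<in> top_dual" and e: "e j \<in> cm_space \<gamma>" and ll: "cov (l j) (l j) = 1"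
    and ee: "cm_inner \<gamma> (e j) (e j) = 1" and le: "l j (e j) = 1"
    using assms by (auto simp: dual_orthonormal_def cov_def)
  show "l j \<in> top_dual" by fact
  have e2: "(cm_norm \<gamma> (e j))\<^sup>2 = 1"
  proof -
    have "cm_norm \<gamma> (2 *\<^sub>R e j) = 2 * cm_norm \<gamma> (e j)"
      using cm_space_scale[OF e, of 2] cm_space_scale(2)[OF cm_space_scale(1)[OF e, of 2], of "1/2"] by simp
    then show ?thesis using ee by (simp add: cm_inner_def cm_norm_zero power_mult_distrib scaleR_2)
  qed
  \<comment> \<open>the difference of \<open>e j\<close> and the representer of \<open>l j\<close>\<close>
  define k where "k = e j + cm_vector (\<lambda>x. (-1) * l j x)"
  have l': "(\<lambda>x. (-1) * l j x) \<in> top_dual" by (rule top_dual_scale[OF l])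
  have "(cm_norm \<gamma> k)\<^sup>2 = 0"
    unfolding k_def cm_norm_add_cm_vector[OF l' e] cov_scale cov_scale2 by (simp add: ll e2 le)
  then have k0: "cm_norm \<gamma> k = 0" by simp
  have k: "k \<in> cm_space \<gamma>" unfolding k_def by (intro cm_space_add e cm_vector_in_cm_space l')
  fix m :: "'a \<Rightarrow> real" assume m: "m \<in> top_dual"
  have "(m k)\<^sup>2 \<le> 0" using dual_square_le_cm_norm[OF k m] by (simp add: k0)
  then have "m k = 0" by simp
  then show "m (e j) = cov (l j) m"
    unfolding k_def cm_vector_scale[OF l] by (simp add: top_dual_linear m dual_cm_vector l)
qed

end

section \<open>Hermite functions of a functional\<close>

text \<open>The Hermite polynomials for the centered normal distribution of variance \<open>q\<close>. With \<open>q\<close> as a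
  parameter functionals need not be normalized, and those that vanish almost everywhere are no
  exception: for \<open>q = 0\<close> the polynomials are the powers.\<close>

fun hermite :: "real \<Rightarrow> nat \<Rightarrow> real \<Rightarrow> real" where
  "hermite q 0 x = 1"
| "hermite q (Suc 0) x = x"
| "hermite q (Suc (Suc n)) x = x * hermite q (Suc n) x - real (Suc n) * q * hermite q n x"

lemma hermite_Suc: "hermite q (Suc n) x = x * hermite q n x - real n * q * hermite q (n - 1) x"
  by (cases n) auto

lemma DERIV_hermite: "(hermite q n has_real_derivative real n * hermite q (n - 1) x) (at x)"
proof (induction q n x rule: hermite.induct)
  case (3 q n x)
  show ?case
    by (rule derivative_eq_intros 3 refl | simp)+ (simp add: hermite_Suc[of q n x] algebra_simps)
qed (auto intro!: derivative_eq_intros)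

context radon_gaussian
begin

definition herm :: "('a \<Rightarrow> real) \<Rightarrow> nat \<Rightarrow> 'a \<Rightarrow> real" where
  "herm l k x = hermite (cov l l) k (l x)"

lemma herm_0: "herm l 0 x = 1" by (simp add: herm_def)

lemma herm_Suc: "herm l (Suc k) x = l x * herm l k x - real k * cov l l * herm l (k - 1) x"
  by (simp add: herm_def hermite_Suc)

lemma herm_moderate: "l \<in> top_dual \<Longrightarrow> herm l k \<in> moderate"
proof (induction k rule: less_induct)
  case (less k)
  show ?case
  proof (cases k)
    case 0
    then show ?thesis using moderate_const[of 1] by (simp add: herm_0[abs_def])
  next
    case (Suc j)
    have "(\<lambda>x. l x * herm l j x - (real j * cov l l) * herm l (j - 1) x) \<in> moderate"
      by (intro moderate_diff moderate_mult moderate_const moderate_dual[OF less.prems]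
          less.IH[OF _ less.prems]) (simp_all add: Suc)
    then show ?thesis by (simp add: Suc herm_Suc[abs_def])
  qed
qed

lemma DERIV_dual: "m \<in> top_dual \<Longrightarrow> ((\<lambda>t. m (x + t *\<^sub>R h)) has_real_derivative m h) (at t)"
  by (auto simp: top_dual_linear intro!: derivative_eq_intros)

lemma DERIV_herm:
  assumes "m \<in> top_dual"
  shows "((\<lambda>t. herm m k (x + t *\<^sub>R h)) has_real_derivative real k * m h * herm m (k - 1) x) (at 0)"
proof -
  have "((\<lambda>t. hermite (cov m m) k (m (x + t *\<^sub>R h))) has_real_derivative
      (real k * hermite (cov m m) (k - 1) (m (x + 0 *\<^sub>R h))) * m h) (at 0)"
    by (rule DERIV_chain2[OF DERIV_hermite DERIV_dual[OF assms]])
  then show ?thesis by (simp add: herm_def ac_simps)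
qed

text \<open>In other words, \<open>H\<^sub>k\<^sub>+\<^sub>1(l)\<close> is minus the divergence of \<open>H\<^sub>k(l) h\<close>, where \<open>h\<close> represents \<open>l\<close>. The term
  \<open>k q H\<^sub>k\<^sub>-\<^sub>1(l)\<close> in the recurrence is the derivative of \<open>H\<^sub>k(l)\<close> in the direction \<open>h\<close>.\<close>

lemma hermite_integration_by_parts:
  assumes l: "l \<in> top_dual" and F: "F \<in> moderate" and F': "F' \<in> moderate"
    and deriv: "\<And>x. ((\<lambda>t. F (x + t *\<^sub>R cm_vector l)) has_real_derivative F' x) (at 0)"
  shows "(\<integral>x. herm l (Suc k) x * F x \<partial>\<gamma>) = (\<integral>x. herm l k x * F' x \<partial>\<gamma>)"
proof -
  define G' where "G' x = real k * cov l l * herm l (k - 1) x * F x + herm l k x * F' x" for x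
  have i1: "(\<lambda>x. herm l k x * F x) \<in> moderate" by (intro moderate_mult herm_moderate l F)
  have i2: "(\<lambda>x. real k * cov l l * herm l (k - 1) x * F x) \<in> moderate"
    by (intro moderate_mult herm_moderate l F moderate_const)
  have i3: "(\<lambda>x. herm l k x * F' x) \<in> moderate" by (intro moderate_mult herm_moderate l F')
  have "(\<integral>x. G' x \<partial>\<gamma>) = (\<integral>x. l x * (herm l k x * F x) \<partial>\<gamma>)"
  proof (rule gaussian_integration_by_parts[OF l i1])
    show "G' \<in> moderate" unfolding G'_def by (intro moderate_add i2 i3)
    fix x
    show "((\<lambda>t. herm l k (x + t *\<^sub>R cm_vector l) * F (x + t *\<^sub>R cm_vector l)) has_real_derivative G' x) (at 0)"
      using DERIV_mult[OF DERIV_herm[OF l, of k x "cm_vector l"] deriv[of x]]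
      by (simp add: G'_def dual_cm_vector l ac_simps)
  qed
  also have "(\<integral>x. G' x \<partial>\<gamma>) = (\<integral>x. real k * cov l l * herm l (k - 1) x * F x \<partial>\<gamma>) + (\<integral>x. herm l k x * F' x \<partial>\<gamma>)"
    unfolding G'_def using integrable_moderate[OF i2] integrable_moderate[OF i3] by (rule Bochner_Integration.integral_add)
  finally have "(\<integral>x. herm l k x * F' x \<partial>\<gamma>) =
    (\<integral>x. l x * (herm l k x * F x) \<partial>\<gamma>) - (\<integral>x. real k * cov l l * herm l (k - 1) x * F x \<partial>\<gamma>)" by simp
  also have "\<dots> = (\<integral>x. l x * (herm l k x * F x) - real k * cov l l * herm l (k - 1) x * F x \<partial>\<gamma>)"
    using integrable_moderate[OF moderate_mult[OF moderate_dual[OF l] i1]] integrable_moderate[OF i2]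
    by (rule Bochner_Integration.integral_diff[symmetric])
  also have "\<dots> = (\<integral>x. herm l (Suc k) x * F x \<partial>\<gamma>)"
    by (simp add: herm_Suc algebra_simps)
  finally show ?thesis by simp
qed

lemma herm_Suc_integral:
  assumes l: "l \<in> top_dual" shows "(\<integral>x. herm l (Suc k) x \<partial>\<gamma>) = 0"
  using hermite_integration_by_parts[OF l moderate_const[of 1] moderate_const[of 0], of k] by simp

text \<open>Each integration by parts lowers both degrees by one and produces the factor \<open>k (\<integral> l m d\<gamma>)\<close>.\<close>

theorem herm_orthogonality:
  assumes l: "l \<in> top_dual" and m: "m \<in> top_dual"
  shows "(\<integral>x. herm l j x * herm m k x \<partial>\<gamma>) = of_bool (j = k) * fact k * cov l m ^ k"
proof (induction j arbitrary: k)
  case 0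
  show ?case
    by (cases k) (simp_all add: herm_0 herm_Suc_integral[OF m] prob_space)
next
  case (Suc j)
  have 1: "(\<lambda>x. real k * cov l m * herm m (k - 1) x) \<in> moderate"
    by (intro moderate_mult moderate_const herm_moderate m)
  have "(\<integral>x. herm l (Suc j) x * herm m k x \<partial>\<gamma>) = (\<integral>x. herm l j x * (real k * cov l m * herm m (k - 1) x) \<partial>\<gamma>)"
    by (rule hermite_integration_by_parts[OF l herm_moderate[OF m] 1])
      (use DERIV_herm[OF m, of k _ "cm_vector l"] in \<open>simp add: dual_cm_vector l m\<close>)
  also have "\<dots> = (real k * cov l m) * (\<integral>x. herm l j x * herm m (k - 1) x \<partial>\<gamma>)"
    by (simp only: integral_mult_right_zero[symmetric] ac_simps)
  also have "\<dots> = of_bool (Suc j = k) * fact k * cov l m ^ k"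
    unfolding Suc.IH by (cases k) auto
  finally show ?case .
qed

text \<open>Polynomials in functionals, generated in a way that suits induction on the degree.\<close>

inductive dual_poly :: "nat \<Rightarrow> ('a \<Rightarrow> real) \<Rightarrow> bool" where
  const: "dual_poly d (\<lambda>_. c)"
| mult_dual: "dual_poly d F \<Longrightarrow> m \<in> top_dual \<Longrightarrow> dual_poly (Suc d) (\<lambda>x. m x * F x)"
| add: "dual_poly d F \<Longrightarrow> dual_poly d G \<Longrightarrow> dual_poly d (\<lambda>x. F x + G x)"
| scale: "dual_poly d F \<Longrightarrow> dual_poly d (\<lambda>x. c * F x)"

lemma dual_poly_moderate: "dual_poly d F \<Longrightarrow> F \<in> moderate"
  by (induction rule: dual_poly.induct)
    (auto intro: moderate_const moderate_mult moderate_add moderate_cmult moderate_dual)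

lemma dual_poly_Suc: "dual_poly d F \<Longrightarrow> dual_poly (Suc d) F"
  by (induction rule: dual_poly.induct) (auto intro: dual_poly.intros)

lemma dual_poly_mono: "d \<le> d' \<Longrightarrow> dual_poly d F \<Longrightarrow> dual_poly d' F"
  by (induction rule: dec_induct) (auto intro: dual_poly_Suc)

text \<open>The clause for degree \<open>0\<close> compensates for \<open>0 - 1 = 0\<close>.\<close>

lemma dual_poly_derivative:
  "dual_poly d F \<Longrightarrow> \<exists>F'. dual_poly (d - 1) F' \<and> (d = 0 \<longrightarrow> F' = (\<lambda>_. 0)) \<and>
     (\<forall>x. ((\<lambda>t. F (x + t *\<^sub>R h)) has_real_derivative F' x) (at 0))"
proof (induction rule: dual_poly.induct)
  case (const d c)
  show ?case by (intro exI[of _ "\<lambda>_. 0"]) (auto intro: dual_poly.const)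
next
  case (mult_dual d F m)
  then obtain F' where F': "dual_poly (d - 1) F'" "d = 0 \<longrightarrow> F' = (\<lambda>_. 0)"
    "\<And>x. ((\<lambda>t. F (x + t *\<^sub>R h)) has_real_derivative F' x) (at 0)" by blast
  have "dual_poly d (\<lambda>x. m x * F' x)"
  proof (cases d)
    case 0
    then show ?thesis using F'(2) dual_poly.const[of d 0] by simp
  next
    case (Suc e)
    then show ?thesis using dual_poly.mult_dual[OF _ mult_dual(2), of e F'] F'(1) by simp
  qed
  then have "dual_poly d (\<lambda>x. m h * F x + m x * F' x)"
    by (intro dual_poly.add dual_poly.scale mult_dual)
  moreover have "((\<lambda>t. m (x + t *\<^sub>R h) * F (x + t *\<^sub>R h)) has_real_derivative m h * F x + m x * F' x) (at 0)" for x
    using DERIV_mult[OF DERIV_dual[OF mult_dual(2), of x h 0] F'(3)[of x]] by (simp add: ac_simps)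
  ultimately show ?case by (intro exI[of _ "\<lambda>x. m h * F x + m x * F' x"]) auto
next
  case (add d F G)
  then obtain F' G' where *: "dual_poly (d - 1) F'" "d = 0 \<longrightarrow> F' = (\<lambda>_. 0)"
    "\<And>x. ((\<lambda>t. F (x + t *\<^sub>R h)) has_real_derivative F' x) (at 0)"
    "dual_poly (d - 1) G'" "d = 0 \<longrightarrow> G' = (\<lambda>_. 0)"
    "\<And>x. ((\<lambda>t. G (x + t *\<^sub>R h)) has_real_derivative G' x) (at 0)" by blast
  show ?case
    by (rule exI[of _ "\<lambda>x. F' x + G' x"]) (use * in \<open>auto intro: dual_poly.add DERIV_add\<close>)
next
  case (scale d F c)
  then obtain F' where F': "dual_poly (d - 1) F'" "d = 0 \<longrightarrow> F' = (\<lambda>_. 0)"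
    "\<And>x. ((\<lambda>t. F (x + t *\<^sub>R h)) has_real_derivative F' x) (at 0)" by blast
  show ?case
    by (rule exI[of _ "\<lambda>x. c * F' x"]) (use F' in \<open>auto intro: dual_poly.scale DERIV_cmult\<close>)
qed

lemma herm_orthogonal_dual_poly:
  assumes l: "l \<in> top_dual"
  shows "dual_poly d F \<Longrightarrow> d < k \<Longrightarrow> (\<integral>x. herm l k x * F x \<partial>\<gamma>) = 0"
proof (induction k arbitrary: F d)
  case (Suc k)
  obtain F' where F': "dual_poly (d - 1) F'" "d = 0 \<longrightarrow> F' = (\<lambda>_. 0)"
    "\<And>x. ((\<lambda>t. F (x + t *\<^sub>R cm_vector l)) has_real_derivative F' x) (at 0)"
    using dual_poly_derivative[OF Suc.prems(1)] by blast
  have "(\<integral>x. herm l (Suc k) x * F x \<partial>\<gamma>) = (\<integral>x. herm l k x * F' x \<partial>\<gamma>)"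
    by (rule hermite_integration_by_parts[OF l]) (use F' Suc.prems dual_poly_moderate in auto)
  also have "\<dots> = 0"
  proof (cases d)
    case (Suc e)
    then show ?thesis using Suc.IH[OF F'(1)] Suc.prems by simp
  qed (use F'(2) in simp)
  finally show ?case .
qed simp

lemma cyl_polys_dual_poly: "p \<in> cyl_polys k \<Longrightarrow> dual_poly k p"
proof -
  assume "p \<in> cyl_polys k"
  then obtain n l A c where l: "\<forall>i<n. l i \<in> top_dual" and A: "finite A" "\<forall>\<alpha>\<in>A. (\<Sum>i<n. \<alpha> i) \<le> k"
    and p: "p = (\<lambda>x. \<Sum>\<alpha>\<in>A. c (\<alpha> :: nat \<Rightarrow> nat) * (\<Prod>i<n. l i x ^ \<alpha> i))"
    unfolding cyl_polys_def by blast
  have pow: "dual_poly (d + a) (\<lambda>x. m x ^ a * F x)" if "dual_poly d F" "m \<in> top_dual" for m a F d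
    using that(1)
  proof (induction a)
    case (Suc a)
    then show ?case using dual_poly.mult_dual[OF _ that(2), of "d + a" "\<lambda>x. m x ^ a * F x"] by (simp add: mult.assoc)
  qed simp
  have mono: "dual_poly (\<Sum>i<n'. \<alpha> i) (\<lambda>x. \<Prod>i<n'. l i x ^ \<alpha> i)" if "n' \<le> n" for n' and \<alpha> :: "nat \<Rightarrow> nat"
    using that
  proof (induction n')
    case (Suc n')
    then show ?case using pow[of "\<Sum>i<n'. \<alpha> i" "\<lambda>x. \<Prod>i<n'. l i x ^ \<alpha> i" "l n'" "\<alpha> n'"] l
      by (simp add: mult.commute)
  qed (simp add: dual_poly.const)
  have "dual_poly k (\<lambda>x. \<Sum>\<alpha>\<in>A. c \<alpha> * (\<Prod>i<n. l i x ^ \<alpha> i))"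
    using A
  proof (induction A rule: finite_induct)
    case (insert \<alpha> A)
    then have "dual_poly k (\<lambda>x. c \<alpha> * (\<Prod>i<n. l i x ^ \<alpha> i))"
      by (intro dual_poly.scale dual_poly_mono[OF _ mono]) auto
    then show ?case using insert by (simp add: dual_poly.add)
  qed (simp add: dual_poly.const)
  then show "dual_poly k p" by (simp add: p)
qed

section \<open>Density of the Hermite functions\<close>

inductive_set herm_span :: "('a \<Rightarrow> real) set" where
  herm: "l \<in> top_dual \<Longrightarrow> herm l k \<in> herm_span"
| add: "p \<in> herm_span \<Longrightarrow> r \<in> herm_span \<Longrightarrow> (\<lambda>x. p x + r x) \<in> herm_span"
| scale: "p \<in> herm_span \<Longrightarrow> (\<lambda>x. c * p x) \<in> herm_span"

lemma herm_span_moderate: "p \<in> herm_span \<Longrightarrow> p \<in> moderate"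
  by (induction rule: herm_span.induct) (auto intro: herm_moderate moderate_add moderate_cmult)

lemma herm_span_zero: "(\<lambda>_. 0) \<in> herm_span"
  using herm_span.scale[OF herm_span.herm[OF top_dual_zero, of 0], of 0] by simp

lemma herm_span_sum: "(\<And>i. i \<in> I \<Longrightarrow> p i \<in> herm_span) \<Longrightarrow> (\<lambda>x. \<Sum>i\<in>I. p i x) \<in> herm_span"
  by (induction I rule: infinite_finite_induct) (auto intro: herm_span.add herm_span_zero)

text \<open>The recurrence in the form \<open>l H\<^sub>k(l) = H\<^sub>k\<^sub>+\<^sub>1(l) + k q H\<^sub>k\<^sub>-\<^sub>1(l)\<close>.\<close>

lemma power_herm_span:
  assumes l: "l \<in> top_dual"
  shows "(\<lambda>x. l x ^ j) \<in> herm_span"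
proof -
  have "(\<lambda>x. l x ^ j * herm l k x) \<in> herm_span" for k
  proof (induction j arbitrary: k)
    case 0
    then show ?case using herm_span.herm[OF l, of k] by simp
  next
    case (Suc j)
    have "(\<lambda>x. l x ^ j * herm l (Suc k) x + (real k * cov l l) * (l x ^ j * herm l (k - 1) x)) \<in> herm_span"
      by (intro herm_span.add herm_span.scale Suc)
    then show ?case by (simp add: herm_Suc algebra_simps)
  qed
  from this[of 0] show ?thesis by (simp add: herm_0)
qed

definition herm_closure :: "('a \<Rightarrow> real) set" where
  "herm_closure = {f \<in> L2_space \<gamma>. \<forall>e>0. \<exists>p\<in>herm_span. L2_norm \<gamma> (\<lambda>x. f x - p x) < e}"

lemma herm_span_L2: "p \<in> herm_span \<Longrightarrow> p \<in> L2_space \<gamma>"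
  by (intro moderate_L2 herm_span_moderate)

lemma herm_closure_limit:
  assumes f: "f \<in> L2_space \<gamma>" and lim: "\<And>e. e > 0 \<Longrightarrow> \<exists>g\<in>herm_closure. L2_norm \<gamma> (\<lambda>x. f x - g x) < e"
  shows "f \<in> herm_closure"
  unfolding herm_closure_def
proof (intro CollectI conjI allI impI f)
  fix e :: real assume e: "e > 0"
  obtain g where g: "g \<in> herm_closure" "L2_norm \<gamma> (\<lambda>x. f x - g x) < e / 2" using lim[of "e / 2"] e by auto
  then obtain p where p: "p \<in> herm_span" "L2_norm \<gamma> (\<lambda>x. g x - p x) < e / 2" "g \<in> L2_space \<gamma>"
    using e unfolding herm_closure_def by (auto elim!: allE[of _ "e / 2"])
  have "L2_norm \<gamma> (\<lambda>x. (f x - g x) + (g x - p x)) \<le> L2_norm \<gamma> (\<lambda>x. f x - g x) + L2_norm \<gamma> (\<lambda>x. g x - p x)"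
    by (intro L2_norm_triangle L2_diff f p(3) herm_span_L2 p(1))
  then show "\<exists>p\<in>herm_span. L2_norm \<gamma> (\<lambda>x. f x - p x) < e" using g p by (intro bexI[OF _ p(1)]) simp
qed

lemma herm_span_subset_closure: "p \<in> herm_span \<Longrightarrow> p \<in> herm_closure"
  by (auto simp: herm_closure_def herm_span_L2 L2_norm_def intro!: bexI[of _ p])

lemma herm_closure_add:
  assumes f: "f \<in> herm_closure" and g: "g \<in> herm_closure"
  shows "(\<lambda>x. f x + g x) \<in> herm_closure"
proof -
  have L2: "f \<in> L2_space \<gamma>" "g \<in> L2_space \<gamma>" using f g by (auto simp: herm_closure_def)
  show ?thesis
  proof (rule herm_closure_limit[OF L2_add[OF L2]])
    fix e :: real assume e: "e > 0"
    obtain p r where p: "p \<in> herm_span" "L2_norm \<gamma> (\<lambda>x. f x - p x) < e / 2"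
      and r: "r \<in> herm_span" "L2_norm \<gamma> (\<lambda>x. g x - r x) < e / 2"
      using f g e unfolding herm_closure_def by (auto elim!: allE[of _ "e / 2"])
    have "L2_norm \<gamma> (\<lambda>x. (f x - p x) + (g x - r x)) \<le> L2_norm \<gamma> (\<lambda>x. f x - p x) + L2_norm \<gamma> (\<lambda>x. g x - r x)"
      by (intro L2_norm_triangle L2_diff L2 herm_span_L2 p(1) r(1))
    also have "\<dots> < e" using p r by simp
    also have "(\<lambda>x. (f x - p x) + (g x - r x)) = (\<lambda>x. (f x + g x) - (p x + r x))" by (simp add: fun_eq_iff)
    finally show "\<exists>h\<in>herm_closure. L2_norm \<gamma> (\<lambda>x. f x + g x - h x) < e"
      by (rule bexI[OF _ herm_span_subset_closure[OF herm_span.add[OF p(1) r(1)]]])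
  qed
qed

lemma herm_closure_scale:
  assumes f: "f \<in> herm_closure"
  shows "(\<lambda>x. c * f x) \<in> herm_closure"
proof -
  have L2: "f \<in> L2_space \<gamma>" using f by (auto simp: herm_closure_def)
  show ?thesis
  proof (rule herm_closure_limit[OF L2_cmult[OF L2]])
    fix e :: real assume e: "e > 0"
    have "e / (\<bar>c\<bar> + 1) > 0" using e by simp
    then obtain p where p: "p \<in> herm_span" "L2_norm \<gamma> (\<lambda>x. f x - p x) < e / (\<bar>c\<bar> + 1)"
      using f unfolding herm_closure_def by blast
    have "L2_norm \<gamma> (\<lambda>x. c * (f x - p x)) \<le> (\<bar>c\<bar> + 1) * L2_norm \<gamma> (\<lambda>x. f x - p x)"
      unfolding L2_norm_cmult by (intro mult_right_mono L2_norm_nonneg) simp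
    also have "\<dots> < e" using p(2) by (simp add: field_simps)
    finally show "\<exists>h\<in>herm_closure. L2_norm \<gamma> (\<lambda>x. c * f x - h x) < e"
      using herm_span.scale[OF p(1), of c] herm_span_subset_closure
      by (intro bexI[of _ "\<lambda>x. c * p x"]) (auto simp: right_diff_distrib)
  qed
qed

lemma herm_closure_sum: "(\<And>i. i \<in> I \<Longrightarrow> f i \<in> herm_closure) \<Longrightarrow> (\<lambda>x. \<Sum>i\<in>I. f i x) \<in> herm_closure"
  by (induction I rule: infinite_finite_induct)
    (auto intro: herm_closure_add herm_span_subset_closure herm_span_zero)

text \<open>The partial sums of the series are bounded by \<open>exp \<bar>l\<bar>\<close>, which is square integrable. It is applied
  to the cosine and the sine.\<close>

lemma entire_in_herm_closure:
  assumes l: "l \<in> top_dual" and a: "\<And>k. \<bar>a k\<bar> \<le> 1 / fact k"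
    and sums: "\<And>y. (\<lambda>k. a k * y ^ k) sums g y"
    and g: "\<And>y. \<bar>g y\<bar> \<le> 1" "g \<in> borel_measurable borel"
  shows "(\<lambda>x. g (l x)) \<in> herm_closure"
proof (rule herm_closure_limit)
  have [measurable]: "l \<in> borel_measurable borel" "g \<in> borel_measurable borel" using l g by auto
  have gl: "(\<lambda>x. g (l x)) \<in> moderate" by (rule moderate_bounded[of _ 1]) (use g in auto)
  then show "(\<lambda>x. g (l x)) \<in> L2_space \<gamma>" by (rule moderate_L2)
  define S where "S n x = (\<Sum>k<n. a k * l x ^ k)" for n x
  have S: "S n \<in> herm_span" for n
    unfolding S_def by (intro herm_span_sum herm_span.scale power_herm_span l)
  have Sle: "\<bar>S n x\<bar> \<le> exp \<bar>l x\<bar>" for n x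
  proof -
    have "\<bar>S n x\<bar> \<le> (\<Sum>k<n. \<bar>l x\<bar> ^ k /\<^sub>R fact k)"
      unfolding S_def
    proof (rule order_trans[OF sum_abs], rule sum_mono)
      fix k
      show "\<bar>a k * l x ^ k\<bar> \<le> \<bar>l x\<bar> ^ k /\<^sub>R fact k"
        using mult_right_mono[OF a[of k], of "\<bar>l x\<bar> ^ k"] by (simp add: abs_mult power_abs field_simps)
    qed
    also have "\<dots> \<le> exp \<bar>l x\<bar>"
      using sum_le_suminf[OF sums_summable[OF exp_converges[of "\<bar>l x\<bar>"]], of "{..<n}"]
        sums_unique[OF exp_converges[of "\<bar>l x\<bar>"]] by simp
    finally show ?thesis .
  qed
  define W where "W x = 2 * exp (\<Sum>l\<leftarrow>[l]. \<bar>l x\<bar>)" for x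
  have W: "W \<in> moderate" unfolding W_def by (intro moderate_cmult moderate_exp_sum) (use l in simp)
  have lim0: "(\<lambda>n. L2_norm \<gamma> (\<lambda>x. g (l x) - S n x)) \<longlonglongrightarrow> 0"
  proof (rule L2_norm_tendsto_0[OF _ moderate_L2[OF W]])
    show "(\<lambda>x. g (l x) - S n x) \<in> borel_measurable \<gamma>" for n
      using moderate_diff[OF gl herm_span_moderate[OF S[of n]]] by (auto simp: measurable_eq)
    show "(\<lambda>n. g (l x) - S n x) \<longlonglongrightarrow> 0" for x
    proof -
      have "(\<lambda>n. S n x) \<longlonglongrightarrow> g (l x)" using sums[of "l x"] by (simp add: sums_def S_def)
      from tendsto_diff[OF tendsto_const this, of "g (l x)"] show ?thesis by simp
    qed
    show "\<bar>g (l x) - S n x\<bar> \<le> W x" for n x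
    proof -
      have "1 \<le> exp \<bar>l x\<bar>" by simp
      moreover have "W x = 2 * exp \<bar>l x\<bar>" by (simp add: W_def)
      ultimately show ?thesis using g(1)[of "l x"] Sle[of n x] by linarith
    qed
  qed
  fix e :: real assume "e > 0"
  from order_tendstoD(2)[OF lim0 this] obtain n where "L2_norm \<gamma> (\<lambda>x. g (l x) - S n x) < e"
    using eventually_happens'[OF sequentially_bot] by blast
  then show "\<exists>h\<in>herm_closure. L2_norm \<gamma> (\<lambda>x. g (l x) - h x) < e"
    using S herm_span_subset_closure by blast
qed

lemma trig_in_herm_closure: "t \<in> trig_span top_dual \<Longrightarrow> t \<in> herm_closure"
proof (induction rule: trig_span.induct)
  case (cos m)
  show ?case
  proof (rule entire_in_herm_closure[OF cos, where a = cos_coeff])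
    show "\<bar>cos_coeff k\<bar> \<le> 1 / fact k" for k by (simp add: cos_coeff_def)
    show "(\<lambda>k. cos_coeff k * y ^ k) sums cos y" for y using cos_converges[of y] by simp
  qed auto
next
  case (sin m)
  show ?case
  proof (rule entire_in_herm_closure[OF sin, where a = sin_coeff])
    show "\<bar>sin_coeff k\<bar> \<le> 1 / fact k" for k by (simp add: sin_coeff_def)
    show "(\<lambda>k. sin_coeff k * y ^ k) sums sin y" for y using sin_converges[of y] by simp
  qed auto
qed (auto intro: herm_closure_add herm_closure_scale)

lemma indicator_in_herm_closure:
  assumes B: "B \<in> sets borel" shows "indicat_real B \<in> herm_closure"
proof (rule herm_closure_limit)
  have IB: "indicat_real B \<in> moderate" by (rule moderate_bounded[of _ 1]) (use B in \<open>auto simp: indicator_def\<close>)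
  then show "indicat_real B \<in> L2_space \<gamma>" by (rule moderate_L2)
  fix e :: real assume e: "e > 0"
  obtain t where t: "t \<in> trig_span top_dual" "\<And>x. \<bar>t x\<bar> \<le> 2" "(\<integral>x. \<bar>t x - indicator B x\<bar> \<partial>\<gamma>) < e\<^sup>2 / 3"
    using top_dual.trig_approximates_indicator[OF radon radon B, of "e\<^sup>2 / 3"] e by auto
  have tm: "t \<in> moderate" by (rule moderate_bounded[OF top_dual.trig_measurable[OF t(1)] t(2)])
  have absm: "(\<lambda>x. \<bar>t x - indicator B x\<bar>) \<in> moderate"
    using moderate_diff[OF tm IB] by (auto simp: moderate_def)
  have "(\<integral>x. (indicator B x - t x)\<^sup>2 \<partial>\<gamma>) \<le> (\<integral>x. 3 * \<bar>t x - indicator B x\<bar> \<partial>\<gamma>)"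
  proof (rule integral_mono)
    show "integrable \<gamma> (\<lambda>x. (indicator B x - t x)\<^sup>2)"
      by (intro integrable_moderate moderate_power moderate_diff IB tm)
    show "integrable \<gamma> (\<lambda>x. 3 * \<bar>t x - indicator B x\<bar>)"
      by (intro integrable_moderate moderate_cmult absm)
    fix x
    have "\<bar>t x - indicator B x\<bar> \<le> 3" using t(2)[of x] by (auto simp: indicator_def)
    then have "\<bar>t x - indicator B x\<bar> * \<bar>t x - indicator B x\<bar> \<le> 3 * \<bar>t x - indicator B x\<bar>"
      by (rule mult_right_mono) simp
    then show "(indicator B x - t x)\<^sup>2 \<le> 3 * \<bar>t x - indicator B x\<bar>"
      by (simp add: power2_eq_square algebra_simps flip: abs_mult)
  qed
  also have "\<dots> < e\<^sup>2" using t(3) by simp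
  finally have "L2_norm \<gamma> (\<lambda>x. indicator B x - t x) < e"
    unfolding L2_norm_def using e by (intro real_less_lsqrt) auto
  then show "\<exists>g\<in>herm_closure. L2_norm \<gamma> (\<lambda>x. indicator B x - g x) < e"
    using trig_in_herm_closure[OF t(1)] by blast
qed

text \<open>Indicators are limits of trigonometric functions of functionals; simple functions are dense.\<close>

theorem herm_span_dense:
  assumes f: "f \<in> L2_space \<gamma>" shows "f \<in> herm_closure"
proof (rule herm_closure_limit[OF f])
  fix e :: real assume e: "e > 0"
  have fm [measurable]: "f \<in> borel_measurable \<gamma>" and f2: "integrable \<gamma> (\<lambda>x. (f x)\<^sup>2)"
    using f by (auto simp: L2_space_def)
  obtain s where s: "\<And>i. simple_function \<gamma> (s i)"
    "\<And>x. x \<in> space \<gamma> \<Longrightarrow> (\<lambda>i. s i x) \<longlonglongrightarrow> f x" "\<And>i x. x \<in> space \<gamma> \<Longrightarrow> norm (s i x) \<le> 2 * norm (f x)"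
    using borel_measurable_implies_sequence_metric[OF fm, of 0]
    by (simp add: norm_conv_dist[symmetric]) metis
  have sm [measurable]: "s i \<in> borel_measurable \<gamma>" for i by (rule borel_measurable_simple_function[OF s(1)])
  have "(\<lambda>x. \<bar>f x\<bar>) \<in> L2_space \<gamma>" using f2 by (simp add: L2_space_def)
  then have W: "(\<lambda>x. 3 * \<bar>f x\<bar>) \<in> L2_space \<gamma>" by (rule L2_cmult)
  have lim0: "(\<lambda>n. L2_norm \<gamma> (\<lambda>x. f x - s n x)) \<longlonglongrightarrow> 0"
  proof (rule L2_norm_tendsto_0[OF _ W])
    fix x assume x: "x \<in> space \<gamma>"
    show "(\<lambda>n. f x - s n x) \<longlonglongrightarrow> 0"
      using tendsto_diff[OF tendsto_const s(2)[OF x], of "f x"] by simp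
    show "\<bar>f x - s n x\<bar> \<le> 3 * \<bar>f x\<bar>" for n using s(3)[OF x, of n] by simp
  qed simp
  from order_tendstoD(2)[OF lim0 e] obtain n where n: "L2_norm \<gamma> (\<lambda>x. f x - s n x) < e"
    using eventually_happens'[OF sequentially_bot] by blast
  have "s n = (\<lambda>x. \<Sum>y\<in>s n ` space \<gamma>. y * indicat_real (s n -` {y} \<inter> space \<gamma>) x)"
  proof
    fix x
    have "(\<Sum>y\<in>s n ` space \<gamma>. y * indicat_real (s n -` {y} \<inter> space \<gamma>) x) =
        (\<Sum>y\<in>s n ` space \<gamma>. if y = s n x then y else 0)"
      by (intro sum.cong) (auto simp: indicator_def space_eq)
    also have "\<dots> = s n x"
      using simple_functionD(1)[OF s(1)[of n]] by (simp add: space_eq)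
    finally show "s n x = (\<Sum>y\<in>s n ` space \<gamma>. y * indicat_real (s n -` {y} \<inter> space \<gamma>) x)" ..
  qed
  moreover have "(\<lambda>x. \<Sum>y\<in>s n ` space \<gamma>. y * indicat_real (s n -` {y} \<inter> space \<gamma>) x) \<in> herm_closure"
  proof (intro herm_closure_sum herm_closure_scale indicator_in_herm_closure)
    fix y
    show "s n -` {y} \<inter> space \<gamma> \<in> sets borel"
      using measurable_sets[OF sm[of n], of "{y}"] by (simp add: sets_eq)
  qed
  ultimately show "\<exists>g\<in>herm_closure. L2_norm \<gamma> (\<lambda>x. f x - g x) < e" using n by metis
qed

end

section \<open>Smooth functions of compact support\<close>

text \<open>A class of smooth functions with support in \<open>[-1, 1]\<close> that is closed under differentiation and
  under multiplication by polynomials. The flat factor \<open>exp (- 1 / (1 - x\<^sup>2))\<close> absorbs the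
  singularities at \<open>\<plusminus>1\<close>.\<close>

definition bump :: "real poly \<Rightarrow> nat \<Rightarrow> real \<Rightarrow> real" where
  "bump p k x = (if \<bar>x\<bar> < 1 then poly p x / (1 - x\<^sup>2) ^ k * exp (- (1 / (1 - x\<^sup>2))) else 0)"

text \<open>The numerator that results from differentiating \<open>p / s\<^sup>k * exp (- 1 / s)\<close> for \<open>s = 1 - x\<^sup>2\<close>, over the
  denominator \<open>s\<^sup>k\<^sup>+\<^sup>2\<close>.\<close>

definition bump_deriv_poly :: "real poly \<Rightarrow> nat \<Rightarrow> real poly" where
  "bump_deriv_poly p k = pderiv p * [:1, 0, -1:]\<^sup>2 + smult (2 * real k) ([:0, 1:] * p * [:1, 0, -1:])
     - smult 2 ([:0, 1:] * p)"

lemma power_div_fact_le_exp: "0 \<le> (u::real) \<Longrightarrow> u ^ n / fact n \<le> exp u"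
  using sum_le_suminf[OF sums_summable[OF exp_converges[of u]], of "{n}"]
    sums_unique[OF exp_converges[of u]] by (simp add: field_simps)

text \<open>Since \<open>exp (- 1 / s) \<le> n! s\<^sup>n\<close>, the exponential beats the pole of order \<open>k\<close> and leaves \<open>s\<^sup>2\<close> for
  \<open>n = k + 2\<close>. The quadratic bound gives the derivative \<open>0\<close> at the two boundary points.\<close>

lemma bump_flat:
  obtains C where "0 \<le> C" "\<And>x y. \<bar>x\<bar> = 1 \<Longrightarrow> \<bar>bump p k y\<bar> \<le> C * (y - x)\<^sup>2"
proof -
  have "bounded (poly p ` {-1..1})"
    by (intro compact_imp_bounded compact_continuous_image continuous_intros) auto
  then obtain B where "\<forall>y\<in>{-1..1}. \<bar>poly p y\<bar> \<le> B" by (auto simp: bounded_iff)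
  then have B: "\<bar>poly p y\<bar> \<le> B" if "\<bar>y\<bar> \<le> 1" for y using that by (auto simp: abs_le_iff)
  have B0: "B \<ge> 0" using B[of 0] by simp
  define C where "C = B * fact (k + 2) * 4"
  have "\<bar>bump p k y\<bar> \<le> C * (y - x)\<^sup>2" if x: "\<bar>x\<bar> = 1" for x y
  proof (cases "\<bar>y\<bar> < 1")
    case False
    then show ?thesis using B0 by (simp add: bump_def C_def)
  next
    case True
    define s where "s = 1 - y\<^sup>2"
    have "y\<^sup>2 < 1" using True by (simp add: abs_square_less_1)
    then have s: "s > 0" by (simp add: s_def)
    define A P E where "A = (fact (k + 2) :: real)" and "P = s ^ (k + 2)" and "E = exp (1 / s)"
    have pos: "A > 0" "P > 0" "E > 0" using s by (auto simp: A_def P_def E_def)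
    have "(1 / s) ^ (k + 2) / A \<le> E"
      unfolding A_def E_def using s by (intro power_div_fact_le_exp) simp
    then have "1 / P / A \<le> E" by (simp add: P_def power_divide)
    then have "1 / E \<le> A * P" using pos by (simp add: field_simps)
    then have "exp (- (1 / s)) \<le> A * P" by (simp add: exp_minus E_def inverse_eq_divide)
    then have "exp (- (1 / s)) / s ^ k \<le> A * P / s ^ k" using s by (simp add: divide_right_mono)
    then have "exp (- (1 / s)) / s ^ k \<le> fact (k + 2) * s\<^sup>2"
      using s by (simp add: P_def A_def power_add del: fact_Suc add_2_eq_Suc')
    then have "\<bar>poly p y\<bar> * (exp (- (1 / s)) / s ^ k) \<le> B * (fact (k + 2) * s\<^sup>2)"
      using True B[of y] B0 s by (intro mult_mono) auto
    moreover have "\<bar>bump p k y\<bar> = \<bar>poly p y\<bar> * (exp (- (1 / s)) / s ^ k)"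
      using True s by (simp add: bump_def s_def[symmetric] abs_mult)
    moreover have "s\<^sup>2 \<le> 4 * (y - x)\<^sup>2"
    proof -
      have "s = (1 - \<bar>y\<bar>) * (1 + \<bar>y\<bar>)" by (simp add: s_def algebra_simps power2_eq_square)
      also have "\<dots> \<le> \<bar>y - x\<bar> * 2" using True x by (intro mult_mono) auto
      finally have "s\<^sup>2 \<le> (\<bar>y - x\<bar> * 2)\<^sup>2" using s by (intro power_mono) auto
      then show ?thesis by (simp add: power_mult_distrib)
    qed
    moreover have "B * (fact (k + 2) * s\<^sup>2) \<le> B * (fact (k + 2) * (4 * (y - x)\<^sup>2))"
      using calculation(3) B0 by (intro mult_left_mono) auto
    moreover have "B * (fact (k + 2) * (4 * (y - x)\<^sup>2)) = C * (y - x)\<^sup>2"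
      by (simp only: C_def ac_simps)
    ultimately show ?thesis by linarith
  qed
  with B0 show ?thesis by (intro that[of C]) (auto simp: C_def)
qed

lemma DERIV_bump: "(bump p k has_real_derivative bump (bump_deriv_poly p k) (k + 2) x) (at x)"
proof (cases "\<bar>x\<bar>" "1 :: real" rule: linorder_cases)
  case less
  have sne: "1 - x\<^sup>2 \<noteq> 0" using abs_square_less_1[of x] less by linarith
  have "((\<lambda>x. poly p x / (1 - x\<^sup>2) ^ k * exp (- (1 / (1 - x\<^sup>2)))) has_real_derivative
      bump (bump_deriv_poly p k) (k + 2) x) (at x)"
  proof -
    define s where "s = 1 - x\<^sup>2"
    have s: "s \<noteq> 0" using sne by (simp add: s_def)
    have sne': "x * x \<noteq> 1" using sne by (simp add: power2_eq_square)
    have d1: "((\<lambda>x. (1 - x\<^sup>2) ^ k) has_real_derivative (real k * s ^ (k - 1) * (- 2 * x))) (at x)"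
      by (auto intro!: derivative_eq_intros simp: s_def)
    have d2: "((\<lambda>x. exp (- (1 / (1 - x\<^sup>2)))) has_real_derivative exp (- (1 / s)) * (- (2 * x) / s\<^sup>2)) (at x)"
      by (auto intro!: derivative_eq_intros simp: s_def sne' power2_eq_square)
    have sk: "real k * s ^ (k - 1) = real k * (s ^ k / s)" using s by (cases k) auto
    have "((\<lambda>x. poly p x / (1 - x\<^sup>2) ^ k * exp (- (1 / (1 - x\<^sup>2)))) has_real_derivative
      (poly (pderiv p) x * s ^ k - poly p x * (real k * s ^ (k - 1) * (- 2 * x))) / (s ^ k * s ^ k) * exp (- (1 / s))
        + (poly p x / s ^ k) * (exp (- (1 / s)) * (- (2 * x) / s\<^sup>2))) (at x)"
      unfolding s_def
      by (rule DERIV_cong[OF DERIV_mult[OF DERIV_divide[OF poly_DERIV d1] d2]]) (use sne in \<open>auto simp: s_def ac_simps\<close>)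
    moreover have "(poly (pderiv p) x * s ^ k - poly p x * (real k * s ^ (k - 1) * (- 2 * x))) / (s ^ k * s ^ k) * exp (- (1 / s))
        + (poly p x / s ^ k) * (exp (- (1 / s)) * (- (2 * x) / s\<^sup>2)) = bump (bump_deriv_poly p k) (k + 2) x"
    proof -
      have bump_eq: "bump (bump_deriv_poly p k) (k + 2) x =
        (poly (pderiv p) x * s\<^sup>2 + 2 * real k * (x * poly p x * s) - 2 * (x * poly p x)) / s ^ (k + 2) * exp (- (1 / s))"
        using less by (simp add: bump_def bump_deriv_poly_def s_def power2_eq_square algebra_simps)
      have algebra: "(a * \<sigma> - P * (real k * (\<sigma> / s) * (- 2 * x))) / (\<sigma> * \<sigma>) * E + (P / \<sigma>) * (E * (- (2 * x) / s\<^sup>2)) =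
          (a * s\<^sup>2 + 2 * real k * (x * P * s) - 2 * (x * P)) / (\<sigma> * s\<^sup>2) * E"
        if "\<sigma> \<noteq> 0" for a P E \<sigma>
        using that s by (simp add: field_simps power2_eq_square)
      show ?thesis unfolding sk bump_eq power_add by (rule algebra) (use s in simp)
    qed
    ultimately show ?thesis by simp
  qed
  moreover have "\<forall>\<^sub>F y in nhds x. bump p k y = poly p y / (1 - y\<^sup>2) ^ k * exp (- (1 / (1 - y\<^sup>2)))"
  proof -
    have "\<forall>\<^sub>F y in nhds x. y \<in> {-1<..<1}" using less by (intro eventually_nhds_in_open) auto
    then show ?thesis by eventually_elim (auto simp: bump_def)
  qed
  ultimately show ?thesis by (subst DERIV_cong_ev[OF refl _ refl])
next
  case equal
  obtain C where C: "0 \<le> C" "\<And>y. \<bar>bump p k y\<bar> \<le> C * (y - x)\<^sup>2" using bump_flat[of p k] equal by metis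
  have "((\<lambda>y. (bump p k y - bump p k x) / (y - x)) \<longlongrightarrow> 0) (at x)"
  proof (rule Lim_null_comparison)
    show "\<forall>\<^sub>F y in at x. norm ((bump p k y - bump p k x) / (y - x)) \<le> C * \<bar>y - x\<bar>"
    proof (rule eventually_at_topological[THEN iffD2], intro exI[of _ UNIV] conjI ballI impI)
      fix y assume "y \<noteq> x"
      then have "\<bar>bump p k y\<bar> / \<bar>y - x\<bar> \<le> C * \<bar>y - x\<bar>"
        using C(2)[of y] by (simp add: field_simps power2_eq_square)
      then show "norm ((bump p k y - bump p k x) / (y - x)) \<le> C * \<bar>y - x\<bar>"
        using equal by (simp add: bump_def[of p k x])
    qed auto
    have "((\<lambda>y. C * \<bar>y - x\<bar>) \<longlongrightarrow> C * \<bar>x - x\<bar>) (at x)" by (intro tendsto_intros)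
    then show "((\<lambda>y. C * \<bar>y - x\<bar>) \<longlongrightarrow> 0) (at x)" by simp
  qed
  moreover have "bump (bump_deriv_poly p k) (k + 2) x = 0" using equal by (simp add: bump_def)
  ultimately show ?thesis by (simp only: has_field_derivative_iff)
next
  case greater
  have "\<forall>\<^sub>F y in nhds x. y \<in> - {-1..1}" using greater by (intro eventually_nhds_in_open) auto
  then have "\<forall>\<^sub>F y in nhds x. bump p k y = 0" by eventually_elim (auto simp: bump_def)
  moreover have "((\<lambda>_. 0) has_real_derivative bump (bump_deriv_poly p k) (k + 2) x) (at x)"
    using greater by (simp add: bump_def)
  ultimately show ?thesis by (subst DERIV_cong_ev[OF refl _ refl])
qed

definition test_functions :: "real \<Rightarrow> (real \<Rightarrow> real) set" where
  "test_functions R = {\<lambda>x. bump p k (x / R) | p k. True}"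

lemma test_function_DERIV:
  assumes R: "R > 0" and a: "a \<in> test_functions R"
  shows "deriv a \<in> test_functions R" and "(a has_real_derivative deriv a x) (at x)"
proof -
  obtain p k where a: "a = (\<lambda>x. bump p k (x / R))" using a by (auto simp: test_functions_def)
  define a' where "a' x = bump (smult (1 / R) (bump_deriv_poly p k)) (k + 2) (x / R)" for x
  have d: "(a has_real_derivative a' x) (at x)" for x
  proof -
    have "((\<lambda>x. bump p k (x / R)) has_real_derivative bump (bump_deriv_poly p k) (k + 2) (x / R) * (1 / R)) (at x)"
      by (rule DERIV_chain2[OF DERIV_bump]) (use R in \<open>auto intro!: derivative_eq_intros\<close>)
    moreover have "bump (bump_deriv_poly p k) (k + 2) (x / R) * (1 / R) = a' x"
      by (simp add: a'_def bump_def)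
    ultimately show ?thesis by (simp only: a)
  qed
  then have "deriv a = a'" by (auto intro: DERIV_imp_deriv)
  moreover have "a' \<in> test_functions R" unfolding test_functions_def a'_def[abs_def] by blast
  ultimately show "deriv a \<in> test_functions R" "(a has_real_derivative deriv a x) (at x)"
    using d by auto
qed

lemma test_function_continuous:
  "R > 0 \<Longrightarrow> a \<in> test_functions R \<Longrightarrow> continuous_on UNIV a"
  using test_function_DERIV(2) by (meson DERIV_isCont continuous_at_imp_continuous_on)

lemma test_function_support:
  "R > 0 \<Longrightarrow> a \<in> test_functions R \<Longrightarrow> \<bar>x\<bar> > R \<Longrightarrow> a x = 0"
  by (auto simp: test_functions_def bump_def)

lemma test_function_bounded:
  assumes R: "R > 0" and a: "a \<in> test_functions R"
  obtains C where "\<And>x. \<bar>a x\<bar> \<le> C"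
proof -
  have "bounded (a ` {-R..R})"
    using test_function_continuous[OF R a]
    by (intro compact_imp_bounded compact_continuous_image) (auto intro: continuous_on_subset)
  then obtain C where "\<forall>x\<in>{-R..R}. \<bar>a x\<bar> \<le> C" by (auto simp: bounded_iff)
  then have C: "\<bar>a x\<bar> \<le> C" if "\<bar>x\<bar> \<le> R" for x using that by (auto simp: abs_le_iff)
  have "\<bar>a x\<bar> \<le> C" for x
  proof (cases "\<bar>x\<bar> \<le> R")
    case False
    then show ?thesis using test_function_support[OF R a, of x] C[of 0] R by force
  qed (rule C)
  then show ?thesis by (rule that)
qed

lemma poly_times_test_function:
  assumes R: "R > 0" and a: "a \<in> test_functions R"
  shows "(\<lambda>x. poly P x * a x) \<in> test_functions R"
proof -
  obtain p k where a: "a = (\<lambda>x. bump p k (x / R))" using a by (auto simp: test_functions_def)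
  have "(\<lambda>x. poly P x * a x) = (\<lambda>x. bump (pcompose P [:0, R:] * p) k (x / R))"
    using R by (auto simp: a bump_def poly_pcompose fun_eq_iff)
  then show ?thesis by (auto simp: test_functions_def)
qed

definition tensor :: "nat \<Rightarrow> (nat \<Rightarrow> real \<Rightarrow> real) \<Rightarrow> (nat \<Rightarrow> real) \<Rightarrow> real" where
  "tensor n a x = (\<Prod>j<n. a j (x j))"

lemma tensor_update:
  assumes "i < n"
  shows "tensor n a (x(i := t)) = a i t * (\<Prod>j\<in>{..<n} - {i}. a j (x j))"
  using assms by (simp add: tensor_def prod.remove[of "{..<n}" i])

lemma DERIV_tensor:
  assumes R: "R > 0" and a: "\<And>j. j < n \<Longrightarrow> a j \<in> test_functions R" and i: "i < n"
  shows "((\<lambda>t. tensor n a (x(i := t))) has_real_derivative tensor n (a(i := deriv (a i))) x) (at (x i))"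
proof -
  have "tensor n (a(i := deriv (a i))) (x(i := x i)) = deriv (a i) (x i) * (\<Prod>j\<in>{..<n} - {i}. a j (x j))"
    by (subst tensor_update[OF i]) simp
  then have "tensor n (a(i := deriv (a i))) x = deriv (a i) (x i) * (\<Prod>j\<in>{..<n} - {i}. a j (x j))" by simp
  then show ?thesis unfolding tensor_update[OF i]
    by (simp add: DERIV_cmult_right test_function_DERIV(2)[OF R a[OF i]])
qed

text \<open>A partial derivative of a tensor product differentiates one factor and stays in the class.\<close>

lemma partials_tensor:
  assumes R: "R > 0" and "set is \<subseteq> {..<n}" and "\<And>j. j < n \<Longrightarrow> a j \<in> test_functions R"
  obtains b where "\<And>j. j < n \<Longrightarrow> b j \<in> test_functions R" "partials is (tensor n a) = tensor n b"
proof -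
  have "\<exists>b. (\<forall>j<n. b j \<in> test_functions R) \<and> partials is (tensor n a) = tensor n b"
    using assms(2)
  proof (induction "is")
    case (Cons i "is")
    then obtain b where b: "\<And>j. j < n \<Longrightarrow> b j \<in> test_functions R" "partials is (tensor n a) = tensor n b"
      by auto
    have i: "i < n" using Cons.prems by simp
    have "partials (i # is) (tensor n a) = tensor n (b(i := deriv (b i)))"
      using DERIV_imp_deriv[OF DERIV_tensor[where a = b, OF R b(1) i]]
      by (simp add: b(2) partial_def[abs_def])
    moreover have "\<forall>j<n. (b(i := deriv (b i))) j \<in> test_functions R"
      using b(1) test_function_DERIV(1)[OF R b(1)[OF i]] by simp
    ultimately show ?case by blast
  qed (use assms(3) in auto)
  then show ?thesis using that by blast
qed

lemma tensor_Cb_inf: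
  assumes R: "R > 0" and a: "\<And>j. j < n \<Longrightarrow> a j \<in> test_functions R"
  shows "tensor n a \<in> Cb_inf n" and "compact_supp n (tensor n a)"
proof -
  have cont: "continuous_on UNIV (tensor n b)" if "\<And>j. j < n \<Longrightarrow> b j \<in> test_functions R" for b
    unfolding tensor_def[abs_def]
    by (intro continuous_on_prod continuous_on_compose2[OF test_function_continuous[OF R that] continuous_on_product_coordinates])
       auto
  have bdd: "bounded (range (tensor n b))" if b: "\<And>j. j < n \<Longrightarrow> b j \<in> test_functions R" for b
  proof -
    have "\<forall>j. \<exists>C. j < n \<longrightarrow> (\<forall>x. \<bar>b j x\<bar> \<le> C)" using test_function_bounded[OF R b] by metis
    then obtain C where C: "\<And>j x. j < n \<Longrightarrow> \<bar>b j x\<bar> \<le> C j" by metis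
    have "norm (tensor n b x) \<le> (\<Prod>j<n. C j)" for x
      unfolding tensor_def real_norm_def abs_prod by (intro prod_mono) (auto intro: C)
    then show ?thesis by (auto simp: bounded_iff)
  qed
  have "tensor n a \<in> smooth n"
    unfolding smooth_def
  proof (intro CollectI conjI allI impI)
    show "depends_on_first n (tensor n a)" by (simp add: depends_on_first_def tensor_def)
    fix "is" assume "is": "set is \<subseteq> {..<n}"
    obtain b where b: "\<And>j. j < n \<Longrightarrow> b j \<in> test_functions R" "partials is (tensor n a) = tensor n b"
      using partials_tensor[where a = a, OF R "is" a] by blast
    show "continuous_on UNIV (partials is (tensor n a))" unfolding b(2) by (rule cont[OF b(1)])
    fix i x assume "i < n"
    then show "(\<lambda>t. partials is (tensor n a) (x(i := t))) field_differentiable at (x i)"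
      unfolding b(2) field_differentiable_def using DERIV_tensor[where a = b, OF R b(1)] by blast
  qed
  moreover have "bounded (range (partials is (tensor n a)))" if "is": "set is \<subseteq> {..<n}" for "is"
  proof -
    obtain b where b: "\<And>j. j < n \<Longrightarrow> b j \<in> test_functions R" "partials is (tensor n a) = tensor n b"
      using partials_tensor[where a = a, OF R "is" a] by blast
    show ?thesis unfolding b(2) by (rule bdd[OF b(1)])
  qed
  ultimately show "tensor n a \<in> Cb_inf n" by (simp add: Cb_inf_def)
  show "compact_supp n (tensor n a)"
    unfolding compact_supp_def
  proof (intro exI[of _ R] allI impI)
    fix x :: "nat \<Rightarrow> real" assume "\<exists>i<n. \<bar>x i\<bar> > R"
    then obtain i where "i < n" "\<bar>x i\<bar> > R" by blast
    then show "tensor n a x = 0"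
      using test_function_support[OF R a[of i], of "x i"] by (auto simp: tensor_def)
  qed
qed

section \<open>The divergence of a cylindrical vector field\<close>

lemma depends_on_first_partial:
  assumes "depends_on_first n \<psi>" "j < n" shows "depends_on_first n (partial j \<psi>)"
  unfolding depends_on_first_def
proof (intro allI impI)
  fix x y :: "nat \<Rightarrow> real" assume xy: "\<forall>i<n. x i = y i"
  then have "(\<lambda>t. \<psi> (x(j := t))) = (\<lambda>t. \<psi> (y(j := t)))"
    using assms(1) by (auto simp: depends_on_first_def fun_eq_iff)
  then show "partial j \<psi> x = partial j \<psi> y" using xy assms(2) by (simp add: partial_def)
qed

lemma continuous_cylinder_moderate:
  assumes dep: "depends_on_first n \<psi>" and cont: "continuous_on UNIV \<psi>" and bdd: "bounded (range \<psi>)"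
    and l: "\<And>i. i < n \<Longrightarrow> l i \<in> top_dual"
  shows "(\<lambda>x. \<psi> (\<lambda>i. l i x)) \<in> moderate"
proof -
  \<comment> \<open>only the first \<open>n\<close> functionals are assumed continuous\<close>
  have eq: "\<psi> (\<lambda>i. l i x) = \<psi> (\<lambda>i. if i < n then l i x else 0)" for x
    using dep by (simp add: depends_on_first_def)
  have "continuous_on UNIV (\<lambda>x i. if i < n then l i x else 0)"
  proof (rule continuous_on_coordinatewise_then_product)
    show "continuous_on UNIV (\<lambda>x. if i < n then l i x else 0)" for i
      using l[of i] by (cases "i < n") (auto simp: top_dual_def)
  qed
  from continuous_on_compose2[OF cont this]
  have "(\<lambda>x. \<psi> (\<lambda>i. l i x)) \<in> borel_measurable borel"
    unfolding eq by (intro borel_measurable_continuous_onI) auto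
  moreover obtain C where "\<And>z. \<bar>\<psi> z\<bar> \<le> C" using bdd by (auto simp: bounded_iff)
  ultimately show ?thesis by (intro moderate_bounded) auto
qed

lemma Cb_inf_moderate:
  assumes \<psi>: "\<psi> \<in> Cb_inf n" and l: "\<And>i. i < n \<Longrightarrow> l i \<in> top_dual"
  shows "(\<lambda>x. \<psi> (\<lambda>i. l i x)) \<in> moderate" and "j < n \<Longrightarrow> (\<lambda>x. partial j \<psi> (\<lambda>i. l i x)) \<in> moderate"
proof -
  have dep: "depends_on_first n \<psi>" using \<psi> by (simp add: Cb_inf_def smooth_def)
  have *: "continuous_on UNIV (partials is \<psi>)" "bounded (range (partials is \<psi>))" if "set is \<subseteq> {..<n}" for "is"
    using \<psi> that by (auto simp: Cb_inf_def smooth_def)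
  show "(\<lambda>x. \<psi> (\<lambda>i. l i x)) \<in> moderate"
    by (rule continuous_cylinder_moderate[OF dep _ _ l]) (use *[of "[]"] in auto)
  show "(\<lambda>x. partial j \<psi> (\<lambda>i. l i x)) \<in> moderate" if "j < n"
    by (rule continuous_cylinder_moderate[OF depends_on_first_partial[OF dep that] _ _ l])
      (use *[of "[j]"] that in auto)
qed

text \<open>\<open>DF x h\<close> is the derivative of \<open>F\<close> at \<open>x\<close> in the direction \<open>h\<close>.\<close>

definition has_moderate_derivative ::
    "('a::hausdorff_locally_convex \<Rightarrow> real) \<Rightarrow> ('a \<Rightarrow> 'a \<Rightarrow> real) \<Rightarrow> bool" where
  "has_moderate_derivative F DF \<longleftrightarrow> F \<in> moderate \<and> (\<forall>h. (\<lambda>x. DF x h) \<in> moderate) \<and>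
     (\<forall>x. linear (DF x)) \<and> (\<forall>x h. ((\<lambda>t. F (x + t *\<^sub>R h)) has_real_derivative DF x h) (at 0))"

context radon_gaussian
begin

text \<open>Integration by parts along the representer of \<open>l\<close> requires the derivative of \<open>\<psi>(m\<^sub>1, \<dots>, m\<^sub>n)\<close> in that
  direction, but for \<open>\<psi>\<close> only partial derivatives are at hand. So decompose \<open>l = \<Sum>j. \<beta>\<^sub>j m\<^sub>j + r\<close> with \<open>r\<close> orthogonal to all \<open>m\<^sub>j\<close>. Along the representer \<open>e\<^sub>j\<close> of \<open>m\<^sub>j\<close>
  only the \<open>j\<close>-th variable moves, and along the representer of \<open>r\<close> none does.\<close>

lemma divergence_single:
  assumes l: "l \<in> top_dual" and F: "has_moderate_derivative F DF"
    and \<psi>: "\<psi> \<in> Cb_inf n" and on: "dual_orthonormal \<gamma> n m e"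
  shows "(\<integral>x. (DF x (cm_vector l) - l x * F x) * \<psi> (\<lambda>i. m i x) \<partial>\<gamma>) =
    - (\<integral>x. F x * (\<Sum>j<n. partial j \<psi> (\<lambda>i. m i x) * l (e j)) \<partial>\<gamma>)"
proof -
  have m: "m j \<in> top_dual" and e: "e j = cm_vector (m j)" if "j < n" for j
    using on that dual_orthonormal_cm_vector[OF on that] by (auto simp: dual_orthonormal_def)
  have covm: "cov (m i) (m j) = of_bool (i = j)" if "i < n" "j < n" for i j
    using on that by (auto simp: dual_orthonormal_def cov_def)
  define \<beta> where "\<beta> j = cov l (m j)" for j
  define s where "s x = (\<Sum>j<n. \<beta> j * m j x)" for x
  define r where "r x = l x + (-1) * s x" for x
  have s: "s \<in> top_dual" "cm_vector s = (\<Sum>j<n. \<beta> j *\<^sub>R e j)"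
    using cm_vector_sum[of "{..<n}" m \<beta>] m e by (auto simp: s_def[abs_def])
  have r: "r \<in> top_dual" unfolding r_def by (intro top_dual_add top_dual_scale l s)
  have Rr: "cm_vector r = cm_vector l - cm_vector s"
    unfolding r_def cm_vector_add[OF l top_dual_scale[OF s(1)]] cm_vector_scale[OF s(1)] by simp
  \<comment> \<open>the remainder direction is invisible to the functionals \<open>m j\<close>\<close>
  have mr: "m i (cm_vector r) = 0" if i: "i < n" for i
  proof -
    have "m i (cm_vector s) = (\<Sum>j<n. \<beta> j * m i (e j))"
      unfolding s(2) using m[OF i] by (simp add: top_dual_def linear_sum linear_scale)
    also have "\<dots> = (\<Sum>j<n. if j = i then \<beta> j else 0)"
      using covm i m e by (intro sum.cong) (auto simp: dual_cm_vector)
    also have "\<dots> = \<beta> i" using i by simp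
    finally show ?thesis using l m[OF i] by (simp add: Rr top_dual_linear dual_cm_vector \<beta>_def)
  qed
  have dep: "\<psi> x = \<psi> y" if "\<And>i. i < n \<Longrightarrow> x i = y i" for x y
    using \<psi> that by (auto simp: Cb_inf_def smooth_def depends_on_first_def)
  have Fm: "F \<in> moderate" and DFm: "\<And>h. (\<lambda>x. DF x h) \<in> moderate" and DFl: "\<And>x. linear (DF x)"
    and DFd: "\<And>x h. ((\<lambda>t. F (x + t *\<^sub>R h)) has_real_derivative DF x h) (at 0)"
    using F by (auto simp: has_moderate_derivative_def)
  define \<phi> where "\<phi> x = \<psi> (\<lambda>i. m i x)" for x
  define \<phi>' where "\<phi>' j x = partial j \<psi> (\<lambda>i. m i x)" for j x
  have \<phi>m: "\<phi> \<in> moderate" and \<phi>'m: "\<And>j. j < n \<Longrightarrow> \<phi>' j \<in> moderate"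
    unfolding \<phi>_def \<phi>'_def using Cb_inf_moderate[OF \<psi> m] by auto
  have \<phi>d: "((\<lambda>t. \<phi> (x + t *\<^sub>R e j)) has_real_derivative \<phi>' j x) (at 0)" if j: "j < n" for j x
  proof -
    have "\<phi> (x + t *\<^sub>R e j) = \<psi> ((\<lambda>i. m i x)(j := t + m j x))" for t
      unfolding \<phi>_def
    proof (rule dep)
      fix i assume i: "i < n"
      have "m i (x + t *\<^sub>R e j) = m i x + t * of_bool (j = i)"
        using m[OF i] m[OF j] covm[OF j i] e[OF j] by (simp add: top_dual_linear dual_cm_vector)
      then show "m i (x + t *\<^sub>R e j) = ((\<lambda>i. m i x)(j := t + m j x)) i" by auto
    qed
    moreover have "((\<lambda>t. \<psi> ((\<lambda>i. m i x)(j := t))) has_real_derivative \<phi>' j x) (at (0 + m j x))"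
    proof -
      have "\<forall>is. set is \<subseteq> {..<n} \<longrightarrow>
          (\<forall>i<n. \<forall>x. (\<lambda>t. partials is \<psi> (x(i := t))) field_differentiable at (x i))"
        using \<psi> unfolding Cb_inf_def smooth_def by blast
      from this[rule_format, of "[]" j "\<lambda>i. m i x"] j
      have "(\<lambda>t. \<psi> ((\<lambda>i. m i x)(j := t))) field_differentiable at (m j x)" by simp
      then show ?thesis by (simp add: \<phi>'_def partial_def DERIV_deriv_iff_field_differentiable)
    qed
    ultimately show ?thesis by (simp only: DERIV_shift)
  qed
  have ibp_e: "(\<integral>x. m j x * (F x * \<phi> x) \<partial>\<gamma>) = (\<integral>x. DF x (e j) * \<phi> x \<partial>\<gamma>) + (\<integral>x. F x * \<phi>' j x \<partial>\<gamma>)"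
    if j: "j < n" for j
  proof -
    have 1: "(\<lambda>x. DF x (e j) * \<phi> x) \<in> moderate" "(\<lambda>x. F x * \<phi>' j x) \<in> moderate"
      by (intro moderate_mult DFm \<phi>m Fm \<phi>'m[OF j])+
    have "(\<integral>x. DF x (e j) * \<phi> x + F x * \<phi>' j x \<partial>\<gamma>) = (\<integral>x. m j x * (F x * \<phi> x) \<partial>\<gamma>)"
      using DERIV_mult[OF DFd[of _ "e j"] \<phi>d[OF j]]
      by (intro gaussian_integration_by_parts[OF m[OF j]] moderate_add 1 moderate_mult Fm \<phi>m)
        (simp add: e[OF j, symmetric] ac_simps)
    then show ?thesis using integrable_moderate[OF 1(1)] integrable_moderate[OF 1(2)] by simp
  qed
  have ibp_r: "(\<integral>x. r x * (F x * \<phi> x) \<partial>\<gamma>) = (\<integral>x. DF x (cm_vector r) * \<phi> x \<partial>\<gamma>)"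
  proof -
    have "\<phi> (x + t *\<^sub>R cm_vector r) = \<phi> x" for x t
      unfolding \<phi>_def using m mr by (intro dep) (simp add: top_dual_linear)
    then have "(\<integral>x. DF x (cm_vector r) * \<phi> x \<partial>\<gamma>) = (\<integral>x. r x * (F x * \<phi> x) \<partial>\<gamma>)"
      using DFd[of _ "cm_vector r"]
      by (intro gaussian_integration_by_parts[OF r] moderate_mult DFm Fm \<phi>m) (simp add: DERIV_cmult_right)
    then show ?thesis by simp
  qed
  have i0: "integrable \<gamma> (\<lambda>x. G x * \<phi> x)" if "G \<in> moderate" for G
    by (intro integrable_moderate moderate_mult \<phi>m that)
  have i1: "integrable \<gamma> (\<lambda>x. m j x * (F x * \<phi> x))" "integrable \<gamma> (\<lambda>x. F x * \<phi>' j x)" if "j < n" for j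
    by (intro integrable_moderate moderate_mult \<phi>m Fm moderate_dual m \<phi>'m that)+
  have i2: "integrable \<gamma> (\<lambda>x. r x * (F x * \<phi> x))"
    by (intro integrable_moderate moderate_mult \<phi>m Fm moderate_dual r)
  have lx: "l x = r x + (\<Sum>j<n. \<beta> j * m j x)" for x by (simp add: r_def s_def)
  have "(\<integral>x. l x * F x * \<phi> x \<partial>\<gamma>) = (\<integral>x. r x * (F x * \<phi> x) + (\<Sum>j<n. \<beta> j * (m j x * (F x * \<phi> x))) \<partial>\<gamma>)"
    by (intro Bochner_Integration.integral_cong) (auto simp: lx algebra_simps sum_distrib_left sum_distrib_right)
  also have "\<dots> = (\<integral>x. r x * (F x * \<phi> x) \<partial>\<gamma>) + (\<Sum>j<n. \<beta> j * (\<integral>x. m j x * (F x * \<phi> x) \<partial>\<gamma>))"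
    using i1 i2 by (subst Bochner_Integration.integral_add) (auto intro!: Bochner_Integration.integrable_sum)
  also have "\<dots> = (\<integral>x. DF x (cm_vector r) * \<phi> x \<partial>\<gamma>) +
      (\<Sum>j<n. \<beta> j * ((\<integral>x. DF x (e j) * \<phi> x \<partial>\<gamma>) + (\<integral>x. F x * \<phi>' j x \<partial>\<gamma>)))"
    by (simp add: ibp_r ibp_e)
  also have "\<dots> = (\<integral>x. DF x (cm_vector r) * \<phi> x + (\<Sum>j<n. \<beta> j * (DF x (e j) * \<phi> x)) + (\<Sum>j<n. \<beta> j * (F x * \<phi>' j x)) \<partial>\<gamma>)"
  proof -
    have i3: "integrable \<gamma> (\<lambda>x. \<Sum>j<n. \<beta> j * (DF x (e j) * \<phi> x))"
      "integrable \<gamma> (\<lambda>x. \<Sum>j<n. \<beta> j * (F x * \<phi>' j x))"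
      using i0[OF DFm] i1 by (intro Bochner_Integration.integrable_sum integrable_mult_right; simp)+
    have i4: "(\<integral>x. (\<Sum>j<n. \<beta> j * (DF x (e j) * \<phi> x)) \<partial>\<gamma>) = (\<Sum>j<n. \<beta> j * (\<integral>x. DF x (e j) * \<phi> x \<partial>\<gamma>))"
      "(\<integral>x. (\<Sum>j<n. \<beta> j * (F x * \<phi>' j x)) \<partial>\<gamma>) = (\<Sum>j<n. \<beta> j * (\<integral>x. F x * \<phi>' j x \<partial>\<gamma>))"
      using i0[OF DFm] i1 by (subst Bochner_Integration.integral_sum; simp)+
    show ?thesis using i0[OF DFm] i3 by (simp add: i4 distrib_left sum.distrib)
  qed
  also have "\<dots> = (\<integral>x. DF x (cm_vector l) * \<phi> x + F x * (\<Sum>j<n. \<phi>' j x * l (e j)) \<partial>\<gamma>)"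
  proof (rule Bochner_Integration.integral_cong[OF refl])
    fix x
    have "cm_vector l = cm_vector r + (\<Sum>j<n. \<beta> j *\<^sub>R e j)" by (simp add: Rr s(2))
    then have "DF x (cm_vector l) = DF x (cm_vector r) + (\<Sum>j<n. \<beta> j * DF x (e j))"
      using DFl[of x] by (simp add: linear_add linear_sum linear_scale)
    moreover have "(\<Sum>j<n. \<phi>' j x * l (e j)) = (\<Sum>j<n. \<beta> j * \<phi>' j x)"
      using l m e by (intro sum.cong) (auto simp: dual_cm_vector \<beta>_def cov_sym)
    ultimately show "DF x (cm_vector r) * \<phi> x + (\<Sum>j<n. \<beta> j * (DF x (e j) * \<phi> x)) + (\<Sum>j<n. \<beta> j * (F x * \<phi>' j x)) =
        DF x (cm_vector l) * \<phi> x + F x * (\<Sum>j<n. \<phi>' j x * l (e j))"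
      by (simp add: distrib_right distrib_left sum_distrib_left sum_distrib_right ac_simps)
  qed
  also have "\<dots> = (\<integral>x. DF x (cm_vector l) * \<phi> x \<partial>\<gamma>) + (\<integral>x. F x * (\<Sum>j<n. \<phi>' j x * l (e j)) \<partial>\<gamma>)"
    by (intro Bochner_Integration.integral_add i0 DFm integrable_moderate moderate_mult moderate_sum Fm \<phi>'m moderate_const) auto
  finally have "(\<integral>x. l x * F x * \<phi> x \<partial>\<gamma>) =
    (\<integral>x. DF x (cm_vector l) * \<phi> x \<partial>\<gamma>) + (\<integral>x. F x * (\<Sum>j<n. \<phi>' j x * l (e j)) \<partial>\<gamma>)" .
  moreover have "(\<integral>x. (DF x (cm_vector l) - l x * F x) * \<phi> x \<partial>\<gamma>) =
    (\<integral>x. DF x (cm_vector l) * \<phi> x \<partial>\<gamma>) - (\<integral>x. l x * F x * \<phi> x \<partial>\<gamma>)"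
    unfolding left_diff_distrib
    by (intro Bochner_Integration.integral_diff i0 DFm moderate_mult moderate_dual[OF l] Fm)
  ultimately show ?thesis by (simp add: \<phi>_def \<phi>'_def)
qed

theorem has_gauss_div_sum:
  assumes l: "\<And>i. i < n \<Longrightarrow> l i \<in> top_dual"
    and F: "\<And>i. i < n \<Longrightarrow> has_moderate_derivative (F i) (DF i)"
  shows "has_gauss_div \<gamma> (\<lambda>x. \<Sum>i<n. F i x *\<^sub>R cm_vector (l i))
    (\<lambda>x. \<Sum>i<n. DF i x (cm_vector (l i)) - l i x * F i x)"
  unfolding has_gauss_div_def
proof (intro conjI ballI allI impI)
  have Fm: "F i \<in> moderate" and DFm: "\<And>h. (\<lambda>x. DF i x h) \<in> moderate" if "i < n" for i
    using F[OF that] by (auto simp: has_moderate_derivative_def)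
  have vi: "(\<lambda>x. DF i x (cm_vector (l i)) - l i x * F i x) \<in> moderate" if "i < n" for i
    by (intro moderate_diff moderate_mult moderate_dual l Fm DFm that)
  have v: "(\<lambda>x. \<Sum>i<n. DF i x (cm_vector (l i)) - l i x * F i x) \<in> moderate"
    by (intro moderate_sum vi) simp
  then show "(\<lambda>x. \<Sum>i<n. DF i x (cm_vector (l i)) - l i x * F i x) \<in> L2_space \<gamma>" by (rule moderate_L2)
  fix \<phi> G assume \<phi>: "\<phi> \<in> FC_inf" and G: "has_gradient \<gamma> \<phi> G"
  obtain N \<psi> m e where \<psi>: "\<psi> \<in> Cb_inf N" and on: "dual_orthonormal \<gamma> N m e"
    and ae: "AE x in \<gamma>. \<phi> x = \<psi> (\<lambda>i. m i x)" and G: "G = (\<lambda>x. \<Sum>j<N. partial j \<psi> (\<lambda>i. m i x) *\<^sub>R e j)"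
    using G unfolding has_gradient_def by blast
  have \<phi>m: "\<phi> \<in> moderate" using \<phi> Cb_inf_moderate(1) unfolding FC_inf_def by blast
  have m: "m j \<in> top_dual" and e: "e j \<in> cm_space \<gamma>" if "j < N" for j
    using on that by (auto simp: dual_orthonormal_def)
  have \<psi>m: "(\<lambda>x. \<psi> (\<lambda>i. m i x)) \<in> moderate" and \<psi>'m: "\<And>j. j < N \<Longrightarrow> (\<lambda>x. partial j \<psi> (\<lambda>i. m i x)) \<in> moderate"
    using Cb_inf_moderate[OF \<psi> m] by auto
  have "(\<integral>x. (\<Sum>i<n. DF i x (cm_vector (l i)) - l i x * F i x) * \<phi> x \<partial>\<gamma>) =
      (\<integral>x. (\<Sum>i<n. DF i x (cm_vector (l i)) - l i x * F i x) * \<psi> (\<lambda>i. m i x) \<partial>\<gamma>)"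
    using v \<phi>m \<psi>m ae by (intro integral_cong_AE) (auto simp: measurable_eq intro!: borel_measurable_times)
  also have "\<dots> = (\<Sum>i<n. \<integral>x. (DF i x (cm_vector (l i)) - l i x * F i x) * \<psi> (\<lambda>i. m i x) \<partial>\<gamma>)"
    unfolding sum_distrib_right
    by (intro Bochner_Integration.integral_sum integrable_moderate moderate_mult vi \<psi>m) simp
  also have "\<dots> = (\<Sum>i<n. - (\<integral>x. F i x * (\<Sum>j<N. partial j \<psi> (\<lambda>i. m i x) * l i (e j)) \<partial>\<gamma>))"
    by (intro sum.cong refl divergence_single[OF l F \<psi> on]) auto
  also have "\<dots> = - (\<integral>x. (\<Sum>i<n. F i x * (\<Sum>j<N. partial j \<psi> (\<lambda>i. m i x) * l i (e j))) \<partial>\<gamma>)"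
    unfolding sum_negf
    by (intro arg_cong[where f = uminus] Bochner_Integration.integral_sum[symmetric] integrable_moderate
        moderate_mult moderate_sum Fm \<psi>'m moderate_const) auto
  also have "\<dots> = - (\<integral>x. cm_inner \<gamma> (\<Sum>i<n. F i x *\<^sub>R cm_vector (l i)) (G x) \<partial>\<gamma>)"
  proof (intro arg_cong[where f = uminus] Bochner_Integration.integral_cong refl)
    fix x
    have Gx: "G x \<in> cm_space \<gamma>" unfolding G by (intro cm_space_sum e) simp
    have *: "(\<lambda>y. \<Sum>i<n. F i x * l i y) \<in> top_dual"
      "cm_vector (\<lambda>y. \<Sum>i<n. F i x * l i y) = (\<Sum>i<n. F i x *\<^sub>R cm_vector (l i))"
      using cm_vector_sum[of "{..<n}" l "\<lambda>i. F i x"] l by auto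
    have "cm_inner \<gamma> (\<Sum>i<n. F i x *\<^sub>R cm_vector (l i)) (G x) = (\<Sum>i<n. F i x * l i (G x))"
      using cm_inner_cm_vector[OF *(1) Gx] by (simp add: *(2))
    also have "\<dots> = (\<Sum>i<n. F i x * (\<Sum>j<N. partial j \<psi> (\<lambda>i. m i x) * l i (e j)))"
      using l by (intro sum.cong) (auto simp: G top_dual_def linear_sum linear_scale)
    finally show "(\<Sum>i<n. F i x * (\<Sum>j<N. partial j \<psi> (\<lambda>i. m i x) * l i (e j))) =
        cm_inner \<gamma> (\<Sum>i<n. F i x *\<^sub>R cm_vector (l i)) (G x)" ..
  qed
  finally show "(\<integral>x. (\<Sum>i<n. DF i x (cm_vector (l i)) - l i x * F i x) * \<phi> x \<partial>\<gamma>) =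
    - (\<integral>x. cm_inner \<gamma> (\<Sum>i<n. F i x *\<^sub>R cm_vector (l i)) (G x) \<partial>\<gamma>)" .
qed

end

section \<open>Chaos components of a sum of Hermite functions\<close>

lemma hermite_poly:
  obtains P where "degree P \<le> k" "\<And>x. hermite q k x = poly P x"
proof -
  have "\<exists>P. degree P \<le> k \<and> (\<forall>x. hermite q k x = poly P x)"
  proof (induction k rule: less_induct)
    case (less k)
    show ?case
    proof (cases k)
      case 0
      then show ?thesis by (intro exI[of _ "[:1:]"]) auto
    next
      case (Suc j)
      obtain P where P: "degree P \<le> j" "\<And>x. hermite q j x = poly P x" using less[of j] Suc by auto
      obtain P' where P': "degree P' \<le> j - 1 \<or> j = 0" "\<And>x. hermite q (j - 1) x = poly P' x" "degree P' \<le> j"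
        using less[of "j - 1"] Suc by (metis diff_le_self le_imp_less_Suc order_trans)
      have "degree (pCons 0 P - smult (real j * q) P') \<le> Suc j"
      proof (rule degree_diff_le)
        show "degree (pCons 0 P) \<le> Suc j" using P(1) degree_pCons_le[of 0 P] by simp
        show "degree (smult (real j * q) P') \<le> Suc j" using P'(3) degree_smult_le[of "real j * q" P'] by simp
      qed
      moreover have "hermite q k x = poly (pCons 0 P - smult (real j * q) P') x" for x
        by (simp add: Suc hermite_Suc P P' del: One_nat_def)
      ultimately show ?thesis using Suc by blast
    qed
  qed
  then show ?thesis using that by blast
qed

text \<open>Distinct terms of the sum may have the same exponents, and then have to be collected: the
  definition of cylindrical polynomials indexes the terms by their exponents.\<close>

lemma cyl_polys_sum:
  fixes n :: nat
  assumes l: "\<And>i. i < n \<Longrightarrow> l i \<in> top_dual" and I: "finite I"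
    and deg: "\<And>s. s \<in> I \<Longrightarrow> (\<Sum>i<n. \<alpha> s i) \<le> d"
  shows "(\<lambda>x. \<Sum>s\<in>I. b s * (\<Prod>i<n. l i x ^ \<alpha> s i)) \<in> cyl_polys d"
proof -
  define c where "c \<beta> = (\<Sum>s\<in>{s \<in> I. \<alpha> s = \<beta>}. b s)" for \<beta>
  have "(\<Sum>s\<in>I. b s * (\<Prod>i<n. l i x ^ \<alpha> s i)) = (\<Sum>\<beta>\<in>\<alpha> ` I. c \<beta> * (\<Prod>i<n. l i x ^ \<beta> i))" for x
  proof -
    have "(\<Sum>s\<in>I. b s * (\<Prod>i<n. l i x ^ \<alpha> s i)) =
        (\<Sum>\<beta>\<in>\<alpha> ` I. \<Sum>s\<in>{s \<in> I. \<alpha> s = \<beta>}. b s * (\<Prod>i<n. l i x ^ \<alpha> s i))"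
      by (rule sum.image_gen[OF I])
    also have "\<dots> = (\<Sum>\<beta>\<in>\<alpha> ` I. c \<beta> * (\<Prod>i<n. l i x ^ \<beta> i))"
      unfolding c_def sum_distrib_right by (intro sum.cong) auto
    finally show ?thesis .
  qed
  then have "(\<lambda>x. \<Sum>s\<in>I. b s * (\<Prod>i<n. l i x ^ \<alpha> s i)) = (\<lambda>x. \<Sum>\<beta>\<in>\<alpha> ` I. c \<beta> * (\<Prod>i<n. l i x ^ \<beta> i))"
    by (rule ext)
  moreover have "\<forall>i<n. l i \<in> top_dual" "finite (\<alpha> ` I)" "\<forall>\<beta>\<in>\<alpha> ` I. (\<Sum>i<n. \<beta> i) \<le> d"
    using l I deg by auto
  ultimately show ?thesis unfolding cyl_polys_def by blast
qed

lemma has_moderate_derivative_mult: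
  assumes "has_moderate_derivative F DF" "has_moderate_derivative G DG"
  shows "has_moderate_derivative (\<lambda>x. F x * G x) (\<lambda>x h. DF x h * G x + DG x h * F x)"
  unfolding has_moderate_derivative_def
proof (intro conjI allI)
  fix x h
  have lin: "linear (DF x)" "linear (DG x)" using assms by (auto simp: has_moderate_derivative_def)
  show "linear (\<lambda>h. DF x h * G x + DG x h * F x)"
    using lin by (intro linearI) (auto simp: linear_add linear_scale algebra_simps)
  have "((\<lambda>t. F (x + t *\<^sub>R h)) has_real_derivative DF x h) (at 0)"
    "((\<lambda>t. G (x + t *\<^sub>R h)) has_real_derivative DG x h) (at 0)"
    using assms by (auto simp: has_moderate_derivative_def)
  from DERIV_mult[OF this]
  show "((\<lambda>t. F (x + t *\<^sub>R h) * G (x + t *\<^sub>R h)) has_real_derivative DF x h * G x + DG x h * F x) (at 0)"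
    by simp
  show "(\<lambda>x. DF x h * G x + DG x h * F x) \<in> moderate"
    using assms unfolding has_moderate_derivative_def by (intro moderate_add moderate_mult) auto
  show "(\<lambda>x. F x * G x) \<in> moderate"
    using assms unfolding has_moderate_derivative_def by (intro moderate_mult) auto
qed

lemma has_moderate_derivative_cmult:
  assumes "has_moderate_derivative F DF"
  shows "has_moderate_derivative (\<lambda>x. c * F x) (\<lambda>x h. c * DF x h)"
  using assms unfolding has_moderate_derivative_def
  by (auto intro!: moderate_cmult DERIV_cmult linearI simp: linear_add linear_scale distrib_left)

lemma has_moderate_derivative_tensor:
  fixes l :: "nat \<Rightarrow> 'a::hausdorff_locally_convex \<Rightarrow> real"
  assumes R: "R > 0" and a: "\<And>j. j < n \<Longrightarrow> a j \<in> test_functions R"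
    and l: "\<And>j. j < n \<Longrightarrow> l j \<in> top_dual"
  shows "has_moderate_derivative (\<lambda>x. \<Prod>j<n. a j (l j x))
    (\<lambda>x h. \<Sum>j<n. deriv (a j) (l j x) * l j h * (\<Prod>i\<in>{..<n} - {j}. a i (l i x)))"
  unfolding has_moderate_derivative_def
proof (intro conjI allI)
  have mod: "(\<lambda>x. f (l j x)) \<in> moderate" if f: "f \<in> test_functions R" and j: "j < n" for f j
  proof -
    have [measurable]: "f \<in> borel_measurable borel" "l j \<in> borel_measurable borel"
      using l[OF j] by (auto intro: borel_measurable_continuous_onI test_function_continuous[OF R f])
    obtain C where "\<And>y. \<bar>f y\<bar> \<le> C" using test_function_bounded[OF R f] by metis
    then show ?thesis by (intro moderate_bounded[of _ C]) auto
  qed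
  show "(\<lambda>x. \<Prod>j<n. a j (l j x)) \<in> moderate" by (intro moderate_prod mod a) auto
  fix x :: 'a and h :: 'a
  show "(\<lambda>x. \<Sum>j<n. deriv (a j) (l j x) * l j h * (\<Prod>i\<in>{..<n} - {j}. a i (l i x))) \<in> moderate"
    by (intro moderate_sum moderate_mult moderate_prod moderate_const mod a test_function_DERIV(1)[OF R]) auto
  show "linear (\<lambda>h. \<Sum>j<n. deriv (a j) (l j x) * l j h * (\<Prod>i\<in>{..<n} - {j}. a i (l i x)))"
    using l by (intro linearI) (auto simp: top_dual_linear algebra_simps sum.distrib sum_distrib_left)
  have "((\<lambda>t. \<Prod>j<n. a j (l j (x + t *\<^sub>R h))) has_real_derivative
      (\<Sum>j<n. deriv (a j) (l j x) * l j h * (\<Prod>i\<in>{..<n} - {j}. a i (l i (x + 0 *\<^sub>R h))))) (at 0)"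
  proof (rule has_field_derivative_prod)
    fix j assume "j \<in> {..<n}"
    then have j: "j < n" by simp
    have "((\<lambda>t. l j (x + t *\<^sub>R h)) has_real_derivative l j h) (at 0)"
      using l[OF j] by (auto simp: top_dual_linear intro!: derivative_eq_intros)
    from DERIV_chain2[OF test_function_DERIV(2)[OF R a[OF j]] this]
    show "((\<lambda>t. a j (l j (x + t *\<^sub>R h))) has_real_derivative deriv (a j) (l j x) * l j h) (at 0)" by simp
  qed
  then show "((\<lambda>t. \<Prod>j<n. a j (l j (x + t *\<^sub>R h))) has_real_derivative
      (\<Sum>j<n. deriv (a j) (l j x) * l j h * (\<Prod>i\<in>{..<n} - {j}. a i (l i x)))) (at 0)" by simp
qed

definition cutoff :: "real \<Rightarrow> real" where "cutoff = bump [:exp 1:] 0"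

lemma cutoff_0: "cutoff 0 = 1"
  by (simp add: cutoff_def bump_def exp_add[symmetric])

lemma abs_cutoff_le: "\<bar>cutoff x\<bar> \<le> 1"
proof (cases "\<bar>x\<bar> < 1")
  case True
  then have "x\<^sup>2 < 1" by (simp add: abs_square_less_1)
  then have "1 \<le> 1 / (1 - x\<^sup>2)" by simp
  then have "exp (1 + - (1 / (1 - x\<^sup>2))) \<le> 1" by simp
  then show ?thesis using True by (simp add: cutoff_def bump_def exp_add[symmetric])
qed (simp add: cutoff_def bump_def)

lemma cutoff_test: "(\<lambda>y. cutoff (y / R)) \<in> test_functions R"
  by (auto simp: cutoff_def test_functions_def)

lemma DERIV_cutoff: "(cutoff has_real_derivative deriv cutoff x) (at x)"
  using test_function_DERIV(2)[of 1 cutoff] cutoff_test[of 1] by simp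

lemma deriv_cutoff_scaled: "R > 0 \<Longrightarrow> deriv (\<lambda>y. cutoff (y / R)) x = deriv cutoff (x / R) / R"
proof (rule DERIV_imp_deriv)
  assume "R > 0"
  then have "((\<lambda>y. cutoff (y / R)) has_real_derivative deriv cutoff (x / R) * (1 / R)) (at x)"
    by (intro DERIV_chain2[OF DERIV_cutoff]) (auto intro!: derivative_eq_intros)
  then show "((\<lambda>y. cutoff (y / R)) has_real_derivative deriv cutoff (x / R) / R) (at x)" by simp
qed

context radon_gaussian
begin

lemma has_moderate_derivative_herm:
  assumes m: "m \<in> top_dual"
  shows "has_moderate_derivative (herm m k) (\<lambda>x h. real k * m h * herm m (k - 1) x)"
  unfolding has_moderate_derivative_def
proof (intro conjI allI herm_moderate m DERIV_herm)
  fix x h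
  show "(\<lambda>x. real k * m h * herm m (k - 1) x) \<in> moderate" by (intro moderate_cmult herm_moderate m)
  show "linear (\<lambda>h. real k * m h * herm m (k - 1) x)"
    using m by (intro linearI) (auto simp: top_dual_linear algebra_simps)
qed

text \<open>In the inductive construction a list of triples is more convenient than indexed families.\<close>

lemma herm_span_repr:
  assumes "p \<in> herm_span"
  obtains n :: nat and c l k where "\<And>i. i < n \<Longrightarrow> l i \<in> top_dual" "p = (\<lambda>x. \<Sum>i<n. c i * herm (l i) (k i) x)"
proof -
  have "\<exists>ts. (\<forall>(c, l, k)\<in>set ts. l \<in> top_dual) \<and> p = (\<lambda>x. \<Sum>(c, l, k)\<leftarrow>ts. c * herm l k x)"
    using assms
  proof induction
    case (herm l k)
    then show ?case by (intro exI[of _ "[(1, l, k)]"]) auto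
  next
    case (add p r)
    then obtain ts us where "\<forall>(c, l, k)\<in>set ts. l \<in> top_dual" "p = (\<lambda>x. \<Sum>(c, l, k)\<leftarrow>ts. c * herm l k x)"
      "\<forall>(c, l, k)\<in>set us. l \<in> top_dual" "r = (\<lambda>x. \<Sum>(c, l, k)\<leftarrow>us. c * herm l k x)" by blast
    then show ?case by (intro exI[of _ "ts @ us"]) auto
  next
    case (scale p a)
    then obtain ts where ts: "\<forall>(c, l, k)\<in>set ts. l \<in> top_dual" "p = (\<lambda>x. \<Sum>(c, l, k)\<leftarrow>ts. c * herm l k x)"
      by blast
    have "a * (\<Sum>(c, l, k)\<leftarrow>ts. c * herm l k x) = (\<Sum>(c, l, k)\<leftarrow>map (\<lambda>(c, l, k). (a * c, l, k)) ts. c * herm l k x)" for x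
      by (induction ts) (auto simp: distrib_left)
    then show ?case using ts by (intro exI[of _ "map (\<lambda>(c, l, k). (a * c, l, k)) ts"]) auto
  qed
  then obtain ts where ts: "\<forall>(c, l, k)\<in>set ts. l \<in> top_dual" "p = (\<lambda>x. \<Sum>(c, l, k)\<leftarrow>ts. c * herm l k x)" by blast
  have "fst (snd (ts ! i)) \<in> top_dual" if "i < length ts" for i
    using ts(1) nth_mem[OF that] by fastforce
  moreover have "p = (\<lambda>x. \<Sum>i<length ts. fst (ts ! i) * herm (fst (snd (ts ! i))) (snd (snd (ts ! i))) x)"
    by (simp add: ts(2) sum_list_sum_nth case_prod_beta' atLeast0LessThan)
  ultimately show ?thesis
    by (rule that[of "length ts" "\<lambda>i. fst (snd (ts ! i))" "\<lambda>i. fst (ts ! i)" "\<lambda>i. snd (snd (ts ! i))"])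
qed

context
  fixes n :: nat and l :: "nat \<Rightarrow> 'a \<Rightarrow> real" and k :: "nat \<Rightarrow> nat"
begin

text \<open>Only the coefficients vary below: sorting by degree, scaling and truncation all act on them,
  while the functionals and the degrees stay fixed.\<close>

definition hsum :: "(nat \<Rightarrow> real) \<Rightarrow> 'a \<Rightarrow> real" where
  "hsum b x = (\<Sum>i<n. b i * herm (l i) (k i) x)"

text \<open>The square of the Cameron--Martin norm of \<open>\<Sum>i. b\<^sub>i H\<^bsub>k(i)-1\<^esub>(l\<^sub>i) h\<^sub>i\<close>, where \<open>h\<^sub>i\<close> represents \<open>l\<^sub>i\<close>.\<close>

definition field_energy :: "(nat \<Rightarrow> real) \<Rightarrow> 'a \<Rightarrow> real" where
  "field_energy b x = (\<Sum>i<n. \<Sum>j<n. b i * b j * cov (l i) (l j) *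
     (herm (l i) (k i - 1) x * herm (l j) (k j - 1) x))"

definition cut :: "real \<Rightarrow> 'a \<Rightarrow> real" where
  "cut R x = (\<Prod>j<n. cutoff (l j x / R))"

definition cut_deriv :: "real \<Rightarrow> 'a \<Rightarrow> 'a \<Rightarrow> real" where
  "cut_deriv R x h = (\<Sum>j<n. deriv cutoff (l j x / R) / R * l j h * (\<Prod>i\<in>{..<n} - {j}. cutoff (l i x / R)))"

text \<open>Minus \<open>\<Sum>i. b\<^sub>i H\<^bsub>k(i)-1\<^esub>(l\<^sub>i) h\<^sub>i\<close>, cut off at scale \<open>R\<close> in all variables.\<close>

definition cut_field :: "real \<Rightarrow> (nat \<Rightarrow> real) \<Rightarrow> 'a \<Rightarrow> 'a" where
  "cut_field R b x = (\<Sum>i<n. (- b i * (cut R x * herm (l i) (k i - 1) x)) *\<^sub>R cm_vector (l i))"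

definition cut_field_div :: "real \<Rightarrow> (nat \<Rightarrow> real) \<Rightarrow> 'a \<Rightarrow> real" where
  "cut_field_div R b x = cut R x * hsum b x -
     (\<Sum>i<n. b i * (cut_deriv R x (cm_vector (l i)) * herm (l i) (k i - 1) x))"

context
  assumes l: "\<And>i. i < n \<Longrightarrow> l i \<in> top_dual"
begin

lemma hsum_moderate: "hsum b \<in> moderate"
  unfolding hsum_def by (intro moderate_sum moderate_cmult herm_moderate l) simp

lemma hsum_inner:
  "(\<integral>x. hsum b x * hsum c x \<partial>\<gamma>) =
    (\<Sum>i<n. \<Sum>j<n. b i * c j * (of_bool (k i = k j) * fact (k j) * cov (l i) (l j) ^ k j))"
proof -
  have mod: "(\<lambda>x. b i * c j * (herm (l i) (k i) x * herm (l j) (k j) x)) \<in> moderate"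
    if "i < n" "j < n" for i j
    by (intro moderate_cmult moderate_mult herm_moderate l that)
  have "(\<integral>x. hsum b x * hsum c x \<partial>\<gamma>) =
      (\<integral>x. (\<Sum>i<n. \<Sum>j<n. b i * c j * (herm (l i) (k i) x * herm (l j) (k j) x)) \<partial>\<gamma>)"
    by (simp add: hsum_def sum_product ac_simps)
  also have "\<dots> = (\<Sum>i<n. \<integral>x. (\<Sum>j<n. b i * c j * (herm (l i) (k i) x * herm (l j) (k j) x)) \<partial>\<gamma>)"
    by (intro Bochner_Integration.integral_sum integrable_moderate moderate_sum mod) auto
  also have "\<dots> = (\<Sum>i<n. \<Sum>j<n. \<integral>x. b i * c j * (herm (l i) (k i) x * herm (l j) (k j) x) \<partial>\<gamma>)"
    by (intro sum.cong refl Bochner_Integration.integral_sum integrable_moderate mod) auto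
  also have "\<dots> = (\<Sum>i<n. \<Sum>j<n. b i * c j * (of_bool (k i = k j) * fact (k j) * cov (l i) (l j) ^ k j))"
    by (intro sum.cong refl) (auto simp: herm_orthogonality[OF l l])
  finally show ?thesis .
qed

text \<open>Membership in the chaos consists of two parts: being a limit of polynomials of degree \<open>d\<close> (here a
  polynomial itself), and orthogonality to limits of polynomials of smaller degree.\<close>

lemma hsum_same_degree_chaos:
  assumes b: "\<And>i. i < n \<Longrightarrow> b i \<noteq> 0 \<Longrightarrow> k i = d"
  shows "hsum b \<in> chaos \<gamma> d"
proof -
  have eq: "hsum b = (\<lambda>x. \<Sum>i<n. b i * herm (l i) d x)"
    unfolding hsum_def using b by (intro ext sum.cong) auto
  have L2: "hsum b \<in> L2_space \<gamma>" by (intro moderate_L2 hsum_moderate)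
  have "\<forall>i. \<exists>P. degree P \<le> d \<and> (\<forall>x. hermite (cov (l i) (l i)) d x = poly P x)"
    using hermite_poly by metis
  then obtain P where P: "\<And>i. degree (P i) \<le> d" "\<And>i x. hermite (cov (l i) (l i)) d x = poly (P i) x" by metis
  have cyl: "hsum b \<in> cyl_polys d"
  proof -
    define \<alpha> where "\<alpha> = (\<lambda>(i :: nat, j) i' :: nat. if i' = i then j else (0 :: nat))"
    have "hsum b x = (\<Sum>s\<in>{..<n} \<times> {..d}. (b (fst s) * coeff (P (fst s)) (snd s)) * (\<Prod>i<n. l i x ^ \<alpha> s i))" for x
    proof -
      have "poly (P i) y = (\<Sum>j\<le>d. coeff (P i) j * y ^ j)" for i y
        unfolding poly_altdef using P(1)[of i]
        by (intro sum.mono_neutral_left) (auto simp: coeff_eq_0)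
      then have "hsum b x = (\<Sum>i<n. \<Sum>j\<le>d. (b i * coeff (P i) j) * l i x ^ j)"
        by (simp add: eq herm_def P(2) sum_distrib_left mult.assoc)
      also have "\<dots> = (\<Sum>i<n. \<Sum>j\<le>d. (b i * coeff (P i) j) * (\<Prod>i'<n. l i' x ^ \<alpha> (i, j) i'))"
      proof (intro sum.cong refl arg_cong2[where f = "(*)"])
        fix i j assume "i \<in> {..<n}"
        have "(\<Prod>i'<n. l i' x ^ \<alpha> (i, j) i') = (\<Prod>i'<n. if i' = i then l i x ^ j else 1)"
          by (intro prod.cong) (auto simp: \<alpha>_def)
        then show "l i x ^ j = (\<Prod>i'<n. l i' x ^ \<alpha> (i, j) i')" using \<open>i \<in> {..<n}\<close> by simp
      qed
      finally show ?thesis by (simp add: sum.cartesian_product case_prod_beta')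
    qed
    moreover have "(\<lambda>x. \<Sum>s\<in>{..<n} \<times> {..d}. (b (fst s) * coeff (P (fst s)) (snd s)) * (\<Prod>i<n. l i x ^ \<alpha> s i)) \<in> cyl_polys d"
      by (rule cyl_polys_sum[OF l]) (auto simp: \<alpha>_def)
    ultimately show ?thesis by (subst ext[of "hsum b"])
  qed
  then have mp: "hsum b \<in> meas_polys \<gamma> d"
    unfolding meas_polys_def using L2 by (auto simp: L2_norm_def intro!: bexI[of _ "hsum b"])
  show ?thesis
  proof (cases d)
    case 0
    then show ?thesis using L2 eq by (auto simp: herm_0)
  next
    case (Suc e)
    have "(\<integral>x. hsum b x * g x \<partial>\<gamma>) = 0" if g: "g \<in> meas_polys \<gamma> e" for g
    proof -
      have gL2: "g \<in> L2_space \<gamma>" using g by (simp add: meas_polys_def)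
      have "\<bar>\<integral>x. hsum b x * g x \<partial>\<gamma>\<bar> \<le> \<epsilon>" if \<epsilon>: "\<epsilon> > 0" for \<epsilon>
      proof -
        define C where "C = L2_norm \<gamma> (hsum b) + 1"
        have C: "C > 0" using L2_norm_nonneg[of \<gamma> "hsum b"] by (simp add: C_def)
        then obtain p where p: "p \<in> cyl_polys e" "L2_norm \<gamma> (\<lambda>x. g x - p x) < \<epsilon> / C"
          using g \<epsilon> unfolding meas_polys_def by (auto elim!: allE[of _ "\<epsilon> / C"])
        have dp: "dual_poly e p" by (rule cyl_polys_dual_poly[OF p(1)])
        have pm: "p \<in> moderate" by (rule dual_poly_moderate[OF dp])
        have "(\<integral>x. hsum b x * p x \<partial>\<gamma>) = (\<integral>x. (\<Sum>i<n. b i * (herm (l i) d x * p x)) \<partial>\<gamma>)"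
          by (simp add: eq sum_distrib_right mult.assoc)
        also have "\<dots> = (\<Sum>i<n. \<integral>x. b i * (herm (l i) d x * p x) \<partial>\<gamma>)"
          by (intro Bochner_Integration.integral_sum integrable_moderate moderate_cmult moderate_mult herm_moderate l pm) simp
        also have "\<dots> = 0"
          using herm_orthogonal_dual_poly[OF l dp, of _ d] Suc by simp
        finally have p0: "(\<integral>x. hsum b x * p x \<partial>\<gamma>) = 0" .
        have "(\<integral>x. hsum b x * g x \<partial>\<gamma>) = (\<integral>x. hsum b x * (g x - p x) \<partial>\<gamma>) + (\<integral>x. hsum b x * p x \<partial>\<gamma>)"
          using L2_integrable_mult[OF L2 gL2] L2_integrable_mult[OF L2 moderate_L2[OF pm]]
          by (simp add: right_diff_distrib)
        also have "\<bar>\<dots>\<bar> \<le> L2_norm \<gamma> (hsum b) * L2_norm \<gamma> (\<lambda>x. g x - p x)"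
          unfolding p0 using L2_Cauchy_Schwarz[OF L2 L2_diff[OF gL2 moderate_L2[OF pm]]] by simp
        also have "\<dots> \<le> C * (\<epsilon> / C)"
          using p(2) C by (intro mult_mono) (auto simp: C_def L2_norm_nonneg)
        finally show ?thesis using C by simp
      qed
      then have "\<bar>\<integral>x. hsum b x * g x \<partial>\<gamma>\<bar> \<le> 0" using dense_ge by blast
      then show ?thesis by simp
    qed
    then show ?thesis using mp Suc by simp
  qed
qed

lemma hsum_low_degree_chaos_sum:
  assumes b: "\<And>i. i < n \<Longrightarrow> b i \<noteq> 0 \<Longrightarrow> k i < N"
  shows "hsum b \<in> chaos_sum \<gamma> N"
proof -
  have "hsum b x = (\<Sum>d<N. hsum (\<lambda>i. if k i = d then b i else 0) x)" for x
  proof -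
    have "(\<Sum>d<N. hsum (\<lambda>i. if k i = d then b i else 0) x) =
        (\<Sum>i<n. \<Sum>d<N. (if k i = d then b i else 0) * herm (l i) (k i) x)"
      unfolding hsum_def by (rule sum.swap)
    also have "\<dots> = (\<Sum>i<n. b i * herm (l i) (k i) x)"
    proof (intro sum.cong refl)
      fix i assume i: "i \<in> {..<n}"
      have "(\<Sum>d<N. (if k i = d then b i else 0) * herm (l i) (k i) x) =
          (\<Sum>d<N. if k i = d then b i * herm (l i) (k i) x else 0)"
        by (intro sum.cong) auto
      also have "\<dots> = b i * herm (l i) (k i) x"
        using b[of i] i by (cases "b i = 0") auto
      finally show "(\<Sum>d<N. (if k i = d then b i else 0) * herm (l i) (k i) x) = b i * herm (l i) (k i) x" .
    qed
    finally show ?thesis by (simp add: hsum_def)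
  qed
  then show ?thesis
    unfolding chaos_sum_def
    by (intro CollectI exI[of _ "\<lambda>d. hsum (\<lambda>i. if k i = d then b i else 0)"])
      (auto intro!: hsum_same_degree_chaos split: if_splits)
qed

section \<open>Energy and divergence of the vector field of a Hermite sum\<close>

lemma cm_norm_sum_cm_vector:
  "(cm_norm \<gamma> (\<Sum>i<n. a i *\<^sub>R cm_vector (l i)))\<^sup>2 = (\<Sum>i<n. \<Sum>j<n. a i * a j * cov (l i) (l j))"
proof -
  have *: "(\<lambda>x. \<Sum>i<n. a i * l i x) \<in> top_dual"
    "cm_vector (\<lambda>x. \<Sum>i<n. a i * l i x) = (\<Sum>i<n. a i *\<^sub>R cm_vector (l i))"
    using cm_vector_sum[of "{..<n}" l a] l by auto
  have "(cm_norm \<gamma> (\<Sum>i<n. a i *\<^sub>R cm_vector (l i)))\<^sup>2 = cov (\<lambda>x. \<Sum>i<n. a i * l i x) (\<lambda>x. \<Sum>i<n. a i * l i x)"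
    using cm_norm_cm_vector[OF *(1)] by (simp add: *(2))
  also have "\<dots> = (\<Sum>i<n. a i * l i (cm_vector (\<lambda>x. \<Sum>i<n. a i * l i x)))"
    using dual_cm_vector[OF *(1) *(1)] by simp
  also have "\<dots> = (\<Sum>i<n. a i * (\<Sum>j<n. a j * l i (cm_vector (l j))))"
    unfolding *(2) using l by (intro sum.cong) (auto simp: top_dual_def linear_sum linear_scale)
  also have "\<dots> = (\<Sum>i<n. \<Sum>j<n. a i * a j * cov (l i) (l j))"
    using l by (auto intro!: sum.cong simp: sum_distrib_left dual_cm_vector cov_sym mult.assoc)
  finally show ?thesis .
qed

lemma field_energy_nonneg: "0 \<le> field_energy b x"
proof -
  have "field_energy b x = (cm_norm \<gamma> (\<Sum>i<n. (b i * herm (l i) (k i - 1) x) *\<^sub>R cm_vector (l i)))\<^sup>2"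
    unfolding cm_norm_sum_cm_vector field_energy_def by (intro sum.cong) (auto simp: ac_simps)
  then show ?thesis by simp
qed

lemma field_energy_moderate: "field_energy b \<in> moderate"
  unfolding field_energy_def by (intro moderate_sum moderate_cmult moderate_mult herm_moderate l) auto

text \<open>By the orthogonality relation, the terms of degree \<open>d\<close> contribute \<open>S\<^sub>d / d\<close> to the energy of the
  field and \<open>S\<^sub>d\<close> to the norm of the Hermite sum: \<open>(d - 1)! \<rho> \<rho>\<^sup>d\<^sup>-\<^sup>1 = d! \<rho>\<^sup>d / d\<close>. Moreover \<open>S\<^sub>d \<ge> 0\<close>, as it is
  the square norm of a partial sum. This is the spectral gap on the chaoses of order at least \<open>N\<close>.\<close>

lemma integral_field_energy_le:
  assumes N: "N \<ge> 1" and b: "\<And>i. i < n \<Longrightarrow> b i \<noteq> 0 \<Longrightarrow> N \<le> k i"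
  shows "(\<integral>x. field_energy b x \<partial>\<gamma>) \<le> (L2_norm \<gamma> (hsum b))\<^sup>2 / N"
proof -
  define T where "T i j = b i * b j * (fact (k j) * cov (l i) (l j) ^ k j)" for i j
  define S where "S d = (\<Sum>i\<in>{i \<in> {..<n}. k i = d}. \<Sum>j\<in>{j \<in> {..<n}. k j = d}. T i j)" for d
  \<comment> \<open>sort the pairs of terms by their common degree\<close>
  have group: "(\<Sum>i<n. \<Sum>j<n. w (k i) * (of_bool (k i = k j) * T i j)) = (\<Sum>d\<in>k ` {..<n}. w d * S d)" for w :: "nat \<Rightarrow> real"
  proof -
    have "(\<Sum>i<n. \<Sum>j<n. w (k i) * (of_bool (k i = k j) * T i j)) =
        (\<Sum>i<n. w (k i) * (\<Sum>j\<in>{j \<in> {..<n}. k j = k i}. T i j))"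
      unfolding sum_distrib_left
      by (intro sum.cong refl sum.mono_neutral_cong_right) auto
    also have "\<dots> = (\<Sum>d\<in>k ` {..<n}. \<Sum>i\<in>{i \<in> {..<n}. k i = d}. w (k i) * (\<Sum>j\<in>{j \<in> {..<n}. k j = k i}. T i j))"
      by (rule sum.image_gen) simp
    also have "\<dots> = (\<Sum>d\<in>k ` {..<n}. w d * S d)"
      unfolding S_def sum_distrib_left by (intro sum.cong) auto
    finally show ?thesis .
  qed
  have S0: "0 \<le> S d" for d
  proof -
    define c where "c i = (if k i = d then b i else 0)" for i
    have "S d = (\<Sum>i<n. \<Sum>j<n. c i * c j * (of_bool (k i = k j) * fact (k j) * cov (l i) (l j) ^ k j))"
    proof -
      have "(\<Sum>i<n. \<Sum>j<n. c i * c j * (of_bool (k i = k j) * fact (k j) * cov (l i) (l j) ^ k j)) =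
          (\<Sum>i\<in>{i \<in> {..<n}. k i = d}. \<Sum>j<n. c i * c j * (of_bool (k i = k j) * fact (k j) * cov (l i) (l j) ^ k j))"
        by (intro sum.mono_neutral_right) (auto simp: c_def)
      also have "\<dots> = S d"
        unfolding S_def by (intro sum.cong refl sum.mono_neutral_cong_right) (auto simp: c_def T_def)
      finally show ?thesis ..
    qed
    then have "S d = (\<integral>x. hsum c x * hsum c x \<partial>\<gamma>)" by (simp add: hsum_inner)
    then show ?thesis by simp
  qed
  have norm: "(L2_norm \<gamma> (hsum b))\<^sup>2 = (\<Sum>d\<in>k ` {..<n}. 1 * S d)"
  proof -
    have "(L2_norm \<gamma> (hsum b))\<^sup>2 = (\<integral>x. hsum b x * hsum b x \<partial>\<gamma>)"
      by (simp add: L2_norm_square power2_eq_square[of "hsum b _"])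
    also have "\<dots> = (\<Sum>i<n. \<Sum>j<n. 1 * (of_bool (k i = k j) * T i j))"
      unfolding hsum_inner by (intro sum.cong refl) (simp add: T_def)
    also have "\<dots> = (\<Sum>d\<in>k ` {..<n}. 1 * S d)" by (rule group)
    finally show ?thesis .
  qed
  have mod: "(\<lambda>x. b i * b j * cov (l i) (l j) * (herm (l i) (k i - 1) x * herm (l j) (k j - 1) x)) \<in> moderate"
    if "i < n" "j < n" for i j
    by (intro moderate_cmult moderate_mult herm_moderate l that)
  have "(\<integral>x. field_energy b x \<partial>\<gamma>) =
      (\<Sum>i<n. \<integral>x. (\<Sum>j<n. b i * b j * cov (l i) (l j) * (herm (l i) (k i - 1) x * herm (l j) (k j - 1) x)) \<partial>\<gamma>)"
    unfolding field_energy_def by (intro Bochner_Integration.integral_sum integrable_moderate moderate_sum mod) auto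
  also have "\<dots> = (\<Sum>i<n. \<Sum>j<n. \<integral>x. b i * b j * cov (l i) (l j) * (herm (l i) (k i - 1) x * herm (l j) (k j - 1) x) \<partial>\<gamma>)"
    by (intro sum.cong refl Bochner_Integration.integral_sum integrable_moderate mod) auto
  also have "\<dots> = (\<Sum>i<n. \<Sum>j<n. (1 / real (k i)) * (of_bool (k i = k j) * T i j))"
  proof (intro sum.cong refl)
    fix i j assume ij: "i \<in> {..<n}" "j \<in> {..<n}"
    show "(\<integral>x. b i * b j * cov (l i) (l j) * (herm (l i) (k i - 1) x * herm (l j) (k j - 1) x) \<partial>\<gamma>) =
        (1 / real (k i)) * (of_bool (k i = k j) * T i j)"
    proof (cases "b i = 0 \<or> b j = 0")
      case False
      then have kij: "1 \<le> k i" "1 \<le> k j" using b ij N by (auto intro: order_trans)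
      then obtain d e where "k i = Suc d" "k j = Suc e" by (metis Suc_le_D One_nat_def)
      then show ?thesis using herm_orthogonality[OF l l, of i j d e] ij by (auto simp: T_def)
    qed (auto simp: T_def)
  qed
  also have "\<dots> = (\<Sum>d\<in>k ` {..<n}. (1 / real d) * S d)" by (rule group)
  also have "\<dots> \<le> (\<Sum>d\<in>k ` {..<n}. (1 / real N) * (1 * S d))"
  proof (rule sum_mono)
    fix d assume "d \<in> k ` {..<n}"
    show "(1 / real d) * S d \<le> (1 / real N) * (1 * S d)"
    proof (cases "N \<le> d")
      case True
      then have "1 / real d \<le> 1 / real N" using N by (intro divide_left_mono) auto
      then have "(1 / real d) * S d \<le> (1 / real N) * S d" by (rule mult_right_mono[OF _ S0])
      then show ?thesis by simp
    next
      case False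
      have "S d = 0" unfolding S_def T_def using b False by (intro sum.neutral ballI) force
      then show ?thesis by simp
    qed
  qed
  also have "\<dots> = (L2_norm \<gamma> (hsum b))\<^sup>2 / N" unfolding norm sum_distrib_left[symmetric] by simp
  finally show ?thesis .
qed

lemma cut_has_derivative: "R > 0 \<Longrightarrow> has_moderate_derivative (cut R) (cut_deriv R)"
  using has_moderate_derivative_tensor[of R n "\<lambda>_ y. cutoff (y / R)" l] cutoff_test l
  by (simp add: cut_def[abs_def] cut_deriv_def[abs_def] deriv_cutoff_scaled)

lemma abs_cut_le: "\<bar>cut R x\<bar> \<le> 1"
  unfolding cut_def abs_prod by (rule prod_le_1) (auto simp: abs_cutoff_le)

lemma cut_field_FC0: 
  assumes R: "R > 0" shows "cut_field R b \<in> FC0_inf_vec \<gamma>"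
proof -
  have "\<forall>i. \<exists>P. \<forall>y. hermite (cov (l i) (l i)) (k i - 1) y = poly P y" using hermite_poly by metis
  then obtain P where P: "\<And>i y. hermite (cov (l i) (l i)) (k i - 1) y = poly (P i) y" by metis
  \<comment> \<open>the Hermite factor and the coefficient are absorbed in the \<open>i\<close>-th factor of the tensor product\<close>
  define a where "a i j = (if j = i then (\<lambda>y. poly (smult (- b i) (P i)) y * cutoff (y / R)) else (\<lambda>y. cutoff (y / R)))" for i j
  have a: "a i j \<in> test_functions R" for i j
    unfolding a_def using cutoff_test[of R] poly_times_test_function[OF R cutoff_test[of R], of "smult (- b i) (P i)"]
    by (simp del: poly_smult)
  have "tensor n (a i) (\<lambda>j. l j x) = - b i * (cut R x * herm (l i) (k i - 1) x)" if i: "i < n" for i x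
  proof -
    have "tensor n (a i) (\<lambda>j. l j x) = a i i (l i x) * (\<Prod>j\<in>{..<n} - {i}. a i j (l j x))"
      unfolding tensor_def using i by (intro prod.remove) auto
    also have "(\<Prod>j\<in>{..<n} - {i}. a i j (l j x)) = (\<Prod>j\<in>{..<n} - {i}. cutoff (l j x / R))"
      by (intro prod.cong) (auto simp: a_def)
    also have "a i i (l i x) = - b i * poly (P i) (l i x) * cutoff (l i x / R)" by (simp add: a_def)
    finally show ?thesis using prod.remove[of "{..<n}" i "\<lambda>j. cutoff (l j x / R)"] i
      by (simp add: cut_def herm_def P del: One_nat_def)
  qed
  then have "cut_field R b = (\<lambda>x. \<Sum>i<n. tensor n (a i) (\<lambda>j. l j x) *\<^sub>R cm_vector (l i))"
    by (simp add: cut_field_def fun_eq_iff)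
  then show ?thesis unfolding FC0_inf_vec_def
    using tensor_Cb_inf[OF R a] l cm_vector_in_cm_space
    by (intro CollectI exI[of _ n] exI[of _ "\<lambda>i. tensor n (a i)"] exI[of _ l] exI[of _ "\<lambda>i. cm_vector (l i)"]) auto
qed

lemma cut_field_has_div:
  assumes R: "R > 0" and b: "\<And>i. i < n \<Longrightarrow> b i \<noteq> 0 \<Longrightarrow> 1 \<le> k i"
  shows "has_gauss_div \<gamma> (cut_field R b) (cut_field_div R b)"
proof -
  define DF where "DF i x h = - b i * (cut_deriv R x h * herm (l i) (k i - 1) x +
    (real (k i - 1) * l i h * herm (l i) (k i - 1 - 1) x) * cut R x)" for i x h
  have "has_gauss_div \<gamma> (cut_field R b)
    (\<lambda>x. \<Sum>i<n. DF i x (cm_vector (l i)) - l i x * (- b i * (cut R x * herm (l i) (k i - 1) x)))"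
    unfolding cut_field_def[abs_def] DF_def
    by (intro has_gauss_div_sum l has_moderate_derivative_cmult has_moderate_derivative_mult
        cut_has_derivative R has_moderate_derivative_herm)
  moreover have "(\<Sum>i<n. DF i x (cm_vector (l i)) - l i x * (- b i * (cut R x * herm (l i) (k i - 1) x))) =
      cut_field_div R b x" for x
  proof -
    have "DF i x (cm_vector (l i)) - l i x * (- b i * (cut R x * herm (l i) (k i - 1) x)) =
        cut R x * (b i * herm (l i) (k i) x) - b i * (cut_deriv R x (cm_vector (l i)) * herm (l i) (k i - 1) x)"
      if i: "i < n" for i
    proof (cases "b i = 0")
      case False
      then obtain d where "k i = Suc d" using b[OF i] by (metis Suc_le_D One_nat_def)
      then show ?thesis using l[OF i] by (simp add: DF_def herm_Suc dual_cm_vector algebra_simps)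
    qed (simp add: DF_def)
    then show ?thesis by (simp add: cut_field_div_def hsum_def sum_distrib_left sum_subtractf)
  qed
  ultimately show ?thesis by simp
qed

lemma cut_field_norm_le:
  assumes N: "N \<ge> 1" and b: "\<And>i. i < n \<Longrightarrow> b i \<noteq> 0 \<Longrightarrow> N \<le> k i" and R: "R > 0"
  shows "L2_norm \<gamma> (\<lambda>x. cm_norm \<gamma> (cut_field R b x)) \<le> L2_norm \<gamma> (hsum b) / sqrt N"
proof -
  have eq: "(cm_norm \<gamma> (cut_field R b x))\<^sup>2 = (cut R x)\<^sup>2 * field_energy b x" for x
    unfolding cut_field_def cm_norm_sum_cm_vector field_energy_def sum_distrib_left
    by (intro sum.cong) (auto simp: ac_simps power2_eq_square)
  have cm: "cut R \<in> moderate" using cut_has_derivative[OF R] by (simp add: has_moderate_derivative_def)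
  have "(\<integral>x. (cut R x)\<^sup>2 * field_energy b x \<partial>\<gamma>) \<le> (\<integral>x. field_energy b x \<partial>\<gamma>)"
  proof (rule integral_mono)
    show "(cut R x)\<^sup>2 * field_energy b x \<le> field_energy b x" for x
      using abs_cut_le[of R x] field_energy_nonneg[of b x]
      by (intro mult_left_le_one_le) (auto simp: abs_square_le_1)
  qed (intro integrable_moderate moderate_mult moderate_power cm field_energy_moderate)+
  also have "\<dots> \<le> (L2_norm \<gamma> (hsum b))\<^sup>2 / N" by (rule integral_field_energy_le[OF N b])
  finally have "sqrt (\<integral>x. (cut R x)\<^sup>2 * field_energy b x \<partial>\<gamma>) \<le> sqrt ((L2_norm \<gamma> (hsum b))\<^sup>2 / N)"
    by (rule real_sqrt_le_mono)
  then show ?thesis by (simp add: L2_norm_def[of _ "\<lambda>x. cm_norm \<gamma> (cut_field R b x)"] eq real_sqrt_divide L2_norm_nonneg)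
qed

text \<open>The cutoff converges to \<open>1\<close> pointwise and boundedly, and its derivatives are of order \<open>1 / R\<close>.\<close>

lemma cut_field_div_tendsto:
  "(\<lambda>m. L2_norm \<gamma> (\<lambda>x. cut_field_div (real (Suc m)) b x - hsum b x)) \<longlonglongrightarrow> 0"
proof -
  obtain B where B: "\<And>y. \<bar>deriv cutoff y\<bar> \<le> B"
    using test_function_bounded[of 1 "deriv cutoff"] test_function_DERIV(1)[of 1 cutoff] cutoff_test[of 1] by auto
  define C where "C i = (\<Sum>j<n. B * \<bar>l j (cm_vector (l i))\<bar>)" for i
  have B0: "B \<ge> 0" using B[of 0] by simp
  have C0: "C i \<ge> 0" for i unfolding C_def using B0 by (intro sum_nonneg) auto
  have cd: "\<bar>cut_deriv R x (cm_vector (l i))\<bar> \<le> C i / R" if R: "R > 0" for R x i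
  proof -
    have "\<bar>cut_deriv R x (cm_vector (l i))\<bar> \<le> (\<Sum>j<n. \<bar>deriv cutoff (l j x / R) / R * l j (cm_vector (l i)) * (\<Prod>i\<in>{..<n} - {j}. cutoff (l i x / R))\<bar>)"
      unfolding cut_deriv_def by (rule sum_abs)
    also have "\<dots> \<le> (\<Sum>j<n. B * \<bar>l j (cm_vector (l i))\<bar> / R)"
    proof (rule sum_mono)
      fix j
      have 1: "\<bar>\<Prod>i\<in>{..<n} - {j}. cutoff (l i x / R)\<bar> \<le> 1"
        unfolding abs_prod by (rule prod_le_1) (auto simp: abs_cutoff_le)
      have "\<bar>deriv cutoff (l j x / R) / R * l j (cm_vector (l i)) * (\<Prod>i\<in>{..<n} - {j}. cutoff (l i x / R))\<bar>
          \<le> \<bar>deriv cutoff (l j x / R) / R * l j (cm_vector (l i))\<bar> * 1"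
        unfolding abs_mult[of _ "\<Prod>i\<in>{..<n} - {j}. cutoff (l i x / R)"] by (intro mult_left_mono 1) simp
      also have "\<dots> = \<bar>deriv cutoff (l j x / R)\<bar> * \<bar>l j (cm_vector (l i))\<bar> / R"
        using R by (simp add: abs_mult)
      also have "\<dots> \<le> B * \<bar>l j (cm_vector (l i))\<bar> / R"
        using R by (intro divide_right_mono mult_right_mono B) auto
      finally show "\<bar>deriv cutoff (l j x / R) / R * l j (cm_vector (l i)) * (\<Prod>i\<in>{..<n} - {j}. cutoff (l i x / R))\<bar>
          \<le> B * \<bar>l j (cm_vector (l i))\<bar> / R" .
    qed
    finally show ?thesis by (simp add: C_def sum_divide_distrib)
  qed
  have absm: "(\<lambda>x. \<bar>F x\<bar>) \<in> moderate" if "F \<in> moderate" for F :: "'a \<Rightarrow> real"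
    using that by (auto simp: moderate_def)
  define W where "W x = 2 * \<bar>hsum b x\<bar> + (\<Sum>i<n. (\<bar>b i\<bar> * C i) * \<bar>herm (l i) (k i - 1) x\<bar>)" for x
  have W: "W \<in> moderate" unfolding W_def
    by (intro moderate_add moderate_cmult moderate_sum absm hsum_moderate herm_moderate l) auto
  define r where "r m x = cut_field_div (real (Suc m)) b x - hsum b x" for m x
  have vm: "cut_field_div R b \<in> moderate" if R: "R > 0" for R
  proof -
    have "cut R \<in> moderate" "\<And>h. (\<lambda>x. cut_deriv R x h) \<in> moderate"
      using cut_has_derivative[OF R] by (auto simp: has_moderate_derivative_def)
    then show ?thesis unfolding cut_field_div_def
      by (intro moderate_diff moderate_mult moderate_sum moderate_cmult hsum_moderate herm_moderate l) auto
  qed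
  have rm: "r m \<in> moderate" for m unfolding r_def by (intro moderate_diff vm hsum_moderate) simp
  have "(\<lambda>m. L2_norm \<gamma> (r m)) \<longlonglongrightarrow> 0"
  proof (rule L2_norm_tendsto_0[OF _ moderate_L2[OF W]])
    show "r m \<in> borel_measurable \<gamma>" for m using rm[of m] by (auto simp: measurable_eq)
    fix x
    show "\<bar>r m x\<bar> \<le> W x" for m
    proof -
      have "\<bar>r m x\<bar> \<le> \<bar>cut (real (Suc m)) x * hsum b x\<bar> + \<bar>hsum b x\<bar> +
          \<bar>\<Sum>i<n. b i * (cut_deriv (real (Suc m)) x (cm_vector (l i)) * herm (l i) (k i - 1) x)\<bar>"
        unfolding r_def cut_field_div_def by linarith
      also have "\<bar>cut (real (Suc m)) x * hsum b x\<bar> \<le> \<bar>hsum b x\<bar>"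
        unfolding abs_mult by (intro mult_left_le_one_le) (auto simp: abs_cut_le)
      also have "\<bar>\<Sum>i<n. b i * (cut_deriv (real (Suc m)) x (cm_vector (l i)) * herm (l i) (k i - 1) x)\<bar> \<le>
          (\<Sum>i<n. (\<bar>b i\<bar> * C i) * \<bar>herm (l i) (k i - 1) x\<bar>)"
      proof (rule order_trans[OF sum_abs], rule sum_mono)
        fix i
        have "\<bar>cut_deriv (real (Suc m)) x (cm_vector (l i))\<bar> \<le> C i / real (Suc m)" by (rule cd) simp
        also have "\<dots> \<le> C i" using C0[of i] by (simp add: field_simps)
        finally have "\<bar>cut_deriv (real (Suc m)) x (cm_vector (l i))\<bar> \<le> C i" .
        then show "\<bar>b i * (cut_deriv (real (Suc m)) x (cm_vector (l i)) * herm (l i) (k i - 1) x)\<bar> \<le>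
          (\<bar>b i\<bar> * C i) * \<bar>herm (l i) (k i - 1) x\<bar>"
          unfolding abs_mult mult.assoc by (intro mult_left_mono mult_right_mono) auto
      qed
      finally show ?thesis by (simp add: W_def)
    qed
    have inv: "(\<lambda>m. c / real (Suc m)) \<longlonglongrightarrow> 0" for c
      using LIMSEQ_Suc[OF lim_const_over_n[of c]] by simp
    have "isCont cutoff 0" using DERIV_isCont[OF DERIV_cutoff] .
    then have "(\<lambda>m. cutoff (l j x / real (Suc m))) \<longlonglongrightarrow> cutoff 0" for j
      by (rule isCont_tendsto_compose) (rule inv)
    then have "(\<lambda>m. cut (real (Suc m)) x) \<longlonglongrightarrow> (\<Prod>j<n. cutoff 0)"
      unfolding cut_def by (intro tendsto_prod) auto
    then have cut1: "(\<lambda>m. cut (real (Suc m)) x) \<longlonglongrightarrow> 1" by (simp add: cutoff_0)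
    have cd0: "(\<lambda>m. cut_deriv (real (Suc m)) x (cm_vector (l i))) \<longlonglongrightarrow> 0" for i
      by (rule Lim_null_comparison[OF _ inv[of "C i"]]) (use cd in auto)
    have "(\<lambda>m. r m x) \<longlonglongrightarrow> (1 * hsum b x - (\<Sum>i<n. b i * (0 * herm (l i) (k i - 1) x))) - hsum b x"
      unfolding r_def cut_field_div_def by (intro tendsto_intros cut1 cd0)
    then show "(\<lambda>m. r m x) \<longlonglongrightarrow> 0" by simp
  qed
  then show ?thesis by (simp add: r_def[abs_def])
qed

proposition hsum_approx_by_divergence:
  assumes N: "N \<ge> 1" and b: "\<And>i. i < n \<Longrightarrow> b i \<noteq> 0 \<Longrightarrow> N \<le> k i" and \<delta>: "\<delta> > 0"
  obtains \<Phi> v where "\<Phi> \<in> FC0_inf_vec \<gamma>" "has_gauss_div \<gamma> \<Phi> v" "L2_norm \<gamma> (\<lambda>x. v x - hsum b x) < \<delta>"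
    "L2_norm \<gamma> (\<lambda>x. cm_norm \<gamma> (\<Phi> x)) \<le> L2_norm \<gamma> (hsum b) / sqrt N"
proof -
  from order_tendstoD(2)[OF cut_field_div_tendsto \<delta>, of b]
  obtain m where m: "L2_norm \<gamma> (\<lambda>x. cut_field_div (real (Suc m)) b x - hsum b x) < \<delta>"
    using eventually_happens'[OF sequentially_bot] by blast
  show ?thesis
  proof (rule that[OF _ _ m])
    show "cut_field (real (Suc m)) b \<in> FC0_inf_vec \<gamma>" by (rule cut_field_FC0) simp
    show "has_gauss_div \<gamma> (cut_field (real (Suc m)) b) (cut_field_div (real (Suc m)) b)"
      using b N by (intro cut_field_has_div) (auto intro: order_trans)
    show "L2_norm \<gamma> (\<lambda>x. cm_norm \<gamma> (cut_field (real (Suc m)) b x)) \<le> L2_norm \<gamma> (hsum b) / sqrt N"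
      by (rule cut_field_norm_le[OF N b]) simp_all
  qed
qed

end

end

end

context radon_gaussian
begin

section \<open>The estimate\<close>

lemma sigma2_upper:
  assumes "\<Phi> \<in> FC0_inf_vec \<gamma>" "has_gauss_div \<gamma> \<Phi> v" "L2_norm \<gamma> v \<le> 1"
    "L2_norm \<gamma> (\<lambda>x. cm_norm \<gamma> (\<Phi> x)) \<le> \<epsilon>"
  shows "ereal (\<integral>x. v x * f x \<partial>\<gamma>) \<le> sigma2 \<gamma> f \<epsilon>"
  unfolding sigma2_def using assms by (intro Sup_upper) blast

lemma sigma2_nonneg:
  assumes "0 \<le> \<epsilon>" shows "0 \<le> sigma2 \<gamma> f \<epsilon>"
proof -
  have "(\<lambda>_. 0) \<in> FC0_inf_vec \<gamma>"
    unfolding FC0_inf_vec_def by (intro CollectI exI[of _ 0]) auto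
  moreover have "has_gauss_div \<gamma> (\<lambda>_. 0) (\<lambda>_. 0)"
  proof -
    have "has_gauss_div \<gamma> (\<lambda>x. \<Sum>i<(0::nat). (0 :: real) *\<^sub>R cm_vector (\<lambda>_. 0)) (\<lambda>x. \<Sum>i<(0::nat). 0 - 0 * 0)"
      by (rule has_gauss_div_sum[where n = 0 and l = "\<lambda>_ _. 0" and F = "\<lambda>_ _. 0" and DF = "\<lambda>_ _ _. 0"]) auto
    then show ?thesis by simp
  qed
  ultimately have "ereal (\<integral>x. 0 * f x \<partial>\<gamma>) \<le> sigma2 \<gamma> f \<epsilon>"
    using assms by (intro sigma2_upper) (auto simp: L2_norm_def cm_norm_zero)
  then show ?thesis by (simp add: zero_ereal_def)
qed

text \<open>For \<open>q\<close> the Hermite sum, test \<open>f\<close> with fields whose divergence approximates \<open>q / \<parallel>q\<parallel>\<close>. The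
  supremum is taken to be finite.\<close>

proposition hsum_inner_le_sigma2:
  fixes n N :: nat
  assumes l: "\<And>i. i < n \<Longrightarrow> l i \<in> top_dual" and N: "N \<ge> 1"
    and b: "\<And>i. i < n \<Longrightarrow> b i \<noteq> 0 \<Longrightarrow> N \<le> k i"
    and f: "f \<in> L2_space \<gamma>" and \<epsilon>: "1 / sqrt N \<le> \<epsilon>" and s: "sigma2 \<gamma> f \<epsilon> = ereal s"
  shows "(\<integral>x. hsum n l k b x * f x \<partial>\<gamma>) \<le> s * L2_norm \<gamma> (hsum n l k b)"
proof -
  define q where "q = hsum n l k b"
  define I where "I = (\<integral>x. q x * f x \<partial>\<gamma>)"
  have qm: "q \<in> moderate" unfolding q_def by (rule hsum_moderate[OF l])
  have "0 \<le> \<epsilon>" using \<epsilon> N by (auto intro: order_trans[of _ "1 / sqrt N"])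
  then have s0: "0 \<le> s" using sigma2_nonneg[of \<epsilon> f] by (simp add: s)
  \<comment> \<open>scale the target strictly inside the unit ball, so that approximations stay in the ball\<close>
  have scaled: "t * I \<le> s" if t: "t > 0" "t * L2_norm \<gamma> q < 1" for t
  proof (rule field_le_epsilon)
    fix e :: real assume e: "e > 0"
    define c where "c i = t * b i" for i
    have hc: "hsum n l k c x = t * q x" for x
      unfolding q_def c_def hsum_def by (simp add: sum_distrib_left mult.assoc)
    have hcn: "L2_norm \<gamma> (hsum n l k c) = t * L2_norm \<gamma> q"
      using L2_norm_cmult[of \<gamma> t q] t(1) by (simp add: hc[abs_def])
    \<comment> \<open>the first bound keeps the divergence in the unit ball, the second one controls the error
      in the integral against \<open>f\<close>\<close>
    define \<delta> where "\<delta> = min (1 - t * L2_norm \<gamma> q) (e / (L2_norm \<gamma> f + 1))"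
    have \<delta>: "\<delta> > 0" "\<delta> \<le> 1 - t * L2_norm \<gamma> q" "\<delta> * L2_norm \<gamma> f \<le> e"
    proof -
      have f1: "L2_norm \<gamma> f + 1 > 0" using L2_norm_nonneg[of \<gamma> f] by simp
      then show "\<delta> > 0" using t e by (simp add: \<delta>_def)
      show "\<delta> \<le> 1 - t * L2_norm \<gamma> q" by (simp add: \<delta>_def)
      have "\<delta> * L2_norm \<gamma> f \<le> (e / (L2_norm \<gamma> f + 1)) * (L2_norm \<gamma> f + 1)"
        using e by (intro mult_mono) (auto simp: \<delta>_def L2_norm_nonneg)
      then show "\<delta> * L2_norm \<gamma> f \<le> e" using f1 by simp
    qed
    have cN: "N \<le> k i" if "i < n" "c i \<noteq> 0" for i using b[OF that(1)] that(2) by (auto simp: c_def)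
    obtain \<Phi> v where v: "\<Phi> \<in> FC0_inf_vec \<gamma>" "has_gauss_div \<gamma> \<Phi> v"
      "L2_norm \<gamma> (\<lambda>x. v x - hsum n l k c x) < \<delta>"
      "L2_norm \<gamma> (\<lambda>x. cm_norm \<gamma> (\<Phi> x)) \<le> L2_norm \<gamma> (hsum n l k c) / sqrt N"
      using hsum_approx_by_divergence[where n = n and l = l and k = k and b = c, OF l N cN \<delta>(1)] by blast
    have vL2: "v \<in> L2_space \<gamma>" using v(2) by (simp add: has_gauss_div_def)
    have hL2: "hsum n l k c \<in> L2_space \<gamma>" by (intro moderate_L2 hsum_moderate l)
    have "L2_norm \<gamma> (\<lambda>x. (v x - hsum n l k c x) + hsum n l k c x) \<le>
        L2_norm \<gamma> (\<lambda>x. v x - hsum n l k c x) + L2_norm \<gamma> (hsum n l k c)"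
      by (intro L2_norm_triangle L2_diff vL2 hL2)
    then have v1: "L2_norm \<gamma> v \<le> 1" using v(3) \<delta>(2) hcn by simp
    have "L2_norm \<gamma> (hsum n l k c) / sqrt N \<le> 1 / sqrt N"
      using t(2) hcn by (intro divide_right_mono) auto
    then have "L2_norm \<gamma> (\<lambda>x. cm_norm \<gamma> (\<Phi> x)) \<le> \<epsilon>" using v(4) \<epsilon> by linarith
    from sigma2_upper[OF v(1,2) v1 this, of f] have vs: "(\<integral>x. v x * f x \<partial>\<gamma>) \<le> s" by (simp add: s)
    have "t * I = (\<integral>x. hsum n l k c x * f x \<partial>\<gamma>)" by (simp add: I_def hc mult.assoc)
    also have "\<dots> = (\<integral>x. v x * f x \<partial>\<gamma>) - (\<integral>x. (v x - hsum n l k c x) * f x \<partial>\<gamma>)"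
      using L2_integrable_mult[OF vL2 f] L2_integrable_mult[OF hL2 f] by (simp add: left_diff_distrib)
    also have "\<dots> \<le> s + \<delta> * L2_norm \<gamma> f"
    proof -
      have "\<bar>\<integral>x. (v x - hsum n l k c x) * f x \<partial>\<gamma>\<bar> \<le> L2_norm \<gamma> (\<lambda>x. v x - hsum n l k c x) * L2_norm \<gamma> f"
        by (rule L2_Cauchy_Schwarz[OF L2_diff[OF vL2 hL2] f])
      also have "\<dots> \<le> \<delta> * L2_norm \<gamma> f" using v(3) by (intro mult_right_mono) (auto simp: L2_norm_nonneg)
      finally show ?thesis using vs by linarith
    qed
    finally show "t * I \<le> s + e" using \<delta>(3) by linarith
  qed
  have "I \<le> s * L2_norm \<gamma> q"
  proof (rule field_le_epsilon)
    fix e :: real assume e: "e > 0"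
    define \<eta> where "\<eta> = e / (s + 1)"
    have \<eta>: "\<eta> > 0" "s * \<eta> \<le> e" using e s0 by (auto simp: \<eta>_def field_simps)
    have pos: "L2_norm \<gamma> q + \<eta> > 0" using \<eta>(1) L2_norm_nonneg[of \<gamma> q] by linarith
    have "(1 / (L2_norm \<gamma> q + \<eta>)) * I \<le> s"
      using pos \<eta>(1) by (intro scaled) auto
    then have "I \<le> s * (L2_norm \<gamma> q + \<eta>)" using pos by (simp add: field_simps)
    then show "I \<le> s * L2_norm \<gamma> q + e" using \<eta>(2) by (simp add: distrib_left)
  qed
  then show ?thesis by (simp add: I_def q_def)
qed

text \<open>Approximate \<open>f\<close> by a Hermite sum and split the latter into its terms \<open>u\<close> of degree less than \<open>N\<close> and
  the remaining terms \<open>q\<close>. As \<open>q\<close> is orthogonal to \<open>u\<close>, the integral of \<open>q f\<close> is almost \<open>\<parallel>q\<parallel>\<^sup>2\<close>, so \<open>\<parallel>q\<parallel>\<close> is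
  almost bounded by the supremum; and \<open>\<parallel>q\<parallel>\<close> is almost the distance from \<open>f\<close> to \<open>u\<close>.\<close>

theorem best_approx_le_sigma2:
  assumes f: "f \<in> L2_space \<gamma>" and N: "N \<ge> 1" and \<epsilon>: "1 / sqrt N \<le> \<epsilon>"
  shows "best_approx \<gamma> N f \<le> sigma2 \<gamma> f \<epsilon>"
proof (cases "sigma2 \<gamma> f \<epsilon>")
  case (real s)
  have "0 \<le> \<epsilon>" using \<epsilon> N by (auto intro: order_trans[of _ "1 / sqrt N"])
  then have s0: "0 \<le> s" using sigma2_nonneg[of \<epsilon> f] by (simp add: real)
  have "best_approx \<gamma> N f \<le> ereal s + ereal e" if e: "e > 0" for e
  proof -
    have "f \<in> herm_closure" by (rule herm_span_dense[OF f])
    then obtain p where p: "p \<in> herm_span" "L2_norm \<gamma> (\<lambda>x. f x - p x) < e / 2"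
      using e unfolding herm_closure_def by (auto elim!: allE[of _ "e / 2"])
    obtain n :: nat and c l k where l: "\<And>i. i < n \<Longrightarrow> l i \<in> top_dual"
      and pc: "p = (\<lambda>x. \<Sum>i<n. c i * herm (l i) (k i) x)"
      using herm_span_repr[OF p(1)] by metis
    define a where "a i = (if k i < N then c i else 0)" for i
    define b where "b i = (if k i < N then 0 else c i)" for i
    let ?u = "hsum n l k a" and ?q = "hsum n l k b"
    have um: "?u \<in> moderate" and qm: "?q \<in> moderate" by (auto intro: hsum_moderate l)
    have pq: "p x = ?u x + ?q x" for x
      unfolding pc hsum_def sum.distrib[symmetric] by (intro sum.cong) (auto simp: a_def b_def)
    have u: "?u \<in> chaos_sum \<gamma> N"
      by (rule hsum_low_degree_chaos_sum[OF l]) (auto simp: a_def split: if_splits)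
    have bN: "N \<le> k i" if "i < n" "b i \<noteq> 0" for i using that by (auto simp: b_def split: if_splits)
    have orth: "(\<integral>x. ?q x * ?u x \<partial>\<gamma>) = 0"
    proof (rule trans[OF hsum_inner[where n = n and l = l and k = k and b = b and c = a, OF l]])
      show "(\<Sum>i<n. \<Sum>j<n. b i * a j * (of_bool (k i = k j) * fact (k j) * cov (l i) (l j) ^ k j)) = 0"
        by (intro sum.neutral ballI) (auto simp: a_def b_def)
    qed
    have pm: "p \<in> L2_space \<gamma>" by (rule herm_span_L2[OF p(1)])
    define Q where "Q = L2_norm \<gamma> ?q"
    have Q0: "Q \<ge> 0" by (simp add: Q_def L2_norm_nonneg)
    have qL2: "?q \<in> L2_space \<gamma>" and uL2: "?u \<in> L2_space \<gamma>" using um qm by (auto intro: moderate_L2)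
    have "Q\<^sup>2 - Q * (e / 2) \<le> (\<integral>x. ?q x * f x \<partial>\<gamma>)"
    proof -
      have "(\<integral>x. ?q x * f x \<partial>\<gamma>) = (\<integral>x. ?q x * ?q x + ?q x * ?u x + ?q x * (f x - p x) \<partial>\<gamma>)"
        by (simp add: pq algebra_simps)
      also have "\<dots> = (\<integral>x. ?q x * ?q x \<partial>\<gamma>) + (\<integral>x. ?q x * ?u x \<partial>\<gamma>) + (\<integral>x. ?q x * (f x - p x) \<partial>\<gamma>)"
        using L2_integrable_mult[OF qL2 qL2] L2_integrable_mult[OF qL2 uL2] L2_integrable_mult[OF qL2 L2_diff[OF f pm]]
        by simp
      also have "\<dots> = Q\<^sup>2 + (\<integral>x. ?q x * (f x - p x) \<partial>\<gamma>)"
        by (simp add: orth Q_def L2_norm_square power2_eq_square[of "?q _"])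
      finally have eq: "(\<integral>x. ?q x * f x \<partial>\<gamma>) = Q\<^sup>2 + (\<integral>x. ?q x * (f x - p x) \<partial>\<gamma>)" .
      have "\<bar>\<integral>x. ?q x * (f x - p x) \<partial>\<gamma>\<bar> \<le> Q * L2_norm \<gamma> (\<lambda>x. f x - p x)"
        unfolding Q_def by (rule L2_Cauchy_Schwarz[OF qL2 L2_diff[OF f pm]])
      also have "\<dots> \<le> Q * (e / 2)" using p(2) Q0 by (intro mult_left_mono) auto
      finally show ?thesis using eq by linarith
    qed
    also have "(\<integral>x. ?q x * f x \<partial>\<gamma>) \<le> s * Q"
      unfolding Q_def by (rule hsum_inner_le_sigma2[where n = n and l = l and k = k, OF l N bN f \<epsilon> real])
    finally have "Q * Q \<le> (s + e / 2) * Q" by (simp add: power2_eq_square algebra_simps)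
    then have Qs: "Q \<le> s + e / 2"
    proof (cases "Q = 0")
      case False
      then show ?thesis using \<open>Q * Q \<le> (s + e / 2) * Q\<close> Q0 by (simp add: mult_le_cancel_right)
    qed (use s0 e in simp)
    have "L2_norm \<gamma> (\<lambda>x. (f x - p x) + ?q x) \<le> L2_norm \<gamma> (\<lambda>x. f x - p x) + Q"
      unfolding Q_def by (intro L2_norm_triangle L2_diff f pm qL2)
    also have "\<dots> \<le> s + e" using p(2) Qs by linarith
    also have "(\<lambda>x. (f x - p x) + ?q x) = (\<lambda>x. f x - ?u x)" by (simp add: pq fun_eq_iff)
    finally have "ereal (L2_norm \<gamma> (\<lambda>x. f x - ?u x)) \<le> ereal s + ereal e" by simp
    moreover have "best_approx \<gamma> N f \<le> ereal (L2_norm \<gamma> (\<lambda>x. f x - ?u x))"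
      unfolding best_approx_def by (rule INF_lower[OF u])
    ultimately show ?thesis by (rule order_trans[rotated])
  qed
  then have "best_approx \<gamma> N f \<le> ereal s" by (rule ereal_le_epsilon2[rule_format])
  then show ?thesis by (simp only: real)
next
  case MInf
  have "0 \<le> \<epsilon>" using \<epsilon> N by (auto intro: order_trans[of _ "1 / sqrt N"])
  then show ?thesis using sigma2_nonneg[of \<epsilon> f] MInf by simp
qed simp

end

theorem theorem4p9:
  fixes \<gamma> :: "'a::hausdorff_locally_convex measure" and f :: "'a \<Rightarrow> real" and N :: nat
  assumes "radon_measure \<gamma>" and "centered_gaussian \<gamma>"
    and "f \<in> L2_space \<gamma>" and "N \<ge> 1"
  shows "best_approx \<gamma> N f \<le> sigma2 \<gamma> f (sqrt (2 * pi) * real N powr (- 1 / 2))"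
proof -
  interpret radon_gaussian \<gamma> by (rule radon_gaussian.intro) fact+
  have "real N powr (- 1 / 2) = 1 / sqrt N"
    using assms(4) by (simp add: powr_minus_divide powr_half_sqrt)
  moreover have "1 \<le> sqrt (2 * pi)" using pi_ge_two by simp
  then have "1 / sqrt N \<le> sqrt (2 * pi) * (1 / sqrt N)"
    using mult_right_mono[of 1 "sqrt (2 * pi)" "1 / sqrt N"] by simp
  ultimately show ?thesis by (intro best_approx_le_sigma2 assms) simp
qed

end
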